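(* Let $u\in L^2([0,1],V)$ be a velocity field satisfying the standing assumption on velocities (see context), and let $G_h\subset G(\mathbf b;\Omega)$ be the conforming finite element space described in the context, with $\mathring G_h=G_h\cap\mathring G(\mathbf b;\Omega)$. Let $g_h\in G_h$ and put $I_i^h=g_h|_{\Gamma_i}$, $i=0,1$. Then the discrete problem $$\text{find } I_h\in G_h:\quad \langle\mathbf b\cdot\nabla_t I_h,\ \mathbf b\cdot\nabla_t\delta I\rangle_{0,\Omega}=0\ \ \text{for all }\delta I\in\mathring G_h,\qquad I_h|_{\Gamma_i}=I_i^h,\ i=0,1,$$ is well-posed: it has a unique solution $I_h$, which depends continuously on the boundary data $(I_0^h,I_1^h)$.
   Context: Domains: $\omega=[0,1]^d$ is the spatial domain (either periodic in all $d$ directions, i.e. a flat torus, or non-periodic), $\Omega=[0,1]\times\omega$ is the space-time domain with points written $(x,t)$, $x\in\omega$, $t\in[0,1]$. $\Gamma_0,\Gamma_1$ are the faces $t=0$ and $t=1$ of $\Omega$, each identified with $\omega$, and $\Gamma=\Gamma_0\cup\Gamma_1$. $\|\cdot\|_{0,\Omega}$ and $\langle\cdot,\cdot\rangle_{0,\Omega}$ are the norm and inner product of $L^2(\Omega)$. Standing assumption on velocities: $V$ is a space of Lipschitz vector fields on $\omega$, continuously embedded in $W^{1,\infty}(\omega)^d$ (concretely, the paper uses fields with finite norm $\|v\|_V^2=\langle Lv,v\rangle$, $L=(\mathrm{id}-\alpha^2\Delta)^3$, an $H^3$-type norm). $u\in L^2([0,1],V)$ means $u(\cdot,t)\in V$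 for $t\in[0,1]$ and $t\mapsto\|u(\cdot,t)\|_V$ is in $L^2([0,1])$. If $\omega$ is not periodic, additionally $u(\cdot,t)\in H^1_0(\omega)\cap W^{1,\infty}(\omega)$ (componentwise). The flow $\varphi:[0,1]\to\mathrm{Diff}(\omega)$ is the unique solution of $\dot\varphi_t(\hat x)=u(\varphi_t(\hat x),t)$, $\varphi_0=\mathrm{id}$. Write $\mathbf b=(u,1)^\top$ and $\mathbf b\cdot\nabla_t f=\partial_t f+u\cdot\nabla f$ (weak sense). Set $\|f\|_{G(\mathbf b;\Omega)}^2=\|f\|_{0,\Omega}^2+\|\mathbf b\cdot\nabla_t f\|_{0,\Omega}^2$, and $G(\mathbf b;\Omega)=\{f\in L^2(\Omega): \|f\|_{G(\mathbf b;\Omega)}<\infty\}$. $\mathring G(\mathbf b;\Omega)$ is the subspace of functions with zero trace on $\Gamma$. $G_h$ is the finite-dimensional space of globally continuous functions that are piecewise affine ($\mathcal P^1$) on each cell of a shape-regular quasi-uniform triangulation $\Omega_h$ of $\Omega$. In the paper, $g_h\in G_h$ is a projection of an extension $g\in G(\mathbf b;\Omega)$ of given boundary data, defined by $\langle\mathbf b\cdot\nabla_t(g_h-g),\mathbf b\cdot\nabla_t\delta I\rangle_{0,\Omega}=0$ for all $\delta I\in G_h$. *)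

theory Defs
  imports "HOL-Analysis.Analysis" "HOL-Probability.Essential_Supremum"
begin

section \<open>Domains\<close>

text \<open>
  The flag \<open>per\<close> selects the periodic case.  Functions on the flat torus are represented by
  functions on \<open>real^'d\<close> that are invariant under integer translations, so there the
  spatial domain is the whole covering space; integrals are always taken over the unit cell.
\<close>

definition unit_cell :: "(real^'d) set" where
  "unit_cell = cbox 0 1"

definition spat :: "bool \<Rightarrow> (real^'d) set" where
  "spat per = (if per then UNIV else unit_cell)"

definition spacetime :: "bool \<Rightarrow> ((real^'d) \<times> real) set" where
  "spacetime per = spat per \<times> {0..1}"

definition Omega :: "((real^'d) \<times> real) set" where
  "Omega = unit_cell \<times> {0..1}"

definition lattice_vectors :: "(real^'d) set" where
  "lattice_vectors = {k. \<forall>i. k $ i \<in> \<int>}"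

definition periodic :: "(real^'d \<Rightarrow> 'b) \<Rightarrow> bool" where
  "periodic f \<longleftrightarrow> (\<forall>k\<in>lattice_vectors. \<forall>x. f (x + k) = f x)"

section \<open>Square-integrable functions\<close>

definition L2 :: "'a::euclidean_space set \<Rightarrow> ('a \<Rightarrow> 'b::euclidean_space) set" where
  "L2 S = {f. f \<in> borel_measurable (lebesgue_on S) \<and>
              integrable (lebesgue_on S) (\<lambda>z. (norm (f z))\<^sup>2)}"

definition L2_inner ::
    "'a::euclidean_space set \<Rightarrow> ('a \<Rightarrow> real) \<Rightarrow> ('a \<Rightarrow> real) \<Rightarrow> real" where
  "L2_inner S f g = (LINT z|lebesgue_on S. f z * g z)"

definition L2_norm ::
    "'a::euclidean_space set \<Rightarrow> ('a \<Rightarrow> 'b::euclidean_space) \<Rightarrow> real" where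
  "L2_norm S f = sqrt (LINT z|lebesgue_on S. (norm (f z))\<^sup>2)"

section \<open>Test functions\<close>

text \<open>
  Test functions come with their gradient.  Weak derivatives are tested with compactly supported
  \<open>C\<^sup>1\<close> functions; by mollification this gives the same weak derivatives as testing with
  smooth functions.
\<close>

definition C1_with_grad :: "('a::euclidean_space \<Rightarrow> real) \<Rightarrow> ('a \<Rightarrow> 'a) \<Rightarrow> bool" where
  "C1_with_grad \<phi> D \<longleftrightarrow> (\<forall>z. GDERIV \<phi> z :> D z) \<and> continuous_on UNIV D"

definition space_test ::
    "bool \<Rightarrow> (real^'d \<Rightarrow> real) \<Rightarrow> (real^'d \<Rightarrow> real^'d) \<Rightarrow> bool" where
  "space_test per \<psi> D \<longleftrightarrow> C1_with_grad \<psi> D \<and>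
     (if per then periodic \<psi>
      else (\<exists>K. compact K \<and> K \<subseteq> interior unit_cell \<and> (\<forall>x. x \<notin> K \<longrightarrow> \<psi> x = 0)))"

text \<open>No condition at the faces \<open>t = 0\<close> and \<open>t = 1\<close>; the gradient is the pair of the spatial
  gradient and the time derivative.\<close>

definition spacetime_test ::
    "bool \<Rightarrow> ((real^'d) \<times> real \<Rightarrow> real) \<Rightarrow> ((real^'d) \<times> real \<Rightarrow> (real^'d) \<times> real) \<Rightarrow> bool" where
  "spacetime_test per \<phi> D \<longleftrightarrow> C1_with_grad \<phi> D \<and>
     (if per then (\<forall>t. periodic (\<lambda>x. \<phi> (x, t)))
      else (\<exists>K. compact K \<and> K \<subseteq> interior unit_cell \<and> (\<forall>x t. x \<notin> K \<longrightarrow> \<phi> (x, t) = 0)))"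

definition spacetime_test0 ::
    "bool \<Rightarrow> ((real^'d) \<times> real \<Rightarrow> real) \<Rightarrow> ((real^'d) \<times> real \<Rightarrow> (real^'d) \<times> real) \<Rightarrow> bool" where
  "spacetime_test0 per \<phi> D \<longleftrightarrow> spacetime_test per \<phi> D \<and>
     (\<exists>J. compact J \<and> J \<subseteq> {0<..<1} \<and> (\<forall>x t. t \<notin> J \<longrightarrow> \<phi> (x, t) = 0))"

section \<open>Sobolev spaces on the spatial domain\<close>

text \<open>\<open>A x $ i $ j\<close> is the weak partial derivative of the \<open>i\<close>-th component in direction \<open>j\<close>.\<close>

definition has_weak_jac ::
    "bool \<Rightarrow> (real^'d \<Rightarrow> real^'d) \<Rightarrow> (real^'d \<Rightarrow> real^'d^'d) \<Rightarrow> bool" where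
  "has_weak_jac per v A \<longleftrightarrow> integrable (lebesgue_on unit_cell) A \<and>
     (\<forall>\<psi> D. space_test per \<psi> D \<longrightarrow> (\<forall>i j.
        (LINT x|lebesgue_on unit_cell. v x $ i * D x $ j) =
        - (LINT x|lebesgue_on unit_cell. A x $ i $ j * \<psi> x)))"

text \<open>Determined almost everywhere on the unit cell whenever a weak Jacobian exists.\<close>

definition weak_jac :: "bool \<Rightarrow> (real^'d \<Rightarrow> real^'d) \<Rightarrow> real^'d \<Rightarrow> real^'d^'d" where
  "weak_jac per v = (SOME A. has_weak_jac per v A)"

definition weak_div :: "bool \<Rightarrow> (real^'d \<Rightarrow> real^'d) \<Rightarrow> real^'d \<Rightarrow> real" where
  "weak_div per v x = trace (weak_jac per v x)"

definition W1inf_norm :: "bool \<Rightarrow> (real^'d \<Rightarrow> real^'d) \<Rightarrow> ereal" where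
  "W1inf_norm per v = esssup (lebesgue_on unit_cell) (\<lambda>x. ereal (norm (v x))) +
                      esssup (lebesgue_on unit_cell) (\<lambda>x. ereal (norm (weak_jac per v x)))"

definition W1inf :: "bool \<Rightarrow> (real^'d \<Rightarrow> real^'d) set" where
  "W1inf per = {v. v \<in> borel_measurable (lebesgue_on unit_cell) \<and>
                   (\<exists>A. has_weak_jac per v A) \<and> W1inf_norm per v < \<infinity>}"

text \<open>Closure of the compactly supported test functions in \<open>H\<^sup>1\<close> (non-periodic domain only);
  the \<open>L\<^sup>2\<close> limit \<open>g\<close> of the gradients is automatically the weak gradient of \<open>f\<close>.\<close>

definition H10 :: "(real^'d \<Rightarrow> real) set" where
  "H10 = {f. f \<in> L2 unit_cell \<and>
     (\<exists>g\<in>L2 unit_cell. \<exists>\<psi> D. (\<forall>n::nat. space_test False (\<psi> n) (D n)) \<and>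
        (\<lambda>n. L2_norm unit_cell (\<lambda>x. \<psi> n x - f x)) \<longlonglongrightarrow> 0 \<and>
        (\<lambda>n. L2_norm unit_cell (\<lambda>x. D n x - g x)) \<longlonglongrightarrow> 0)}"

section \<open>Velocity fields\<close>

text \<open>
  A normed space \<open>V\<close> of Lipschitz vector fields, continuously embedded in \<open>W\<^bsup>1,\<infinity>\<^esup>\<close>.
  Completeness is not required.
\<close>

definition velocity_space ::
    "bool \<Rightarrow> (real^'d \<Rightarrow> real^'d) set \<Rightarrow> ((real^'d \<Rightarrow> real^'d) \<Rightarrow> real) \<Rightarrow> bool" where
  "velocity_space per V normV \<longleftrightarrow>
     (\<lambda>x. 0) \<in> V \<and>
     (\<forall>v\<in>V. \<forall>w\<in>V. (\<lambda>x. v x + w x) \<in> V \<and> normV (\<lambda>x. v x + w x) \<le> normV v + normV w) \<and>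
     (\<forall>c. \<forall>v\<in>V. (\<lambda>x. c *\<^sub>R v x) \<in> V \<and> normV (\<lambda>x. c *\<^sub>R v x) = \<bar>c\<bar> * normV v) \<and>
     (\<forall>v\<in>V. normV v = 0 \<longrightarrow> (\<forall>x\<in>spat per. v x = 0)) \<and>
     (\<forall>v\<in>V. (per \<longrightarrow> periodic v) \<and> (\<exists>L. L-lipschitz_on (spat per) v) \<and> v \<in> W1inf per) \<and>
     (\<exists>C. \<forall>v\<in>V. W1inf_norm per v \<le> ereal (C * normV v))"

text \<open>Instead of strong (Bochner) measurability into \<open>V\<close>, only the weaker joint measurability of
  \<open>(x, t) \<mapsto> u(x, t)\<close> is demanded; the embedding of \<open>V\<close> shows that the former implies the latter.\<close>

definition L2_time ::
    "(real^'d \<Rightarrow> real^'d) set \<Rightarrow> ((real^'d \<Rightarrow> real^'d) \<Rightarrow> real) \<Rightarrow> (real^'d \<Rightarrow> real \<Rightarrow> real^'d) set" where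
  "L2_time V normV = {u. (\<lambda>z. u (fst z) (snd z)) \<in> borel_measurable (lebesgue_on Omega) \<and>
     (\<forall>t\<in>{0..1}. (\<lambda>x. u x t) \<in> V) \<and> (\<lambda>t. normV (\<lambda>x. u x t)) \<in> L2 {0..1}}"

definition admissible_velocity ::
    "bool \<Rightarrow> (real^'d \<Rightarrow> real^'d) set \<Rightarrow> ((real^'d \<Rightarrow> real^'d) \<Rightarrow> real) \<Rightarrow>
     (real^'d \<Rightarrow> real \<Rightarrow> real^'d) \<Rightarrow> bool" where
  "admissible_velocity per V normV u \<longleftrightarrow> u \<in> L2_time V normV \<and>
     (\<not> per \<longrightarrow> (\<forall>t\<in>{0..1}. (\<forall>i. (\<lambda>x. u x t $ i) \<in> H10) \<and> (\<lambda>x. u x t) \<in> W1inf per))"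

section \<open>The graph space of the transport operator\<close>

definition bvec :: "(real^'d \<Rightarrow> real \<Rightarrow> real^'d) \<Rightarrow> (real^'d) \<times> real \<Rightarrow> (real^'d) \<times> real" where
  "bvec u z = (u (fst z) (snd z), 1)"

text \<open>
  The pairing of \<open>f\<close> with the space-time divergence of \<open>\<phi> \<cdot> bvec u\<close>, i.e. with
  \<open>\<partial>\<^sub>t\<phi> + u \<cdot> \<nabla>\<phi> + \<phi> div u\<close>.  The integral is iterated because the weak divergence is only
  chosen slice by slice; the inner integral does not depend on that choice.
\<close>

definition adjoint_pairing ::
    "bool \<Rightarrow> (real^'d \<Rightarrow> real \<Rightarrow> real^'d) \<Rightarrow> ((real^'d) \<times> real \<Rightarrow> real) \<Rightarrow>
     ((real^'d) \<times> real \<Rightarrow> real) \<Rightarrow> ((real^'d) \<times> real \<Rightarrow> (real^'d) \<times> real) \<Rightarrow> real" where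
  "adjoint_pairing per u f \<phi> D =
     (LINT t|lebesgue_on {0..1}. LINT x|lebesgue_on unit_cell.
        f (x, t) * (bvec u (x, t) \<bullet> D (x, t) + weak_div per (\<lambda>y. u y t) x * \<phi> (x, t)))"

definition has_transport_deriv ::
    "bool \<Rightarrow> (real^'d \<Rightarrow> real \<Rightarrow> real^'d) \<Rightarrow> ((real^'d) \<times> real \<Rightarrow> real) \<Rightarrow>
     ((real^'d) \<times> real \<Rightarrow> real) \<Rightarrow> bool" where
  "has_transport_deriv per u f w \<longleftrightarrow> w \<in> L2 Omega \<and>
     (\<forall>\<phi> D. spacetime_test0 per \<phi> D \<longrightarrow> adjoint_pairing per u f \<phi> D = - L2_inner Omega w \<phi>)"

definition transport_deriv ::
    "bool \<Rightarrow> (real^'d \<Rightarrow> real \<Rightarrow> real^'d) \<Rightarrow> ((real^'d) \<times> real \<Rightarrow> real) \<Rightarrow>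
     (real^'d) \<times> real \<Rightarrow> real" where
  "transport_deriv per u f = (SOME w. has_transport_deriv per u f w)"

definition G_space ::
    "bool \<Rightarrow> (real^'d \<Rightarrow> real \<Rightarrow> real^'d) \<Rightarrow> ((real^'d) \<times> real \<Rightarrow> real) set" where
  "G_space per u = {f \<in> L2 Omega. \<exists>w. has_transport_deriv per u f w}"

definition G_norm ::
    "bool \<Rightarrow> (real^'d \<Rightarrow> real \<Rightarrow> real^'d) \<Rightarrow> ((real^'d) \<times> real \<Rightarrow> real) \<Rightarrow> real" where
  "G_norm per u f = sqrt ((L2_norm Omega f)\<^sup>2 + (L2_norm Omega (transport_deriv per u f))\<^sup>2)"

text \<open>
  Traces on the faces \<open>t = 0\<close> and \<open>t = 1\<close>, where the normal component of \<open>bvec u\<close> is \<open>-1\<close> and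
  \<open>1\<close>, defined by Green's formula.  The lateral boundary does not contribute: \<open>u\<close> vanishes there
  (and so do the test functions), or there is none.
\<close>

definition has_trace ::
    "bool \<Rightarrow> (real^'d \<Rightarrow> real \<Rightarrow> real^'d) \<Rightarrow> ((real^'d) \<times> real \<Rightarrow> real) \<Rightarrow>
     (real^'d \<Rightarrow> real) \<Rightarrow> (real^'d \<Rightarrow> real) \<Rightarrow> bool" where
  "has_trace per u f f0 f1 \<longleftrightarrow> f0 \<in> L2 unit_cell \<and> f1 \<in> L2 unit_cell \<and>
     (\<forall>\<phi> D. spacetime_test per \<phi> D \<longrightarrow>
        adjoint_pairing per u f \<phi> D + L2_inner Omega (transport_deriv per u f) \<phi> =
        L2_inner unit_cell f1 (\<lambda>x. \<phi> (x, 1)) - L2_inner unit_cell f0 (\<lambda>x. \<phi> (x, 0)))"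

definition G0_space ::
    "bool \<Rightarrow> (real^'d \<Rightarrow> real \<Rightarrow> real^'d) \<Rightarrow> ((real^'d) \<times> real \<Rightarrow> real) set" where
  "G0_space per u = {f \<in> G_space per u. has_trace per u f (\<lambda>x. 0) (\<lambda>x. 0)}"

section \<open>Finite elements\<close>

text \<open>
  A conforming simplicial mesh.  In the periodic case it is the lift to the covering space of a
  mesh of the torus, hence invariant under lattice translations, so that cells may cross the
  boundary of the unit cell.  In the non-periodic case local finiteness says that it is finite.
\<close>

definition mesh :: "bool \<Rightarrow> ((real^'d) \<times> real) set set \<Rightarrow> bool" where
  "mesh per T \<longleftrightarrow>
     (\<forall>K\<in>T. int DIM((real^'d) \<times> real) simplex K) \<and>
     (\<forall>K\<in>T. \<forall>K'\<in>T. (K \<inter> K') face_of K) \<and>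
     \<Union>T = spacetime per \<and>
     finite {K\<in>T. K \<inter> Omega \<noteq> {}} \<and>
     (per \<longrightarrow> (\<forall>K\<in>T. \<forall>k\<in>lattice_vectors. (\<lambda>z. z + (k, 0)) ` K \<in> T))"

definition inradius :: "'a::euclidean_space set \<Rightarrow> real" where
  "inradius K = Sup {r. 0 \<le> r \<and> (\<exists>z. cball z r \<subseteq> K)}"

definition shape_regular :: "real \<Rightarrow> 'a::euclidean_space set set \<Rightarrow> bool" where
  "shape_regular \<sigma> T \<longleftrightarrow> (\<forall>K\<in>T. diameter K \<le> \<sigma> * inradius K)"

definition quasi_uniform :: "real \<Rightarrow> 'a::euclidean_space set set \<Rightarrow> bool" where
  "quasi_uniform \<tau> T \<longleftrightarrow> (\<forall>K\<in>T. \<forall>K'\<in>T. diameter K \<le> \<tau> * diameter K')"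

definition Gh :: "bool \<Rightarrow> ((real^'d) \<times> real) set set \<Rightarrow> ((real^'d) \<times> real \<Rightarrow> real) set" where
  "Gh per T = {f. continuous_on (spacetime per) f \<and>
     (\<forall>K\<in>T. \<exists>a c. \<forall>z\<in>K. f z = a \<bullet> z + c) \<and>
     (per \<longrightarrow> (\<forall>t\<in>{0..1}. periodic (\<lambda>x. f (x, t))))}"

definition Gh0 ::
    "bool \<Rightarrow> (real^'d \<Rightarrow> real \<Rightarrow> real^'d) \<Rightarrow> ((real^'d) \<times> real) set set \<Rightarrow>
     ((real^'d) \<times> real \<Rightarrow> real) set" where
  "Gh0 per u T = Gh per T \<inter> G0_space per u"

text \<open>The boundary data \<open>I0\<close>, \<open>I1\<close> are continuous functions on the faces, attained pointwise.\<close>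

definition discrete_solution ::
    "bool \<Rightarrow> (real^'d \<Rightarrow> real \<Rightarrow> real^'d) \<Rightarrow> ((real^'d) \<times> real) set set \<Rightarrow>
     (real^'d \<Rightarrow> real) \<Rightarrow> (real^'d \<Rightarrow> real) \<Rightarrow> ((real^'d) \<times> real \<Rightarrow> real) \<Rightarrow> bool" where
  "discrete_solution per u T I0 I1 Ih \<longleftrightarrow> Ih \<in> Gh per T \<and>
     (\<forall>dI\<in>Gh0 per u T.
        L2_inner Omega (transport_deriv per u Ih) (transport_deriv per u dI) = 0) \<and>
     (\<forall>x\<in>spat per. Ih (x, 0) = I0 x \<and> Ih (x, 1) = I1 x)"

end

theory Submission
  imports Defs
begin

text \<open>
  The discrete problem is a finite-dimensional linear system, so it is solved by linear algebra once
  one fact of analysis is known: the semidefinite form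
  \<open>a(f, g) = \<langle>b \<cdot> \<nabla>f, b \<cdot> \<nabla>g\<rangle>\<close> is definite on the finite element functions with zero trace.  Existence is
  an orthogonal projection: subtract from \<open>gh\<close> its \<open>a\<close>-projection onto \<open>Gh0\<close>
  (\<open>orthogonal_projection_exists\<close>, \<open>solution_exists\<close>); this works for a semidefinite form.  Uniqueness is the
  definiteness itself, applied to the difference of two solutions.  For the continuous dependence, the
  differences of solutions lie in the space of those \<open>f\<close> in \<open>Gh\<close> that are \<open>a\<close>-orthogonal to \<open>Gh0\<close>.  There the
  \<open>L\<^sup>2\<close> norm of the face values controls the graph norm, because a function in it with zero face values lies
  in \<open>Gh0\<close>, is orthogonal to itself, and hence vanishes; in finite dimension the implication between null
  spaces is an inequality between the forms (\<open>psd_form_comparison\<close>).  The constant obtained in this way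
  depends on the mesh and on \<open>u\<close>.

  Definiteness is a uniqueness theorem for the transport equation (\<open>transport_uniqueness\<close>).  If
  \<open>\<partial>\<^sub>t f + u \<cdot> \<nabla>f = 0\<close> and \<open>f\<close> vanishes at \<open>t = 0\<close>, the energy \<open>e(t) = \<integral>f(x, t)\<^sup>2 dx\<close> satisfies
  \<open>e(s) \<le> \<integral>\<^sub>0\<^sup>s C \<parallel>u(t)\<parallel>\<^sub>V e(t) dt\<close>, since integrating \<open>u \<cdot> \<nabla>(f\<^sup>2)\<close> by parts leaves the divergence of \<open>u\<close>, which the
  embedding of \<open>V\<close> bounds; Gronwall's argument gives \<open>e = 0\<close>.

  The rest connects the weak notions with pointwise ones.  A function in \<open>Gh\<close> is Lipschitz and has a
  gradient off the faces of the mesh, and Green's formula (\<open>green\<close>) holds for it with this gradient.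
  Together with the fundamental lemma of the calculus of variations it shows that \<open>Gh\<close> is contained in
  the graph space, that the weak transport derivative is the classical one almost everywhere, and that
  the trace is the restriction to the faces.  Green's formula follows from the fundamental theorem in
  time and from an integration by parts in space for almost every fixed \<open>t\<close>.

  The integration by parts (\<open>space_integration_by_parts\<close>) is the delicate point: the weak Jacobian of \<open>u\<close> is
  tested with \<open>C\<^sup>1\<close> functions only, whereas products of finite element functions are merely Lipschitz.
  In the periodic case the Lipschitz function is mollified.  Otherwise each component of \<open>u\<close> is a limit in \<open>H\<^sup>1\<close>
  of compactly supported \<open>C\<^sup>1\<close> functions, for which the formula holds by translation invariance of the
  integral; the limit of their gradients is the weak Jacobian by the fundamental lemma.
\<close>


section \<open>Integration over measurable sets\<close>

text \<open>In this way the inner integral of the adjoint pairing, which contains a divergence chosen slice by slice,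
  becomes measurable in time: it agrees almost everywhere with a measurable function.\<close>

lemma complete_AE_measurable:
  fixes f g :: "'a \<Rightarrow> 'b::topological_space"
  assumes M: "complete_measure M" and f: "f \<in> borel_measurable M" and ae: "AE x in M. f x = g x"
  shows "g \<in> borel_measurable M"
proof (rule measurableI)
  fix A :: "'b set" assume A: "A \<in> sets borel"
  have "f -` A \<inter> space M \<in> sets M"
    using f A by (rule measurable_sets)
  moreover have "AE x in M. x \<in> f -` A \<inter> space M \<longleftrightarrow> x \<in> g -` A \<inter> space M"
    using ae by eventually_elim auto
  ultimately show "g -` A \<inter> space M \<in> sets M"
    using complete_measure.in_sets_AE[OF M, of "f -` A \<inter> space M" "g -` A \<inter> space M"] by blast
qed simp

lemma complete_measure_lebesgue_on:
  fixes S :: "'a::euclidean_space set"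
  assumes "S \<in> sets lebesgue"
  shows "complete_measure (lebesgue_on S)"
proof
  fix A B :: "'a set" assume "B \<subseteq> A" "A \<in> null_sets (lebesgue_on S)"
  then show "B \<in> sets (lebesgue_on S)"
    using assms null_sets_restrict_space[OF assms]
    by (metis completion.complete2 null_setsD2 subset_trans)
qed

text \<open>Completeness carries measurability from either function to the other, so both sides are integrals of
  measurable functions or both have the default value zero.\<close>

lemma integral_cong_AE_lebesgue_on:
  fixes f g :: "'a::euclidean_space \<Rightarrow> real"
  assumes S: "S \<in> sets lebesgue" and ae: "AE x in lebesgue_on S. f x = g x"
  shows "(LINT x|lebesgue_on S. f x) = (LINT x|lebesgue_on S. g x)"
    and "integrable (lebesgue_on S) f \<longleftrightarrow> integrable (lebesgue_on S) g"
proof -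
  note C = complete_measure_lebesgue_on[OF S]
  have ae': "AE x in lebesgue_on S. g x = f x" using ae by eventually_elim simp
  have iff: "f \<in> borel_measurable (lebesgue_on S) \<longleftrightarrow> g \<in> borel_measurable (lebesgue_on S)"
    using complete_AE_measurable[OF C _ ae] complete_AE_measurable[OF C _ ae'] by blast
  show "integrable (lebesgue_on S) f \<longleftrightarrow> integrable (lebesgue_on S) g"
    using iff integrable_cong_AE[OF _ _ ae] borel_measurable_integrable by blast
  show "(LINT x|lebesgue_on S. f x) = (LINT x|lebesgue_on S. g x)"
  proof (cases "f \<in> borel_measurable (lebesgue_on S)")
    case True
    then show ?thesis using iff ae by (intro integral_cong_AE) auto
  next
    case False
    then show ?thesis using iff
      by (metis borel_measurable_integrable not_integrable_integral_eq)
  qed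
qed

lemma integral_cong_AE_lebesgue:
  fixes f g :: "'a::euclidean_space \<Rightarrow> real"
  assumes "AE x in lebesgue. f x = g x"
  shows "(LINT x|lebesgue. f x) = (LINT x|lebesgue. g x)"
    and "integrable lebesgue f \<longleftrightarrow> integrable lebesgue g"
  using integral_cong_AE_lebesgue_on[of UNIV f g, unfolded lebesgue_on_UNIV_eq] assms by simp_all

text \<open>Both orders of slicing are needed: time slices for the integration by parts in space, spatial
  slices for the fundamental theorem in time.\<close>

lemma AE_lborel_slices:
  fixes P :: "'a::euclidean_space \<times> 'b::euclidean_space \<Rightarrow> bool"
  assumes P: "AE z in lborel. P z"
  shows "AE x in lborel. AE t in lborel. P (x, t)" "AE t in lborel. AE x in lborel. P (x, t)"
proof -
  have P2: "AE z in lborel \<Otimes>\<^sub>M lborel. P z"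
    unfolding lborel_prod by (rule P)
  from lborel_pair.AE_pair[OF P2] show "AE x in lborel. AE t in lborel. P (x, t)" .
  have "AE z in distr (lborel \<Otimes>\<^sub>M lborel) (lborel \<Otimes>\<^sub>M lborel) (\<lambda>(t::'b,x::'a). (x,t)). P z"
    using P2 lborel_pair.distr_pair_swap by metis
  then have "AE z in lborel \<Otimes>\<^sub>M lborel. P (case z of (t,x) \<Rightarrow> (x,t))"
    by (rule AE_distrD[rotated]) (rule measurable_pair_swap')
  from lborel_pair.AE_pair[OF this] show "AE t in lborel. AE x in lborel. P (x, t)" by simp
qed

text \<open>Lebesgue measure on the product is the completion of the product measure and not the product of
  the completions, so the integrand is replaced by a Borel function that equals it almost
  everywhere.\<close>

lemma Fubini_lebesgue_on:
  fixes h :: "'a::euclidean_space \<times> 'b::euclidean_space \<Rightarrow> real"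
  assumes A: "A \<in> sets borel" and B: "B \<in> sets borel"
    and h: "integrable (lebesgue_on (A \<times> B)) h"
  shows "AE t in lebesgue_on B. integrable (lebesgue_on A) (\<lambda>x. h (x, t))"
    and "integrable (lebesgue_on B) (\<lambda>t. LINT x|lebesgue_on A. h (x, t))"
    and "(LINT t|lebesgue_on B. LINT x|lebesgue_on A. h (x, t)) = (LINT z|lebesgue_on (A \<times> B). h z)"
proof -
  have AB: "A \<times> B \<in> sets borel"
    using A B by (metis borel_prod pair_measureI)
  have sAB: "A \<times> B \<in> sets lebesgue" "A \<in> sets lebesgue" "B \<in> sets lebesgue"
    using A B AB by (auto intro: sets_completionI_sets)
  let ?h = "\<lambda>z. indicat_real (A \<times> B) z * h z"
  have h0: "integrable lebesgue ?h"
    using h sAB by (subst (asm) integrable_restrict_space) auto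
  obtain g where g: "g \<in> borel_measurable lborel" and gh: "AE z in lborel. ?h z = g z"
    using completion_ex_borel_measurable_real[OF borel_measurable_integrable[OF h0]] by auto
  have gh': "AE z in lebesgue. ?h z = g z" using gh by (rule AE_completion)
  have gi: "integrable lborel g"
  proof -
    have "integrable lebesgue g"
      using h0 g gh' integrable_cong_AE[of ?h lebesgue g] by (simp add: borel_measurable_integrable measurable_completion)
    then show ?thesis using g by (simp add: integrable_completion)
  qed
  have gi2: "integrable (lborel \<Otimes>\<^sub>M lborel) g" by (simp add: gi lborel_prod)
  have aet: "AE t in lborel. AE x in lborel. ?h (x, t) = g (x, t)"
    by (rule AE_lborel_slices(2)[OF gh])
  have slice: "AE t in lborel. integrable lborel (\<lambda>x. g (x, t))"
    using lborel_pair.AE_integrable_snd[of "\<lambda>x t. g (x,t)"] gi2 by simp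
  have key: "integrable (lebesgue_on A) (\<lambda>x. h (x, t)) \<and>
       (LINT x|lebesgue_on A. h (x, t)) = (LINT x|lborel. g (x, t))"
    if t: "t \<in> B" and ae: "AE x in lborel. ?h (x, t) = g (x, t)" and i: "integrable lborel (\<lambda>x. g (x, t))" for t
  proof -
    have i': "integrable lebesgue (\<lambda>x. g (x, t))"
      using i by (simp add: integrable_completion borel_measurable_integrable)
    have ae': "AE x in lebesgue. g (x, t) = indicat_real A x * h (x, t)"
      using AE_completion[OF ae] by eventually_elim (use t in \<open>auto simp: indicator_def\<close>)
    have 1: "integrable lebesgue (\<lambda>x. indicat_real A x * h (x, t))"
      using integral_cong_AE_lebesgue(2)[OF ae'] i' by simp
    have 2: "(LINT x|lebesgue. indicat_real A x * h (x, t)) = (LINT x|lebesgue. g (x, t))"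
      using integral_cong_AE_lebesgue(1)[OF ae'] by simp
    show ?thesis
      using 1 2 sAB i by (subst integrable_restrict_space, simp, subst integral_restrict_space, simp)
        (simp add: integral_completion borel_measurable_integrable)
  qed
  have all: "AE t in lborel. t \<in> B \<longrightarrow> (integrable (lebesgue_on A) (\<lambda>x. h (x, t)) \<and>
       (LINT x|lebesgue_on A. h (x, t)) = (LINT x|lborel. g (x, t)))"
    using aet slice by eventually_elim (use key in blast)
  have allB: "AE t in lebesgue_on B. (integrable (lebesgue_on A) (\<lambda>x. h (x, t)) \<and>
       (LINT x|lebesgue_on A. h (x, t)) = (LINT x|lborel. g (x, t)))"
    using AE_completion[OF all] sAB by (subst AE_restrict_space_iff) auto
  then show "AE t in lebesgue_on B. integrable (lebesgue_on A) (\<lambda>x. h (x, t))" by eventually_elim simp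
  have ig: "integrable lborel (\<lambda>t. LINT x|lborel. g (x, t))"
    using lborel_pair.integrable_snd[of "\<lambda>x t. g (x,t)"] gi2 by simp
  then have ig': "integrable lebesgue (\<lambda>t. LINT x|lborel. g (x, t))"
    by (simp add: integrable_completion borel_measurable_integrable)
  have ig'': "integrable (lebesgue_on B) (\<lambda>t. LINT x|lborel. g (x, t))"
    using ig' sAB by (subst integrable_restrict_space) (auto intro!: integrable_mult_indicator[where 'b=real, simplified])
  have aeB: "AE t in lebesgue_on B. (LINT x|lborel. g (x, t)) = (LINT x|lebesgue_on A. h (x, t))"
    using allB by eventually_elim simp
  show "integrable (lebesgue_on B) (\<lambda>t. LINT x|lebesgue_on A. h (x, t))"
    using integral_cong_AE_lebesgue_on(2)[OF sAB(3) aeB] ig'' by simp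
  have out: "(LINT x|lborel. g (x, t)) = indicat_real B t * (LINT x|lborel. g (x, t))"
    if ae: "AE x in lborel. ?h (x, t) = g (x, t)" and i: "integrable lborel (\<lambda>x. g (x, t))" for t
  proof (cases "t \<in> B")
    case False
    have "AE x in lborel. g (x, t) = 0" using ae
      by eventually_elim (use False in \<open>auto simp: indicator_def\<close>)
    then have "(LINT x|lborel. g (x, t)) = 0"
      by (rule integral_eq_zero_AE)
    then show ?thesis using False by simp
  qed simp
  have "(LINT z|lebesgue_on (A \<times> B). h z) = (LINT z|lebesgue. ?h z)"
    using sAB by (subst integral_restrict_space) auto
  also have "\<dots> = (LINT z|lebesgue. g z)"
    using gh' by (rule integral_cong_AE_lebesgue(1))
  also have "\<dots> = (LINT z|lborel. g z)" using g by (simp add: integral_completion)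
  also have "\<dots> = (LINT t|lborel. LINT x|lborel. g (x, t))"
    using lborel_pair.integral_snd[of "\<lambda>x t. g (x,t)"] gi2 by (simp add: lborel_prod)
  also have "\<dots> = (LINT t|lebesgue. LINT x|lborel. g (x, t))"
    using ig by (simp add: integral_completion borel_measurable_integrable)
  also have "\<dots> = (LINT t|lebesgue. indicat_real B t * (LINT x|lborel. g (x, t)))"
  proof -
    have "AE t in lborel. (LINT x|lborel. g (x, t)) = indicat_real B t * (LINT x|lborel. g (x, t))"
      using aet slice by eventually_elim (rule out)
    from AE_completion[OF this] show ?thesis
      by (rule integral_cong_AE_lebesgue(1))
  qed
  also have "\<dots> = (LINT t|lebesgue_on B. LINT x|lborel. g (x, t))"
    using sAB by (subst integral_restrict_space) auto
  also have "\<dots> = (LINT t|lebesgue_on B. LINT x|lebesgue_on A. h (x, t))"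
    using integral_cong_AE_lebesgue_on(1)[OF sAB(3) aeB] by simp
  finally show "(LINT t|lebesgue_on B. LINT x|lebesgue_on A. h (x, t)) = (LINT z|lebesgue_on (A \<times> B). h z)" ..
qed

lemma Fubini_swap_lebesgue_on:
  fixes h :: "'a::euclidean_space \<times> 'b::euclidean_space \<Rightarrow> real"
  assumes h: "h \<in> borel_measurable borel" "\<And>z. \<bar>h z\<bar> \<le> K" and A: "compact A" and B: "compact B"
  shows "(LINT t|lebesgue_on B. LINT x|lebesgue_on A. h (x, t)) = (LINT x|lebesgue_on A. LINT t|lebesgue_on B. h (x, t))"
proof -
  have sA: "A \<in> sets borel" and sB: "B \<in> sets borel" using A B by (auto intro: borel_compact)
  have sAB: "A \<times> B \<in> sets borel" by (intro borel_compact compact_Times A B)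
  have fin: "emeasure lborel (A \<times> B) < \<infinity>" by (intro emeasure_compact_finite compact_Times A B)
  define k where "k = (\<lambda>x t. indicator A x * (indicator B t * h (x, t)))"
  have km: "case_prod k \<in> borel_measurable borel"
  proof -
    have "(\<lambda>z. indicator (A \<times> B) z * h z) \<in> borel_measurable borel"
      using sAB h(1) by (intro borel_measurable_times) auto
    moreover have "case_prod k = (\<lambda>z. indicator (A \<times> B) z * h z)" by (auto simp: k_def fun_eq_iff indicator_def)
    ultimately show ?thesis by simp
  qed
  have K0: "0 \<le> K" using h(2)[of undefined] by linarith
  have ki: "integrable lborel (case_prod k)"
  proof (rule integrableI_bounded_set[where A = "A \<times> B" and B = K])
    show "AE z in lborel. z \<in> A \<times> B \<longrightarrow> norm (case_prod k z) \<le> K"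
      using h(2) K0 by (intro AE_I2) (auto simp: k_def indicator_def)
    show "AE z in lborel. z \<notin> A \<times> B \<longrightarrow> case_prod k z = 0"
      by (intro AE_I2) (auto simp: k_def indicator_def)
  qed (use km fin sAB in auto)
  have ki2: "integrable (lborel \<Otimes>\<^sub>M lborel) (case_prod k)" using ki by (simp add: lborel_prod)
  have hx: "(\<lambda>x. h (x, t)) \<in> borel_measurable borel" for t
    using measurable_compose[OF _ h(1), of "\<lambda>x. (x, t)" borel] by simp
  have ht: "(\<lambda>t. h (x, t)) \<in> borel_measurable borel" for x
    using measurable_compose[OF _ h(1), of "\<lambda>t. (x, t)" borel] by simp
  have lebA: "(LINT x|lebesgue_on A. f x) = (LINT x|lborel. indicator A x * f x)" if "f \<in> borel_measurable borel" for f :: "'a \<Rightarrow> real"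
    using sA that by (subst integral_restrict_space) (auto simp: integral_completion sets_completionI_sets)
  have lebB: "(LINT x|lebesgue_on B. f x) = (LINT x|lborel. indicator B x * f x)" if "f \<in> borel_measurable borel" for f :: "'b \<Rightarrow> real"
    using sB that by (subst integral_restrict_space) (auto simp: integral_completion sets_completionI_sets)
  have 1: "(\<lambda>t. LINT x|lborel. indicator A x * h (x, t)) \<in> borel_measurable borel"
    and 2: "(\<lambda>x. LINT t|lborel. indicator B t * h (x, t)) \<in> borel_measurable borel"
  proof -
    have "(\<lambda>p::'b \<times> 'a. (snd p, fst p)) \<in> borel_measurable borel"
      by (intro borel_measurable_continuous_onI continuous_intros)
    from measurable_compose[OF this h(1)]
    have sw: "(\<lambda>p::'b \<times> 'a. h (snd p, fst p)) \<in> borel_measurable borel" .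
    have "(\<lambda>p::'b \<times> 'a. indicat_real A (snd p)) \<in> borel_measurable borel"
      by (rule measurable_compose[of snd borel borel]) (use sA in \<open>auto intro!: borel_measurable_continuous_onI continuous_intros\<close>)
    then have "(\<lambda>p::'b \<times> 'a. indicat_real A (snd p) * h (snd p, fst p)) \<in> borel_measurable lborel"
      using sw by simp
    then have "case_prod (\<lambda>t x. indicat_real A x * h (x, t)) \<in> borel_measurable (lborel \<Otimes>\<^sub>M lborel)"
      unfolding lborel_prod by (simp add: case_prod_unfold)
    from lborel.borel_measurable_lebesgue_integral[OF this]
    show "(\<lambda>t. LINT x|lborel. indicator A x * h (x, t)) \<in> borel_measurable borel" by simp
    have "(\<lambda>p::'a \<times> 'b. indicat_real B (snd p)) \<in> borel_measurable borel"
      by (rule measurable_compose[of snd borel borel]) (use sB in \<open>auto intro!: borel_measurable_continuous_onI continuous_intros\<close>)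
    then have "(\<lambda>p::'a \<times> 'b. indicat_real B (snd p) * h p) \<in> borel_measurable lborel"
      using h(1) by simp
    then have "case_prod (\<lambda>x t. indicat_real B t * h (x, t)) \<in> borel_measurable (lborel \<Otimes>\<^sub>M lborel)"
      unfolding lborel_prod by (simp add: case_prod_unfold)
    from lborel.borel_measurable_lebesgue_integral[OF this]
    show "(\<lambda>x. LINT t|lborel. indicator B t * h (x, t)) \<in> borel_measurable borel" by simp
  qed
  have "(LINT t|lebesgue_on B. LINT x|lebesgue_on A. h (x, t)) = (LINT t|lborel. indicator B t * (LINT x|lborel. indicator A x * h (x, t)))"
    using hx 1 by (simp add: lebA lebB)
  also have "\<dots> = (LINT t|lborel. LINT x|lborel. k x t)"
  proof -
    have "k x t = indicator B t * (indicator A x * h (x, t))" for x t unfolding k_def by (rule mult.left_commute)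
    then show ?thesis by simp
  qed
  also have "\<dots> = (LINT x|lborel. LINT t|lborel. k x t)"
    by (rule lborel_pair.Fubini_integral[OF ki2])
  also have "\<dots> = (LINT x|lborel. indicator A x * (LINT t|lborel. indicator B t * h (x, t)))"
    by (simp add: k_def)
  also have "\<dots> = (LINT x|lebesgue_on A. LINT t|lebesgue_on B. h (x, t))"
    using ht 2 by (simp add: lebA lebB)
  finally show ?thesis .
qed

lemma integrable_lebesgue_on_subset:
  fixes f :: "'a::euclidean_space \<Rightarrow> real"
  assumes f: "integrable (lebesgue_on S) f" and S: "S \<in> sets lebesgue" "T \<in> sets lebesgue" "T \<subseteq> S"
  shows "integrable (lebesgue_on T) f"
proof -
  have "integrable lebesgue (\<lambda>x. indicat_real S x * f x)"
    using f S(1) by (subst (asm) integrable_restrict_space) auto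
  from integrable_mult_indicator[OF S(2) this]
  have "integrable lebesgue (\<lambda>x. indicat_real T x * f x)"
  proof (rule Bochner_Integration.integrable_cong[THEN iffD1, rotated -1])
    show "indicat_real T x *\<^sub>R (indicat_real S x * f x) = indicat_real T x * f x" for x
      using S(3) by (auto simp: indicator_def)
  qed simp
  then show ?thesis using S(2) by (subst integrable_restrict_space) auto
qed

lemma AE_lebesgue_on_subset:
  assumes "AE x in lebesgue_on S. P x" "S \<in> sets lebesgue" "T \<in> sets lebesgue" "T \<subseteq> S"
  shows "AE x in lebesgue_on T. P x"
  using assms by (simp add: AE_restrict_space_iff) (auto elim: eventually_mono)

lemma integral_subset_le:
  fixes f :: "'a::euclidean_space \<Rightarrow> real"
  assumes f: "integrable (lebesgue_on S) f" "\<And>x. 0 \<le> f x" and S: "S \<in> sets lebesgue" "T \<in> sets lebesgue" "T \<subseteq> S"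
  shows "(LINT x|lebesgue_on T. f x) \<le> (LINT x|lebesgue_on S. f x)"
proof -
  have iT: "integrable lebesgue (\<lambda>x. indicat_real T x * f x)"
    using integrable_lebesgue_on_subset[OF f(1) S] S by (subst (asm) integrable_restrict_space) auto
  have iS: "integrable lebesgue (\<lambda>x. indicat_real S x * f x)"
    using f(1) S by (subst (asm) integrable_restrict_space) auto
  have "(LINT x|lebesgue. indicat_real T x * f x) \<le> (LINT x|lebesgue. indicat_real S x * f x)"
    by (rule integral_mono[OF iT iS]) (use f(2) S(3) in \<open>auto simp: indicator_def\<close>)
  then show ?thesis using S by (subst (1 2) integral_restrict_space) auto
qed

lemma borel_measurable_lebesgue_on:
  fixes f :: "'a::euclidean_space \<Rightarrow> 'b::{second_countable_topology, topological_space}"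
  shows "f \<in> borel_measurable borel \<Longrightarrow> f \<in> borel_measurable (lebesgue_on S)"
  by (simp add: measurable_completion measurable_restrict_space1)

lemma borel_measurable_component:
  fixes f :: "'a \<Rightarrow> 'b::euclidean_space^'n"
  assumes "f \<in> borel_measurable M"
  shows "(\<lambda>x. f x $ j) \<in> borel_measurable M"
proof -
  have "(\<lambda>v::'b^'n. v $ j) \<in> borel_measurable borel"
    by (intro borel_measurable_continuous_onI continuous_intros)
  from measurable_compose[OF assms this] show ?thesis .
qed

lemma continuous_lebesgue_on:
  fixes f :: "'a::euclidean_space \<Rightarrow> 'b::euclidean_space"
  assumes "continuous_on S f" "S \<in> sets lebesgue"
  shows "f \<in> borel_measurable (lebesgue_on S)"
  using assms by (rule continuous_imp_measurable_on_sets_lebesgue)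

lemma compact_bounded_fun:
  fixes F :: "'a::topological_space \<Rightarrow> 'b::real_normed_vector"
  assumes "compact S" "continuous_on S F"
  obtains B where "\<And>x. x \<in> S \<Longrightarrow> norm (F x) \<le> B"
  using compact_imp_bounded[OF compact_continuous_image[OF assms(2,1)]]
  by (auto simp: bounded_iff)

lemma lborel_integral_shift:
  fixes f :: "'a::euclidean_space \<Rightarrow> 'b::{banach, second_countable_topology}"
  assumes "f \<in> borel_measurable borel"
  shows "(LINT x|lborel. f (a + x)) = (LINT x|lborel. f x)"
proof -
  have "(LINT x|lborel. f x) = (LINT x|distr lborel borel ((+) a). f x)"
    by (simp add: lborel_distr_plus)
  also have "\<dots> = (LINT x|lborel. f (a + x))"
    using assms by (subst integral_distr) auto
  finally show ?thesis ..
qed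

lemma lborel_integrable_shift:
  fixes f :: "'a::euclidean_space \<Rightarrow> 'b::{banach, second_countable_topology}"
  assumes "integrable lborel f"
  shows "integrable lborel (\<lambda>x. f (a + x))"
proof -
  have "integrable (distr lborel borel ((+) a)) f"
    using assms by (simp add: lborel_distr_plus)
  then show ?thesis using borel_measurable_integrable[OF assms] by (subst (asm) integrable_distr_eq) auto
qed

lemma integrable_bounded_lebesgue_on:
  fixes f :: "'a::euclidean_space \<Rightarrow> real"
  assumes S: "S \<in> lmeasurable" and f: "f \<in> borel_measurable (lebesgue_on S)"
    and b: "\<And>x. x \<in> S \<Longrightarrow> \<bar>f x\<bar> \<le> B"
  shows "integrable (lebesgue_on S) f"
proof (rule Bochner_Integration.integrable_bound)
  show "integrable (lebesgue_on S) (\<lambda>x. B)"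
    using S by (simp add: finite_measure.integrable_const finite_measure_lebesgue_on)
  show "AE x in lebesgue_on S. norm (f x) \<le> norm B"
    using b by (intro AE_I2) (force simp: space_restrict_space)
qed (rule f)

lemma integrable_mult_bounded:
  fixes f g :: "'a \<Rightarrow> real"
  assumes f: "integrable M f" and g: "g \<in> borel_measurable M" and b: "\<And>x. x \<in> space M \<Longrightarrow> \<bar>g x\<bar> \<le> B"
  shows "integrable M (\<lambda>x. f x * g x)"
proof (rule Bochner_Integration.integrable_bound)
  show "integrable M (\<lambda>x. B * f x)" using f by simp
  show "AE x in M. norm (f x * g x) \<le> norm (B * f x)"
  proof (rule AE_I2)
    fix x assume "x \<in> space M"
    then have "\<bar>g x\<bar> \<le> \<bar>B\<bar>" using b by fastforce
    then show "norm (f x * g x) \<le> norm (B * f x)"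
      by (metis abs_ge_zero abs_mult mult.commute mult_left_mono real_norm_def)
  qed
qed (use f g borel_measurable_integrable in auto)

section \<open>Square-integrable functions\<close>

lemma L2_mult_integrable:
  fixes f g :: "'a::euclidean_space \<Rightarrow> real"
  assumes "f \<in> L2 S" "g \<in> L2 S"
  shows "integrable (lebesgue_on S) (\<lambda>z. f z * g z)"
proof (rule Bochner_Integration.integrable_bound)
  show "integrable (lebesgue_on S) (\<lambda>z. (norm (f z))\<^sup>2 + (norm (g z))\<^sup>2)"
    using assms by (simp add: L2_def)
  show "(\<lambda>z. f z * g z) \<in> borel_measurable (lebesgue_on S)"
    using assms by (auto simp: L2_def intro: borel_measurable_times)
  have "\<bar>a * b\<bar> \<le> a\<^sup>2 + b\<^sup>2" for a b :: real
  proof -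
    have "2 * \<bar>a\<bar> * \<bar>b\<bar> \<le> \<bar>a\<bar>\<^sup>2 + \<bar>b\<bar>\<^sup>2" by (rule sum_squares_bound)
    moreover have "0 \<le> \<bar>a\<bar> * \<bar>b\<bar>" by simp
    ultimately have "\<bar>a\<bar> * \<bar>b\<bar> \<le> \<bar>a\<bar>\<^sup>2 + \<bar>b\<bar>\<^sup>2" by linarith
    then show ?thesis by (simp add: abs_mult)
  qed
  then show "AE z in lebesgue_on S. norm (f z * g z) \<le> norm ((norm (f z))\<^sup>2 + (norm (g z))\<^sup>2)"
    by (intro AE_I2) (simp add: abs_mult)
qed

lemma L2_add:
  fixes f g :: "'a::euclidean_space \<Rightarrow> real"
  assumes "f \<in> L2 S" "g \<in> L2 S"
  shows "(\<lambda>z. f z + g z) \<in> L2 S"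
proof -
  have "integrable (lebesgue_on S) (\<lambda>z. (norm (f z))\<^sup>2 + (norm (g z))\<^sup>2 + 2 * (f z * g z))"
    using assms L2_mult_integrable[OF assms] by (simp add: L2_def)
  then show ?thesis using assms
    by (auto simp: L2_def power2_sum algebra_simps intro: borel_measurable_add)
qed

lemma L2_scale:
  fixes f :: "'a::euclidean_space \<Rightarrow> real"
  assumes "f \<in> L2 S"
  shows "(\<lambda>z. c * f z) \<in> L2 S"
  using assms by (auto simp: L2_def power_mult_distrib)

lemma L2_diff:
  fixes f g :: "'a::euclidean_space \<Rightarrow> real"
  assumes "f \<in> L2 S" "g \<in> L2 S"
  shows "(\<lambda>z. f z - g z) \<in> L2 S"
  using L2_add[OF assms(1) L2_scale[OF assms(2), of "-1"]] by simp

lemma L2_bounded: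
  fixes f :: "'a::euclidean_space \<Rightarrow> real"
  assumes S: "S \<in> lmeasurable" and f: "f \<in> borel_measurable (lebesgue_on S)"
    and b: "\<And>x. x \<in> S \<Longrightarrow> \<bar>f x\<bar> \<le> B"
  shows "f \<in> L2 S"
proof -
  have "integrable (lebesgue_on S) (\<lambda>x. (f x)\<^sup>2)"
  proof (rule integrable_bounded_lebesgue_on[OF S, where B = "B\<^sup>2"])
    show "\<bar>(f x)\<^sup>2\<bar> \<le> B\<^sup>2" if "x \<in> S" for x
      using b[OF that] by (simp add: abs_le_square_iff[symmetric])
  qed (use f in simp)
  then show ?thesis using f by (simp add: L2_def)
qed

lemma L2_dominated:
  fixes f g :: "'a::euclidean_space \<Rightarrow> real"
  assumes f: "f \<in> borel_measurable (lebesgue_on S)" and g: "g \<in> L2 S" and b: "\<And>x. x \<in> S \<Longrightarrow> \<bar>f x\<bar> \<le> g x"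
  shows "f \<in> L2 S"
proof -
  have "integrable (lebesgue_on S) (\<lambda>x. (f x)\<^sup>2)"
  proof (rule Bochner_Integration.integrable_bound)
    show "integrable (lebesgue_on S) (\<lambda>x. (norm (g x))\<^sup>2)" using g by (simp add: L2_def)
    show "(\<lambda>x. (f x)\<^sup>2) \<in> borel_measurable (lebesgue_on S)" using f by simp
    show "AE x in lebesgue_on S. norm ((f x)\<^sup>2) \<le> norm ((norm (g x))\<^sup>2)"
    proof (rule AE_I2)
      fix x assume "x \<in> space (lebesgue_on S)"
      then have "\<bar>f x\<bar> \<le> \<bar>g x\<bar>" using b[of x] by (auto simp: space_restrict_space)
      then show "norm ((f x)\<^sup>2) \<le> norm ((norm (g x))\<^sup>2)" by (simp add: abs_le_square_iff[symmetric])
    qed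
  qed
  then show ?thesis using f by (simp add: L2_def)
qed

lemma L2_continuous_compact:
  fixes f :: "'a::euclidean_space \<Rightarrow> real"
  assumes "compact S" "continuous_on S f"
  shows "f \<in> L2 S"
proof -
  obtain B where "\<And>x. x \<in> S \<Longrightarrow> norm (f x) \<le> B" using compact_bounded_fun[OF assms] by blast
  then show ?thesis using assms
    by (intro L2_bounded[where B = B] continuous_lebesgue_on) (auto simp: lmeasurable_compact fmeasurableD)
qed

lemma L2_integrable_compact:
  fixes f :: "'a::euclidean_space \<Rightarrow> real"
  assumes "compact S" "f \<in> L2 S"
  shows "integrable (lebesgue_on S) f"
  using L2_mult_integrable[OF assms(2) L2_continuous_compact[OF assms(1), of "\<lambda>_. 1"]] by simp

lemma psd_discriminant:
  fixes A B C :: real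
  assumes psd: "\<And>t. 0 \<le> A + 2 * t * B + t\<^sup>2 * C" and C0: "0 \<le> C"
  shows "B\<^sup>2 \<le> A * C"
proof (cases "C = 0")
  case True
  have "B = 0"
  proof (rule ccontr)
    assume "B \<noteq> 0"
    then show False using psd[of "- (A + 1) / (2 * B)"] True by (simp add: field_simps)
  qed
  then show ?thesis using True by simp
next
  case False
  with C0 have C: "0 < C" by simp
  have "0 \<le> A + 2 * (- B / C) * B + (- B / C)\<^sup>2 * C" by (rule psd)
  also have "\<dots> = A - B\<^sup>2 / C" using C by (simp add: field_simps power2_eq_square)
  finally show ?thesis using C by (simp add: field_simps)
qed

lemma L2_inner_add: "f \<in> L2 S \<Longrightarrow> g \<in> L2 S \<Longrightarrow> h \<in> L2 S \<Longrightarrow>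
    L2_inner S (\<lambda>z. f z + g z) h = L2_inner S f h + L2_inner S g h"
  for f g h :: "'b::euclidean_space \<Rightarrow> real"
  unfolding L2_inner_def using L2_mult_integrable[of f S h] L2_mult_integrable[of g S h] by (simp add: distrib_right)

lemma L2_inner_scale: "L2_inner S (\<lambda>z. c * f z) h = c * L2_inner S f h"
  for f h :: "'b::euclidean_space \<Rightarrow> real"
  unfolding L2_inner_def by (simp add: mult.assoc)

lemma L2_inner_sym: "L2_inner S f h = L2_inner S h f"
  for f h :: "'b::euclidean_space \<Rightarrow> real"
  unfolding L2_inner_def by (simp add: mult.commute)

lemma L2_inner_nonneg: "0 \<le> L2_inner S f f"
  for f :: "'b::euclidean_space \<Rightarrow> real"
  unfolding L2_inner_def by simp

text \<open>The quadratic polynomial \<open>t \<mapsto> \<parallel>f + t g\<parallel>\<^sup>2\<close> is nonnegative.\<close>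

lemma L2_inner_CS:
  fixes f g :: "'a::euclidean_space \<Rightarrow> real"
  assumes "f \<in> L2 S" "g \<in> L2 S"
  shows "(L2_inner S f g)\<^sup>2 \<le> L2_inner S f f * L2_inner S g g"
proof (rule psd_discriminant)
  fix t
  have "0 \<le> (LINT z|lebesgue_on S. (f z + t * g z)\<^sup>2)" by simp
  also have "(\<lambda>z. (f z + t * g z)\<^sup>2) = (\<lambda>z. f z * f z + (2 * t) * (f z * g z) + t\<^sup>2 * (g z * g z))"
    by (auto simp: fun_eq_iff power2_eq_square algebra_simps)
  also have "(LINT z|lebesgue_on S. \<dots> z) = L2_inner S f f + 2 * t * L2_inner S f g + t\<^sup>2 * L2_inner S g g"
    unfolding L2_inner_def
    using L2_mult_integrable[OF assms(1,1)] L2_mult_integrable[OF assms] L2_mult_integrable[OF assms(2,2)] by simp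
  finally show "0 \<le> L2_inner S f f + 2 * t * L2_inner S f g + t\<^sup>2 * L2_inner S g g" .
qed (simp add: L2_inner_def)

lemma L2_norm_sq:
  fixes f :: "'a::euclidean_space \<Rightarrow> real"
  shows "(L2_norm S f)\<^sup>2 = L2_inner S f f"
  unfolding L2_norm_def L2_inner_def by (simp add: power2_eq_square[of "f _"])

lemma L2_inner_le_norms:
  fixes f g :: "'a::euclidean_space \<Rightarrow> real"
  assumes "f \<in> L2 S" "g \<in> L2 S"
  shows "\<bar>L2_inner S f g\<bar> \<le> L2_norm S f * L2_norm S g"
proof (rule power2_le_imp_le)
  show "\<bar>L2_inner S f g\<bar>\<^sup>2 \<le> (L2_norm S f * L2_norm S g)\<^sup>2"
    using L2_inner_CS[OF assms] by (simp add: power_mult_distrib L2_norm_sq)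
qed (simp add: L2_norm_def)

lemma L2_inner_tendsto:
  fixes f g :: "'a::euclidean_space \<Rightarrow> real"
  assumes fn: "\<And>n. fn n \<in> L2 S" and f: "f \<in> L2 S" and h: "h \<in> L2 S"
    and lim: "(\<lambda>n. L2_norm S (\<lambda>z. fn n z - f z)) \<longlonglongrightarrow> 0"
  shows "(\<lambda>n. L2_inner S (fn n) h) \<longlonglongrightarrow> L2_inner S f h"
proof (rule LIM_zero_cancel, rule Lim_null_comparison)
  show "\<forall>\<^sub>F n in sequentially. norm (L2_inner S (fn n) h - L2_inner S f h) \<le> L2_norm S (\<lambda>z. fn n z - f z) * L2_norm S h"
  proof (intro always_eventually allI)
    fix n
    have "L2_inner S (fn n) h - L2_inner S f h = L2_inner S (\<lambda>z. fn n z - f z) h"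
      unfolding L2_inner_def using L2_mult_integrable[OF fn h] L2_mult_integrable[OF f h]
      by (simp add: left_diff_distrib)
    then show "norm (L2_inner S (fn n) h - L2_inner S f h) \<le> L2_norm S (\<lambda>z. fn n z - f z) * L2_norm S h"
      using L2_inner_le_norms[OF L2_diff[OF fn f] h] by simp
  qed
  show "(\<lambda>n. L2_norm S (\<lambda>z. fn n z - f z) * L2_norm S h) \<longlonglongrightarrow> 0"
    using tendsto_mult[OF lim tendsto_const[of "L2_norm S h"]] by simp
qed

section \<open>Test functions and the fundamental lemma\<close>

text \<open>Open boxes are stable under intersection and generate the Borel sets, so all set integrals vanish
  by a Dynkin argument.\<close>

lemma AE_zero_if_box_integrals_zero:
  fixes h :: "'a::euclidean_space \<Rightarrow> real"
  assumes h: "integrable lborel h"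
    and box: "\<And>a b. (LINT x|lborel. indicator (box a b) x * h x) = 0"
  shows "AE x in lborel. h x = 0"
proof -
  have h': "\<And>A. A \<in> sets borel \<Longrightarrow> integrable lborel (\<lambda>x. indicator A x * h x)"
    using integrable_mult_indicator[OF _ h] by simp
  have "set_lebesgue_integral lborel A h = 0" if "A \<in> sets borel" for A
  proof -
    let ?G = "range (\<lambda>(a, b). box a b :: 'a set)"
    have A: "A \<in> sigma_sets UNIV ?G"
      using that by (simp add: borel_eq_box)
    have "Int_stable ?G"
      by (auto simp: Int_stable_def box_Int_box)
    moreover have "?G \<subseteq> Pow UNIV" by simp
    ultimately show ?thesis using A
    proof (induction rule: sigma_sets_induct_disjoint)
      case (basic A)
      then show ?case using box by (auto simp: set_lebesgue_integral_def)
    next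
      case empty
      then show ?case by (simp add: set_lebesgue_integral_def)
    next
      case (compl A)
      have A: "A \<in> sets borel" using compl(1) by (simp add: borel_eq_box)
      have "(\<lambda>n. LINT x|lborel. indicator (box (- real n *\<^sub>R One) (real n *\<^sub>R One)) x * h x) \<longlonglongrightarrow> (LINT x|lborel. h x)"
      proof (rule integral_dominated_convergence[where w = "\<lambda>x. \<bar>h x\<bar>"])
        show "AE x in lborel. (\<lambda>n. indicator (box (- real n *\<^sub>R One) (real n *\<^sub>R One)) x * h x) \<longlonglongrightarrow> h x"
        proof (rule AE_I2)
          fix x :: 'a
          obtain N :: nat where N: "norm x < real N" using reals_Archimedean2 by blast
          have "eventually (\<lambda>n. indicator (box (- real n *\<^sub>R One) (real n *\<^sub>R One)) x * h x = h x) sequentially"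
            using eventually_ge_at_top[of N]
          proof eventually_elim
            case (elim n)
            have "\<bar>x \<bullet> i\<bar> < real n" if "i \<in> Basis" for i
              using Basis_le_norm[OF that, of x] N elim by linarith
            then have "x \<in> box (- real n *\<^sub>R One) (real n *\<^sub>R One)"
              by (auto simp: mem_box abs_less_iff) (metis minus_less_iff)
            then show ?case by simp
          qed
          then show "(\<lambda>n. indicator (box (- real n *\<^sub>R One) (real n *\<^sub>R One)) x * h x) \<longlonglongrightarrow> h x"
            by (rule tendsto_eventually)
        qed
      qed (use h h' borel_measurable_integrable[OF h] in \<open>auto simp: indicator_def\<close>)
      then have tot: "(LINT x|lborel. h x) = 0"
        using box by (simp add: LIMSEQ_const_iff)
      have "(LINT x|lborel. indicator (UNIV - A) x * h x) = (LINT x|lborel. h x - indicator A x * h x)"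
        by (rule Bochner_Integration.integral_cong) (auto simp: indicator_def)
      also have "\<dots> = (LINT x|lborel. h x) - (LINT x|lborel. indicator A x * h x)"
        using h h'[OF A] by simp
      finally show ?case using tot compl by (simp add: set_lebesgue_integral_def)
    next
      case (union A)
      have A: "\<And>i. A i \<in> sets borel" using union(2) by (simp add: borel_eq_box image_subset_iff)
      have "set_lebesgue_integral lborel (\<Union>(range A)) h = (\<Sum>i. set_lebesgue_integral lborel (A i) h)"
        using A union(1) h'[of "\<Union>(range A)"]
        by (intro lebesgue_integral_countable_add)
          (auto simp: disjoint_family_on_def set_integrable_def)
      then show ?case using union by simp
    qed
  qed
  then show ?thesis
    using density_unique_real[OF h, of "\<lambda>_. 0"] by (simp add: set_lebesgue_integral_def)
qed

text \<open>The test functions enter only through the boxes whose indicators they approximate; this covers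
  periodic tests and compactly supported tests, in space and in space-time, at once.\<close>

lemma fundamental_lemma:
  fixes h :: "'a::euclidean_space \<Rightarrow> real"
  assumes h: "integrable (lebesgue_on (cbox l r)) h"
    and approx: "\<And>a c. (\<forall>b\<in>Basis. l \<bullet> b < a \<bullet> b \<and> a \<bullet> b < c \<bullet> b \<and> c \<bullet> b < r \<bullet> b) \<Longrightarrow>
      \<exists>\<phi>::nat \<Rightarrow> 'a \<Rightarrow> real. (\<forall>n. \<phi> n \<in> borel_measurable borel) \<and> (\<forall>n z. \<bar>\<phi> n z\<bar> \<le> 1) \<and>
        (\<forall>z\<in>cbox l r. (\<lambda>n. \<phi> n z) \<longlonglongrightarrow> indicator (box a c) z) \<and>
        (\<forall>n. (LINT z|lebesgue_on (cbox l r). h z * \<phi> n z) = 0)"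
  shows "AE z in lebesgue_on (cbox l r). h z = 0"
proof -
  let ?M = "lebesgue_on (cbox l r)"
  have S: "cbox l r \<in> sets lebesgue" by simp
  have bm: "\<And>f::'a\<Rightarrow>real. f \<in> borel_measurable borel \<Longrightarrow> f \<in> borel_measurable ?M"
    by (simp add: measurable_completion measurable_restrict_space1)
  have hm: "h \<in> borel_measurable ?M" using h by auto
  have bi: "\<And>A. A \<in> sets borel \<Longrightarrow> indicat_real A \<in> borel_measurable ?M"
    by (intro bm) simp
  have strict: "(LINT z|?M. h z * indicator (box a c) z) = 0"
    if ac: "\<forall>b\<in>Basis. l \<bullet> b < a \<bullet> b \<and> a \<bullet> b < c \<bullet> b \<and> c \<bullet> b < r \<bullet> b" for a c
  proof -
    obtain \<phi> :: "nat \<Rightarrow> 'a \<Rightarrow> real" where \<phi>: "\<And>n. \<phi> n \<in> borel_measurable borel" "\<And>n z. \<bar>\<phi> n z\<bar> \<le> 1"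
        "\<And>z. z \<in> cbox l r \<Longrightarrow> (\<lambda>n. \<phi> n z) \<longlonglongrightarrow> indicator (box a c) z"
        "\<And>n. (LINT z|?M. h z * \<phi> n z) = 0"
      using approx[OF ac] by metis
    have "(\<lambda>n. LINT z|?M. h z * \<phi> n z) \<longlonglongrightarrow> (LINT z|?M. h z * indicator (box a c) z)"
    proof (rule integral_dominated_convergence[where w = "\<lambda>z. \<bar>h z\<bar>"])
      show "AE z in ?M. (\<lambda>n. h z * \<phi> n z) \<longlonglongrightarrow> h z * indicator (box a c) z"
        using \<phi>(3) by (intro AE_I2 tendsto_mult) (auto simp: space_restrict_space)
      show "AE z in ?M. norm (h z * \<phi> n z) \<le> \<bar>h z\<bar>" for n
        using \<phi>(2)[of n] by (intro AE_I2) (auto simp: abs_mult mult_left_le)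
    qed (simp_all add: h hm \<phi>(1) bm bi borel_measurable_times)
    then show ?thesis using \<phi>(4) by (simp add: LIMSEQ_const_iff)
  qed
  have open_box: "(LINT z|?M. h z * indicator (box a c) z) = 0"
    if sub: "\<forall>b\<in>Basis. l \<bullet> b \<le> a \<bullet> b \<and> c \<bullet> b \<le> r \<bullet> b" for a c
  proof (cases "box a c = {}")
    case False
    then have lt: "\<forall>b\<in>Basis. a \<bullet> b < c \<bullet> b" by (simp add: box_ne_empty)
    \<comment> \<open>The box is exhausted from inside; \<open>n + 3\<close> keeps both margins below half of the side length.\<close>
    define e where "e = (\<lambda>n::nat. 1 / (real n + 3))"
    have e: "0 < e n" "e n < 1/2" for n unfolding e_def by (auto simp: field_simps)
    have e0: "e \<longlonglongrightarrow> 0"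
      using LIMSEQ_ignore_initial_segment[OF lim_inverse_n', of 3] by (simp add: e_def)
    define A where "A = (\<lambda>n. a + e n *\<^sub>R (c - a))"
    define B where "B = (\<lambda>n. c - e n *\<^sub>R (c - a))"
    have AB: "a \<bullet> b < A n \<bullet> b" "A n \<bullet> b < B n \<bullet> b" "B n \<bullet> b < c \<bullet> b" if "b \<in> Basis" for b n
    proof -
      have "a \<bullet> b < c \<bullet> b" using lt that by simp
      then have d: "0 < c \<bullet> b - a \<bullet> b" by simp
      show "a \<bullet> b < A n \<bullet> b" "B n \<bullet> b < c \<bullet> b" using d e(1)[of n] by (auto simp: A_def B_def inner_simps)
      have "e n * (c \<bullet> b - a \<bullet> b) < 1/2 * (c \<bullet> b - a \<bullet> b)"
        using e(2)[of n] d by (rule mult_strict_right_mono)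
      then show "A n \<bullet> b < B n \<bullet> b" by (simp add: A_def B_def inner_simps)
    qed
    have z: "(LINT z|?M. h z * indicator (box (A n) (B n)) z) = 0" for n
    proof (rule strict, intro ballI)
      fix b :: 'a assume b: "b \<in> Basis"
      show "l \<bullet> b < A n \<bullet> b \<and> A n \<bullet> b < B n \<bullet> b \<and> B n \<bullet> b < r \<bullet> b"
        using AB[OF b, of n] sub b by (meson le_less_trans less_le_trans)
    qed
    have "(\<lambda>n. LINT z|?M. h z * indicator (box (A n) (B n)) z) \<longlonglongrightarrow> (LINT z|?M. h z * indicator (box a c) z)"
    proof (rule integral_dominated_convergence[where w = "\<lambda>z. \<bar>h z\<bar>"])
      show "AE z in ?M. (\<lambda>n. h z * indicator (box (A n) (B n)) z) \<longlonglongrightarrow> h z * indicator (box a c) z"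
      proof (intro AE_I2 tendsto_mult tendsto_const)
        fix z
        show "(\<lambda>n. indicat_real (box (A n) (B n)) z) \<longlonglongrightarrow> indicator (box a c) z"
        proof (cases "z \<in> box a c")
          case False
          then have "z \<notin> box (A n) (B n)" for n
            unfolding mem_box using AB(1,3) by (meson less_trans)
          then show ?thesis using False by simp
        next
          case True
          have "eventually (\<lambda>n. \<forall>b\<in>Basis. A n \<bullet> b < z \<bullet> b \<and> z \<bullet> b < B n \<bullet> b) sequentially"
          proof (intro eventually_ball_finite finite_Basis ballI eventually_conj)
            fix b :: 'a assume b: "b \<in> Basis"
            have 1: "(\<lambda>n. A n \<bullet> b) \<longlonglongrightarrow> (a + 0 *\<^sub>R (c - a)) \<bullet> b" unfolding A_def by (intro tendsto_intros e0)
            have 2: "(\<lambda>n. B n \<bullet> b) \<longlonglongrightarrow> (c - 0 *\<^sub>R (c - a)) \<bullet> b" unfolding B_def by (intro tendsto_intros e0)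
            show "\<forall>\<^sub>F n in sequentially. A n \<bullet> b < z \<bullet> b" using order_tendstoD(2)[OF 1] True b by (auto simp: mem_box)
            show "\<forall>\<^sub>F n in sequentially. z \<bullet> b < B n \<bullet> b" using order_tendstoD(1)[OF 2] True b by (auto simp: mem_box)
          qed
          then have "eventually (\<lambda>n. indicat_real (box (A n) (B n)) z = indicator (box a c) z) sequentially"
            by eventually_elim (use True in \<open>auto simp: mem_box\<close>)
          then show ?thesis by (rule tendsto_eventually)
        qed
      qed
      show "AE z in ?M. norm (h z * indicator (box (A n) (B n)) z) \<le> \<bar>h z\<bar>" for n
        by (intro AE_I2) (auto simp: indicator_def)
    qed (simp_all add: h hm bi borel_measurable_times)
    then show ?thesis using z by (simp add: LIMSEQ_const_iff)
  qed simp
  let ?h = "\<lambda>z. indicat_real (cbox l r) z * h z"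
  have h0: "integrable lebesgue ?h"
    using h by (subst (asm) integrable_restrict_space) auto
  obtain g where g: "g \<in> borel_measurable lborel" and gh: "AE z in lborel. ?h z = g z"
    using completion_ex_borel_measurable_real[OF borel_measurable_integrable[OF h0]] by auto
  have gh': "AE z in lebesgue. ?h z = g z" using gh by (rule AE_completion)
  have gi: "integrable lborel g"
    using integral_cong_AE_lebesgue(2)[OF gh'] h0 g by (simp add: integrable_completion)
  have "AE z in lborel. g z = 0"
  proof (rule AE_zero_if_box_integrals_zero[OF gi])
    fix a c :: 'a
    define a' where "a' = (\<Sum>b\<in>Basis. max (a \<bullet> b) (l \<bullet> b) *\<^sub>R b)"
    define c' where "c' = (\<Sum>b\<in>Basis. min (c \<bullet> b) (r \<bullet> b) *\<^sub>R b)"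
    have ac': "a' \<bullet> b = max (a \<bullet> b) (l \<bullet> b)" "c' \<bullet> b = min (c \<bullet> b) (r \<bullet> b)" if "b \<in> Basis" for b
      using that by (simp_all add: a'_def c'_def inner_sum_left_Basis)
    have eq: "box a' c' = box a c \<inter> box l r"
      using ac' by (auto simp: mem_box)
    have "(LINT x|lborel. indicator (box a c) x * g x) = (LINT x|lebesgue. indicator (box a c) x * g x)"
      using g by (subst integral_completion) auto
    also have "\<dots> = (LINT x|lebesgue. indicat_real (cbox l r) x * (h x * indicator (box a' c') x))"
    proof (rule integral_cong_AE_lebesgue(1))
      have "AE x in lebesgue. x \<notin> cbox l r - box l r"
        using negligible_frontier_interval[of l r] 
        unfolding negligible_iff_null_sets by (rule AE_not_in)
      with gh' show "AE x in lebesgue. indicat_real (box a c) x * g x = indicat_real (cbox l r) x * (h x * indicator (box a' c') x)"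
      proof eventually_elim
        case (elim x)
        then show ?case using box_subset_cbox[of l r] unfolding eq by (auto simp: indicator_def split: if_splits)
      qed
    qed
    also have "\<dots> = (LINT x|?M. h x * indicator (box a' c') x)"
      by (subst integral_restrict_space) auto
    also have "\<dots> = 0" using ac' by (intro open_box) auto
    finally show "(LINT x|lborel. indicator (box a c) x * g x) = 0" .
  qed
  then have "AE z in lebesgue. g z = 0" by (rule AE_completion)
  with gh' have "AE z in lebesgue. z \<in> cbox l r \<longrightarrow> h z = 0"
    by eventually_elim (auto simp: indicator_def split: if_splits)
  then show ?thesis by (subst AE_restrict_space_iff) auto
qed

lemma C1_continuous: "C1_with_grad \<phi> D \<Longrightarrow> continuous_on UNIV \<phi>"
  unfolding C1_with_grad_def gderiv_def
  by (meson continuous_at_imp_continuous_on has_derivative_continuous)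

lemma C1_measurable: "C1_with_grad \<phi> D \<Longrightarrow> \<phi> \<in> borel_measurable borel"
  by (intro borel_measurable_continuous_onI C1_continuous)

lemma C1_const: "C1_with_grad (\<lambda>z. c) (\<lambda>z. 0)"
  by (simp add: C1_with_grad_def GDERIV_const)

lemma C1_mult:
  assumes "C1_with_grad \<phi> D" "C1_with_grad \<psi> E"
  shows "C1_with_grad (\<lambda>z. \<phi> z * \<psi> z) (\<lambda>z. \<phi> z *\<^sub>R E z + \<psi> z *\<^sub>R D z)"
  using assms C1_continuous[OF assms(1)] C1_continuous[OF assms(2)]
  unfolding C1_with_grad_def by (auto intro!: GDERIV_mult continuous_intros)

lemma C1_prod:
  fixes I :: "'i set"
  assumes "finite I" "\<And>i. i \<in> I \<Longrightarrow> \<exists>D. C1_with_grad (\<phi> i) D"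
  shows "\<exists>D. C1_with_grad (\<lambda>z. \<Prod>i\<in>I. \<phi> i z) D"
  using assms
proof (induction I rule: finite_induct)
  case empty
  then show ?case using C1_const by auto
next
  case (insert i I)
  then obtain E where E: "C1_with_grad (\<lambda>z. \<Prod>i\<in>I. \<phi> i z) E" by auto
  obtain D where "C1_with_grad (\<phi> i) D" using insert by auto
  note this E
  from C1_mult[OF this] show ?case using insert by auto
qed

lemma C1_coord:
  fixes p :: "real \<Rightarrow> real"
  assumes "\<And>s. (p has_real_derivative p' s) (at s)" "continuous_on UNIV p'"
  shows "C1_with_grad (\<lambda>z. p (z \<bullet> b)) (\<lambda>z. p' (z \<bullet> b) *\<^sub>R b)"
  unfolding C1_with_grad_def
proof (intro conjI allI)
  fix z
  have "GDERIV (\<lambda>z. z \<bullet> b) z :> b"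
    unfolding gderiv_def by (intro derivative_eq_intros | simp)+
  then show "GDERIV (\<lambda>z. p (z \<bullet> b)) z :> p' (z \<bullet> b) *\<^sub>R b"
    using assms(1) by (rule GDERIV_DERIV_compose)
  show "continuous_on UNIV (\<lambda>z. p' (z \<bullet> b) *\<^sub>R b)"
    by (intro continuous_intros continuous_on_compose2[OF assms(2)]) auto
qed

lemma C1_fst_snd:
  fixes \<psi> :: "'a::euclidean_space \<Rightarrow> real" and \<tau> :: "real \<Rightarrow> real"
  assumes \<psi>: "C1_with_grad \<psi> D" and \<tau>: "\<And>s. (\<tau> has_real_derivative \<tau>' s) (at s)" "continuous_on UNIV \<tau>'"
  shows "C1_with_grad (\<lambda>z. \<psi> (fst z) * \<tau> (snd z)) (\<lambda>z. (\<tau> (snd z) *\<^sub>R D (fst z), \<psi> (fst z) * \<tau>' (snd z)))"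
  unfolding C1_with_grad_def
proof (intro conjI allI)
  fix z :: "'a \<times> real"
  have 1: "((\<lambda>z. \<psi> (fst z)) has_derivative (\<lambda>h. fst h \<bullet> D (fst z))) (at z)"
    using \<psi> unfolding C1_with_grad_def gderiv_def
    by (intro has_derivative_compose[of fst fst z UNIV \<psi> "\<lambda>h. h \<bullet> D (fst z)"]) (auto intro!: derivative_intros)
  have 2: "((\<lambda>z. \<tau> (snd z)) has_derivative (\<lambda>h. \<tau>' (snd z) * snd h)) (at z)"
    using \<tau>(1)[of "snd z"] unfolding has_field_derivative_def
    by (intro has_derivative_compose[of snd snd z UNIV \<tau>]) (auto intro!: derivative_intros)
  show "GDERIV (\<lambda>z. \<psi> (fst z) * \<tau> (snd z)) z :> (\<tau> (snd z) *\<^sub>R D (fst z), \<psi> (fst z) * \<tau>' (snd z))"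
    unfolding gderiv_def
    by (rule has_derivative_eq_rhs[OF has_derivative_mult[OF 1 2]])
      (auto simp: fun_eq_iff inner_prod_def algebra_simps)
next
  have "continuous_on UNIV \<tau>"
    using \<tau>(1) by (meson DERIV_isCont continuous_at_imp_continuous_on)
  note c = continuous_on_compose2[OF this] continuous_on_compose2[OF \<tau>(2)]
     continuous_on_compose2[OF C1_continuous[OF \<psi>]]
  have "continuous_on UNIV D" using \<psi> by (simp add: C1_with_grad_def)
  note c = c continuous_on_compose2[OF this]
  show "continuous_on UNIV (\<lambda>z. (\<tau> (snd z) *\<^sub>R D (fst z), \<psi> (fst z) * \<tau>' (snd z)))"
    by (intro continuous_intros c) auto
qed

text \<open>Bounded \<open>C\<^sup>1\<close> functions converging pointwise to the indicator of the positive half-line and vanishing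
  on its complement: composed with a function \<open>q\<close> they approximate the indicator of \<open>{q > 0}\<close>
  without leaving \<open>{q > 0}\<close>.\<close>

definition smooth_step :: "nat \<Rightarrow> real \<Rightarrow> real" where
  "smooth_step n y = real n * (max 0 y)\<^sup>2 / (1 + real n * (max 0 y)\<^sup>2)"

definition smooth_step' :: "nat \<Rightarrow> real \<Rightarrow> real" where
  "smooth_step' n y = 2 * real n * max 0 y / (1 + real n * (max 0 y)\<^sup>2)\<^sup>2"

lemma DERIV_max_sq: "((\<lambda>y::real. (max 0 y)\<^sup>2) has_real_derivative 2 * max 0 y) (at y)"
proof -
  consider "y < 0" | "y > 0" | "y = 0" by linarith
  then show ?thesis
  proof cases
    case 1
    have "((\<lambda>y::real. 0) has_real_derivative 0) (at y)" by simp
    moreover have "\<forall>\<^sub>F x in nhds y. (0::real) = (max 0 x)\<^sup>2"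
      using eventually_nhds_in_open[of "{..<0}" y] 1 by (auto elim: eventually_mono)
    ultimately show ?thesis using 1 DERIV_cong_ev[of y y "\<lambda>y. 0" "\<lambda>y. (max 0 y)\<^sup>2" 0 0] by simp
  next
    case 2
    have "((\<lambda>y::real. y\<^sup>2) has_real_derivative 2 * y) (at y)" by (auto intro!: derivative_eq_intros)
    moreover have "\<forall>\<^sub>F x in nhds y. x\<^sup>2 = (max 0 x)\<^sup>2"
      using eventually_nhds_in_open[of "{0<..}" y] 2 by (auto elim: eventually_mono)
    ultimately show ?thesis using 2 DERIV_cong_ev[of y y "\<lambda>y. y\<^sup>2" "\<lambda>y. (max 0 y)\<^sup>2" "2 * y" "2 * y"] by simp
  next
    case 3
    have "(\<lambda>h::real. (max 0 h)\<^sup>2 / h) \<midarrow>0\<rightarrow> 0"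
    proof (rule Lim_null_comparison)
      show "\<forall>\<^sub>F h::real in at 0. norm ((max 0 h)\<^sup>2 / h) \<le> \<bar>h\<bar>"
        by (rule always_eventually) (auto simp: max_def power2_eq_square abs_mult)
      show "((\<lambda>h::real. \<bar>h\<bar>) \<longlongrightarrow> 0) (at 0)" by (rule tendsto_rabs_zero) (rule tendsto_ident_at)
    qed
    then show ?thesis using 3 by (simp add: DERIV_def)
  qed
qed

lemma DERIV_smooth_step: "(smooth_step n has_real_derivative smooth_step' n y) (at y)"
proof -
  have p: "1 + real n * (max 0 y)\<^sup>2 > 0" by (simp add: add_pos_nonneg)
  have "((\<lambda>y. real n * (max 0 y)\<^sup>2 / (1 + real n * (max 0 y)\<^sup>2)) has_real_derivative
     ((real n * (2 * max 0 y)) * (1 + real n * (max 0 y)\<^sup>2) - real n * (max 0 y)\<^sup>2 * (real n * (2 * max 0 y)))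
      / ((1 + real n * (max 0 y)\<^sup>2) * (1 + real n * (max 0 y)\<^sup>2))) (at y)"
  proof (rule DERIV_divide)
    show "((\<lambda>y. real n * (max 0 y)\<^sup>2) has_real_derivative real n * (2 * max 0 y)) (at y)"
      by (rule DERIV_cmult[OF DERIV_max_sq])
    from DERIV_add[OF DERIV_const this, of 1]
    show "((\<lambda>y. 1 + real n * (max 0 y)\<^sup>2) has_real_derivative real n * (2 * max 0 y)) (at y)" by simp
  qed (use p in linarith)
  then show ?thesis
    unfolding smooth_step_def[abs_def] smooth_step'_def
    by (rule DERIV_cong) (simp add: power2_eq_square algebra_simps)
qed

lemma continuous_smooth_step': "continuous_on UNIV (smooth_step' n)"
proof -
  have "1 + real n * (max 0 y)\<^sup>2 > 0" for y by (simp add: add_pos_nonneg)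
  then have "1 + real n * (max 0 y)\<^sup>2 \<noteq> 0" for y by (metis less_irrefl)
  then show ?thesis unfolding smooth_step'_def[abs_def]
    by (intro continuous_intros) auto
qed

lemma smooth_step_range: "0 \<le> smooth_step n y" "smooth_step n y \<le> 1"
proof -
  have p: "1 + real n * (max 0 y)\<^sup>2 > 0" by (simp add: add_pos_nonneg)
  show "0 \<le> smooth_step n y" "smooth_step n y \<le> 1"
    unfolding smooth_step_def using p by (simp_all add: divide_le_eq_1)
qed

lemma smooth_step_nonpos: "y \<le> 0 \<Longrightarrow> smooth_step n y = 0"
  by (simp add: smooth_step_def)

lemma smooth_step_tendsto: "(\<lambda>n. smooth_step n y) \<longlonglongrightarrow> (if y > 0 then 1 else 0)"
proof (cases "y > 0")
  case True
  have "(\<lambda>n. 1 - 1 / (1 + real n * y\<^sup>2)) \<longlonglongrightarrow> 1 - 0"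
  proof (intro tendsto_diff tendsto_const)
    have "filterlim (\<lambda>n. 1 + real n * y\<^sup>2) at_top sequentially"
      using True by (intro filterlim_tendsto_add_at_top[OF tendsto_const]
          filterlim_at_top_mult_tendsto_pos[OF tendsto_const _ filterlim_real_sequentially]) auto
    then show "(\<lambda>n. 1 / (1 + real n * y\<^sup>2)) \<longlonglongrightarrow> 0"
      by (intro tendsto_divide_0[OF tendsto_const] filterlim_at_top_imp_at_infinity)
  qed
  moreover have "smooth_step n y = 1 - 1 / (1 + real n * y\<^sup>2)" for n
  proof -
    have "1 + real n * y\<^sup>2 > 0" by (simp add: add_pos_nonneg)
    then show ?thesis using True by (simp add: smooth_step_def max_def field_simps)
  qed
  ultimately show ?thesis using True by simp
qed (simp add: smooth_step_nonpos)

text \<open>For \<open>0 < a < c < 1\<close>, positive on the unit interval exactly between \<open>a\<close> and \<open>c\<close>.  The trigonometric variant is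
  \<open>1\<close>-periodic, which makes the product over the coordinates invariant under lattice vectors.\<close>

definition coord_bump :: "bool \<Rightarrow> real \<Rightarrow> real \<Rightarrow> real \<Rightarrow> real" where
  "coord_bump per a c s =
     (if per then cos (2 * pi * (s - (a + c) / 2)) - cos (pi * (c - a)) else (s - a) * (c - s))"

lemma coord_bump_deriv:
  "\<exists>q'. (\<forall>s. (coord_bump per a c has_real_derivative q' s) (at s)) \<and> continuous_on UNIV q'"
proof (cases per)
  case True
  have "coord_bump per a c = (\<lambda>s. cos (2 * pi * (s - (a + c) / 2)) - cos (pi * (c - a)))"
    using True by (auto simp: coord_bump_def)
  then show ?thesis
    by (intro exI[of _ "\<lambda>s. - sin (2 * pi * (s - (a + c) / 2)) * (2 * pi)"])
      (auto intro!: derivative_eq_intros continuous_intros)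
next
  case False
  have "coord_bump per a c = (\<lambda>s. (s - a) * (c - s))"
    using False by (auto simp: coord_bump_def)
  then show ?thesis
    by (intro exI[of _ "\<lambda>s. (c - s) - (s - a)"])
      (auto intro!: derivative_eq_intros continuous_intros)
qed

text \<open>In the periodic case \<open>cos (2 \<pi> d)\<close> is decreasing in the distance \<open>d\<close> to the midpoint up to
  \<open>d = 1/2\<close>; beyond that, \<open>1 - d\<close> is the distance on the circle, and it still exceeds half the length
  because \<open>a > 0\<close> and \<open>c < 1\<close>.\<close>

lemma coord_bump_pos_iff:
  assumes ac: "0 < a" "a < c" "c < 1" and s: "0 \<le> s" "s \<le> 1"
  shows "coord_bump per a c s > 0 \<longleftrightarrow> a < s \<and> s < c"
proof (cases per)
  case False
  then show ?thesis using ac by (auto simp: coord_bump_def zero_less_mult_iff)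
next
  case True
  define d where "d = \<bar>s - (a + c) / 2\<bar>"
  have "cos (2 * pi * (s - (a + c) / 2)) = cos \<bar>2 * pi * (s - (a + c) / 2)\<bar>" by simp
  also have "\<dots> = cos (2 * pi * d)" by (simp add: d_def abs_mult)
  finally have cd: "cos (2 * pi * (s - (a + c) / 2)) = cos (2 * pi * d)" .
  have mono: "cos x < cos y \<longleftrightarrow> y < x" if "0 \<le> x" "x \<le> pi" "0 \<le> y" "y \<le> pi" for x y
    using that cos_monotone_0_pi_le[of x y] cos_monotone_0_pi[of y x] by (meson not_le)
  have pr: "0 \<le> pi * (c - a)" "pi * (c - a) \<le> pi" using ac by auto
  have iff: "a < s \<and> s < c \<longleftrightarrow> 2 * d < c - a" by (auto simp: d_def abs_if field_simps)
  show ?thesis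
  proof (cases "2 * d \<le> 1")
    case le: True
    have "2 * pi * d \<le> pi" using mult_left_mono[OF le, of pi] by simp
    moreover have "0 \<le> 2 * pi * d" by (simp add: d_def)
    ultimately have "cos (pi * (c - a)) < cos (2 * pi * d) \<longleftrightarrow> 2 * pi * d < pi * (c - a)"
      using mono pr by blast
    also have "\<dots> \<longleftrightarrow> pi * (2 * d) < pi * (c - a)" by (simp add: mult_ac)
    finally show ?thesis using True iff cd by (simp add: coord_bump_def)
  next
    case False
    have d1: "1 - d > (c - a) / 2" using ac s by (auto simp: d_def abs_if field_simps)
    then have d2: "2 * (1 - d) > c - a" by simp
    have "cos (2 * pi * d) = cos (2 * pi - 2 * pi * d)" by (simp add: cos_diff)
    also have "\<dots> = cos (pi * (2 * (1 - d)))" by (simp add: algebra_simps)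
    also have "\<dots> < cos (pi * (c - a))"
    proof -
      have "pi * (2 * (1 - d)) \<le> pi * 1" using False by (intro mult_left_mono) auto
      moreover have "pi * (c - a) < pi * (2 * (1 - d))" using d2 by (simp only: mult_less_cancel_left_pos pi_gt_zero)
      ultimately show ?thesis using mono pr by (smt (verit))
    qed
    finally show ?thesis using True iff cd False ac by (simp add: coord_bump_def)
  qed
qed

lemma coord_bump_periodic: "k \<in> \<int> \<Longrightarrow> coord_bump True a c (s + k) = coord_bump True a c s"
proof -
  assume "k \<in> \<int>"
  then obtain m where k: "k = of_int m" by (elim Ints_cases)
  have "cos (2 * pi * (s + k - (a + c) / 2)) = cos (2 * pi * (s - (a + c) / 2) + 2 * pi * of_int m)"
    by (simp add: k algebra_simps)
  also have "\<dots> = cos (2 * pi * (s - (a + c) / 2))"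
    by (simp only: cos_add cos_int_2pin sin_int_2pin)
  finally show ?thesis by (simp add: coord_bump_def)
qed

lemma smooth_bump_deriv:
  "\<exists>p'. (\<forall>s. ((\<lambda>s. smooth_step n (coord_bump per a c s)) has_real_derivative p' s) (at s)) \<and> continuous_on UNIV p'"
proof -
  obtain q' where q': "\<And>s. (coord_bump per a c has_real_derivative q' s) (at s)" "continuous_on UNIV q'"
    using coord_bump_deriv by blast
  have c: "continuous_on UNIV (coord_bump per a c)"
    using q'(1) by (meson DERIV_isCont continuous_at_imp_continuous_on)
  show ?thesis
  proof (intro exI conjI allI)
    show "((\<lambda>s. smooth_step n (coord_bump per a c s)) has_real_derivative smooth_step' n (coord_bump per a c s) * q' s) (at s)" for s
      by (rule DERIV_chain2[OF DERIV_smooth_step q'(1)])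
    show "continuous_on UNIV (\<lambda>s. smooth_step' n (coord_bump per a c s) * q' s)"
      by (intro continuous_intros continuous_on_compose2[OF continuous_smooth_step'] c q'(2)) auto
  qed
qed

definition box_bump :: "bool \<Rightarrow> real^'d \<Rightarrow> real^'d \<Rightarrow> nat \<Rightarrow> real^'d \<Rightarrow> real" where
  "box_bump per a c n x = (\<Prod>i\<in>UNIV. smooth_step n (coord_bump per (a $ i) (c $ i) (x $ i)))"

lemma box_bump_range: "0 \<le> box_bump per a c n x" "box_bump per a c n x \<le> 1"
  unfolding box_bump_def using smooth_step_range by (auto intro!: prod_nonneg prod_le_1)

lemma box_bump_C1:
  fixes a c :: "real^'d"
  shows "\<exists>D. C1_with_grad (box_bump per a c n) D"
proof -
  have "\<exists>D. C1_with_grad (\<lambda>x::real^'d. smooth_step n (coord_bump per (a $ i) (c $ i) (x $ i))) D" for i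
  proof -
    obtain p' where "\<forall>s. ((\<lambda>s. smooth_step n (coord_bump per (a $ i) (c $ i) s)) has_real_derivative p' s) (at s)"
      "continuous_on UNIV p'" using smooth_bump_deriv by blast
    note * = C1_coord[OF this(1)[rule_format] this(2), of "axis i 1 :: real^'d"]
    have eq: "z \<bullet> axis i 1 = z $ i" for z :: "real^'d" by (simp add: inner_axis)
    from *[unfolded eq] show ?thesis by blast
  qed
  then show ?thesis unfolding box_bump_def[abs_def] by (intro C1_prod) auto
qed

lemma box_bump_test:
  fixes a c :: "real^'d"
  assumes ac: "\<And>i. 0 < a $ i \<and> a $ i < c $ i \<and> c $ i < 1"
  shows "\<exists>D. space_test per (box_bump per a c n) D"
proof -
  obtain D where D: "C1_with_grad (box_bump per a c n) D" using box_bump_C1 by blast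
  show ?thesis
  proof (cases per)
    case True
    have "periodic (box_bump per a c n)"
      unfolding periodic_def lattice_vectors_def box_bump_def using True by (simp add: coord_bump_periodic)
    then show ?thesis using D True by (auto simp: space_test_def)
  next
    case False
    have "compact (cbox a c)" by simp
    moreover have "cbox a c \<subseteq> interior unit_cell"
      unfolding unit_cell_def interior_cbox
    proof
      fix x assume "x \<in> cbox a c"
      then have "a $ i \<le> x $ i \<and> x $ i \<le> c $ i" for i by (simp add: mem_box_cart)
      then have "0 < x $ i \<and> x $ i < 1" for i using ac[of i] by (meson le_less_trans less_le_trans)
      then show "x \<in> box 0 1" by (simp add: mem_box_cart)
    qed
    moreover have "box_bump per a c n x = 0" if x: "x \<notin> cbox a c" for x
    proof -
      obtain i where i: "\<not> (a $ i \<le> x $ i \<and> x $ i \<le> c $ i)" using x by (auto simp: mem_box_cart)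
      then have "coord_bump per (a $ i) (c $ i) (x $ i) \<le> 0"
        using ac[of i] False by (auto simp: coord_bump_def mult_le_0_iff)
      then show ?thesis unfolding box_bump_def by (intro prod_zero) (auto intro!: exI[of _ i] smooth_step_nonpos)
    qed
    ultimately have "\<exists>K. compact K \<and> K \<subseteq> interior unit_cell \<and> (\<forall>x. x \<notin> K \<longrightarrow> box_bump per a c n x = 0)"
      by (intro exI[of _ "cbox a c"] conjI allI impI)
    then have "space_test per (box_bump per a c n) D"
      unfolding space_test_def if_not_P[OF False] using D by (rule conjI[rotated])
    then show ?thesis by (rule exI[of _ D])
  qed
qed

lemma box_bump_tendsto:
  assumes ac: "\<And>i. 0 < a $ i \<and> a $ i < c $ i \<and> c $ i < 1" and x: "x \<in> unit_cell"
  shows "(\<lambda>n. box_bump per a c n x) \<longlonglongrightarrow> indicator (box a c) x"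
proof -
  have "(\<lambda>n. box_bump per a c n x) \<longlonglongrightarrow> (\<Prod>i\<in>UNIV. if coord_bump per (a $ i) (c $ i) (x $ i) > 0 then 1 else 0)"
    unfolding box_bump_def by (intro tendsto_prod smooth_step_tendsto)
  also have "(\<Prod>i\<in>UNIV. if coord_bump per (a $ i) (c $ i) (x $ i) > 0 then 1 else (0::real)) =
      (\<Prod>i\<in>UNIV. if a $ i < x $ i \<and> x $ i < c $ i then 1 else 0)"
    using x ac by (intro prod.cong refl) (simp add: coord_bump_pos_iff unit_cell_def mem_box_cart)
  also have "\<dots> = indicator (box a c) x"
  proof (cases "x \<in> box a c")
    case True
    then show ?thesis by (simp add: mem_box_cart)
  next
    case False
    then obtain i where "\<not> (a $ i < x $ i \<and> x $ i < c $ i)" by (auto simp: mem_box_cart)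
    then have "(\<Prod>i\<in>UNIV. if a $ i < x $ i \<and> x $ i < c $ i then 1 else (0::real)) = 0"
      by (intro prod_zero) (auto intro!: exI[of _ i])
    then show ?thesis using False by simp
  qed
  finally show ?thesis .
qed

lemma fundamental_lemma_cell:
  fixes h :: "real^'d \<Rightarrow> real"
  assumes h: "integrable (lebesgue_on unit_cell) h"
    and test: "\<And>\<psi> D. space_test per \<psi> D \<Longrightarrow> (LINT x|lebesgue_on unit_cell. h x * \<psi> x) = 0"
  shows "AE x in lebesgue_on unit_cell. h x = 0"
  unfolding unit_cell_def
proof (rule fundamental_lemma)
  fix a c :: "real^'d"
  assume ac: "\<forall>b\<in>Basis. 0 \<bullet> b < a \<bullet> b \<and> a \<bullet> b < c \<bullet> b \<and> c \<bullet> b < 1 \<bullet> b"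
  have ac': "0 < a $ i \<and> a $ i < c $ i \<and> c $ i < 1" for i
    using ac[rule_format, of "axis i 1"] by (auto simp: inner_axis axis_in_Basis_iff)
  show "\<exists>\<phi>::nat \<Rightarrow> real^'d \<Rightarrow> real. (\<forall>n. \<phi> n \<in> borel_measurable borel) \<and> (\<forall>n z. \<bar>\<phi> n z\<bar> \<le> 1) \<and>
        (\<forall>z\<in>cbox 0 1. (\<lambda>n. \<phi> n z) \<longlonglongrightarrow> indicator (box a c) z) \<and>
        (\<forall>n. (LINT z|lebesgue_on (cbox 0 1). h z * \<phi> n z) = 0)"
  proof (intro exI[of _ "box_bump per a c"] conjI allI ballI)
    fix n
    show "box_bump per a c n \<in> borel_measurable borel"
      using box_bump_C1 C1_measurable by blast
    show "\<bar>box_bump per a c n z\<bar> \<le> 1" for z using box_bump_range[of per a c n z] by simp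
    show "(LINT z|lebesgue_on (cbox 0 1). h z * box_bump per a c n z) = 0"
      using box_bump_test[OF ac'] test by (metis unit_cell_def)
  qed (use box_bump_tendsto[OF ac'] in \<open>auto simp: unit_cell_def\<close>)
qed (use h in \<open>simp add: unit_cell_def\<close>)

lemma Omega_cbox: "Omega = cbox (0, 0) (1, 1)"
  by (simp add: Omega_def unit_cell_def cbox_Pair_eq)

lemma fundamental_lemma_Omega:
  fixes h :: "(real^'d) \<times> real \<Rightarrow> real"
  assumes h: "integrable (lebesgue_on Omega) h"
    and test: "\<And>\<phi> D. spacetime_test0 per \<phi> D \<Longrightarrow> (LINT z|lebesgue_on Omega. h z * \<phi> z) = 0"
  shows "AE z in lebesgue_on Omega. h z = 0"
  unfolding Omega_cbox
proof (rule fundamental_lemma)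
  fix a c :: "(real^'d) \<times> real"
  assume ac: "\<forall>b\<in>Basis. (0, 0) \<bullet> b < a \<bullet> b \<and> a \<bullet> b < c \<bullet> b \<and> c \<bullet> b < (1, 1) \<bullet> b"
  have ac1: "0 < fst a $ i \<and> fst a $ i < fst c $ i \<and> fst c $ i < 1" for i
    using ac[rule_format, of "(axis i 1, 0)"] by (auto simp: inner_prod_def inner_axis axis_in_Basis_iff Basis_prod_def)
  have ac2: "0 < snd a" "snd a < snd c" "snd c < 1"
    using ac[rule_format, of "(0, 1)"] by (auto simp: inner_prod_def Basis_prod_def)
  define \<tau> where "\<tau> = (\<lambda>n s. smooth_step n (coord_bump False (snd a) (snd c) s))"
  define \<phi> where "\<phi> = (\<lambda>n z. box_bump per (fst a) (fst c) n (fst z) * \<tau> n (snd z))"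
  have \<phi>test: "\<exists>D. spacetime_test0 per (\<phi> n) D" for n
  proof -
    obtain D where D: "space_test per (box_bump per (fst a) (fst c) n) D" using box_bump_test[OF ac1] by blast
    then have D1: "C1_with_grad (box_bump per (fst a) (fst c) n) D" by (simp add: space_test_def)
    obtain p' where p: "\<forall>s. (\<tau> n has_real_derivative p' s) (at s)" "continuous_on UNIV p'"
      unfolding \<tau>_def using smooth_bump_deriv by blast
    have 0: "\<tau> n t = 0" if "t \<notin> {snd a..snd c}" for t
      using that ac2 unfolding \<tau>_def by (intro smooth_step_nonpos) (auto simp: coord_bump_def mult_le_0_iff)
    have "{snd a..snd c} \<subseteq> {0<..<1}" using ac2 by auto
    then have J: "\<exists>J. compact J \<and> J \<subseteq> {0<..<1} \<and> (\<forall>x t. t \<notin> J \<longrightarrow> \<phi> n (x, t) = 0)"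
      using 0 by (intro exI[of _ "{snd a..snd c}"]) (auto simp: \<phi>_def)
    have P: "if per then (\<forall>t. periodic (\<lambda>x. \<phi> n (x, t)))
      else (\<exists>K. compact K \<and> K \<subseteq> interior unit_cell \<and> (\<forall>x t. x \<notin> K \<longrightarrow> \<phi> n (x, t) = 0))"
    proof (cases per)
      case True
      then show ?thesis using D by (auto simp: space_test_def periodic_def \<phi>_def)
    next
      case False
      then obtain K where "compact K" "K \<subseteq> interior unit_cell" "\<forall>x. x \<notin> K \<longrightarrow> box_bump per (fst a) (fst c) n x = 0"
        using D by (auto simp: space_test_def)
      then show ?thesis using False by (auto simp: \<phi>_def)
    qed
    from C1_fst_snd[OF D1 p(1)[rule_format] p(2)] J P show ?thesis
      unfolding spacetime_test0_def spacetime_test_def \<phi>_def by blast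
  qed
  show "\<exists>\<phi>::nat \<Rightarrow> (real^'d) \<times> real \<Rightarrow> real. (\<forall>n. \<phi> n \<in> borel_measurable borel) \<and> (\<forall>n z. \<bar>\<phi> n z\<bar> \<le> 1) \<and>
        (\<forall>z\<in>cbox (0, 0) (1, 1). (\<lambda>n. \<phi> n z) \<longlonglongrightarrow> indicator (box a c) z) \<and>
        (\<forall>n. (LINT z|lebesgue_on (cbox (0, 0) (1, 1)). h z * \<phi> n z) = 0)"
  proof (intro exI[of _ \<phi>] conjI allI ballI)
    fix n
    show "\<phi> n \<in> borel_measurable borel"
      using \<phi>test[of n] C1_measurable unfolding spacetime_test0_def spacetime_test_def by blast
    have "\<bar>\<tau> n s\<bar> \<le> 1" for s unfolding \<tau>_def using smooth_step_range by (simp add: abs_of_nonneg)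
    moreover have "\<bar>box_bump per (fst a) (fst c) n x\<bar> \<le> 1" for x using box_bump_range[of per "fst a" "fst c" n x] by simp
    ultimately show "\<bar>\<phi> n z\<bar> \<le> 1" for z unfolding \<phi>_def abs_mult by (intro mult_le_one) auto
    show "(LINT z|lebesgue_on (cbox (0, 0) (1, 1)). h z * \<phi> n z) = 0"
      using \<phi>test[of n] test unfolding Omega_cbox[symmetric] by blast
  next
    fix z :: "(real^'d) \<times> real" assume "z \<in> cbox (0, 0) (1, 1)"
    then have z: "fst z \<in> unit_cell" "0 \<le> snd z" "snd z \<le> 1"
      using Omega_cbox unfolding Omega_def by (auto simp: cbox_Pair_eq unit_cell_def)
    have "(\<lambda>n. \<tau> n (snd z)) \<longlonglongrightarrow> (if coord_bump False (snd a) (snd c) (snd z) > 0 then 1 else 0)"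
      unfolding \<tau>_def by (rule smooth_step_tendsto)
    then have "(\<lambda>n. \<phi> n z) \<longlonglongrightarrow> indicator (box (fst a) (fst c)) (fst z) * (if coord_bump False (snd a) (snd c) (snd z) > 0 then 1 else 0)"
      unfolding \<phi>_def by (intro tendsto_mult box_bump_tendsto[OF ac1 z(1)])
    moreover have "z \<in> box a c \<longleftrightarrow> fst z \<in> box (fst a) (fst c) \<and> snd a < snd z \<and> snd z < snd c"
      by (subst box_prod) (simp add: mem_Times_iff)
    ultimately show "(\<lambda>n. \<phi> n z) \<longlonglongrightarrow> indicator (box a c) z"
      by (simp add: coord_bump_pos_iff[OF ac2 z(2,3)] indicator_def if_distrib of_bool_def cong: if_cong)
        (auto split: if_splits)
  qed
qed (use h in \<open>simp add: Omega_cbox\<close>)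

lemma unit_cell_props:
  "unit_cell \<in> lmeasurable" "unit_cell \<in> sets lebesgue" "compact unit_cell" "convex unit_cell"
  "unit_cell \<in> sets borel" "(unit_cell :: (real^'d) set) \<noteq> {}"
  by (auto simp: unit_cell_def interval_eq_empty_cart(2))

section \<open>Lipschitz functions with continuous gradient off a null set\<close>

text \<open>The common class of finite element functions, test functions and their products.  The Lipschitz
  bound justifies dominated convergence for difference quotients, and continuity of the gradient on an
  open set makes mollified gradients converge there.  Setting the gradient to zero off \<open>W\<close> makes it a
  Borel function.\<close>

definition ae_C1 :: "'a::euclidean_space set \<Rightarrow> ('a \<Rightarrow> real) \<Rightarrow> 'a set \<Rightarrow> ('a \<Rightarrow> 'a) \<Rightarrow> bool" where
  "ae_C1 S F W DF \<longleftrightarrow> (\<exists>L. L-lipschitz_on S F) \<and> open W \<and> W \<subseteq> S \<and> negligible (S - W) \<and>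
     (\<forall>z\<in>W. GDERIV F z :> DF z) \<and> continuous_on W DF \<and> (\<forall>z. z \<notin> W \<longrightarrow> DF z = 0)"

lemma gderiv_bounded_by_lipschitz:
  fixes F :: "'a::euclidean_space \<Rightarrow> real"
  assumes L: "L-lipschitz_on W F" and W: "open W" "z \<in> W" and D: "GDERIV F z :> D"
  shows "norm D \<le> L"
proof (cases "D = 0")
  case True
  then show ?thesis using lipschitz_on_nonneg[OF L] by simp
next
  case False
  have "((\<lambda>t::real. F (z + t *\<^sub>R D)) has_derivative (\<lambda>t. (t *\<^sub>R D) \<bullet> D)) (at 0)"
    using D unfolding gderiv_def
    by (intro has_derivative_compose[of "\<lambda>t. z + t *\<^sub>R D" "\<lambda>t. t *\<^sub>R D" 0 UNIV F "\<lambda>h. h \<bullet> D"])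
      (auto intro!: derivative_eq_intros)
  then have "((\<lambda>t::real. F (z + t *\<^sub>R D)) has_real_derivative (D \<bullet> D)) (at 0)"
    unfolding has_field_derivative_def by (simp add: mult_commute_abs)
  then have lim: "((\<lambda>t. (F (z + t *\<^sub>R D) - F z) / t) \<longlongrightarrow> D \<bullet> D) (at 0)"
    by (simp add: DERIV_def)
  have "((\<lambda>t::real. z + t *\<^sub>R D) \<longlongrightarrow> z + 0 *\<^sub>R D) (at 0)" by (intro tendsto_intros)
  then have "\<forall>\<^sub>F t in at (0::real). z + t *\<^sub>R D \<in> W"
    using W by (auto dest: topological_tendstoD)
  then have "\<forall>\<^sub>F t in at (0::real). (F (z + t *\<^sub>R D) - F z) / t \<le> L * norm D"
    using eventually_neq_at_within[of 0 0 UNIV]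
  proof eventually_elim
    case (elim t)
    have "\<bar>F (z + t *\<^sub>R D) - F z\<bar> \<le> L * (\<bar>t\<bar> * norm D)"
      using lipschitz_onD[OF L elim(1) W(2)] by (simp add: dist_norm)
    then have "\<bar>(F (z + t *\<^sub>R D) - F z) / t\<bar> \<le> L * norm D"
      using elim(2) by (simp add: abs_divide divide_le_eq mult_ac)
    then show ?case by linarith
  qed
  then have "D \<bullet> D \<le> L * norm D"
    by (rule tendsto_upperbound[OF lim]) simp
  then have "norm D * norm D \<le> L * norm D" by (simp add: dot_square_norm power2_eq_square)
  then show ?thesis using False by (simp add: mult_le_cancel_right)
qed

lemma ae_C1_bound:
  assumes "ae_C1 S F W DF" "L-lipschitz_on S F"
  shows "norm (DF z) \<le> L"
proof (cases "z \<in> W")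
  case True
  have "L-lipschitz_on W F" using assms unfolding ae_C1_def by (auto intro: lipschitz_on_subset)
  then show ?thesis using gderiv_bounded_by_lipschitz[of L W F z "DF z"] assms(1) True
    unfolding ae_C1_def by blast
next
  case False
  then show ?thesis using assms lipschitz_on_nonneg unfolding ae_C1_def by auto
qed

lemma ae_C1_bounded: "ae_C1 S F W DF \<Longrightarrow> \<exists>L. \<forall>z. norm (DF z) \<le> L"
  using ae_C1_bound unfolding ae_C1_def by blast

lemma ae_C1_measurable_grad:
  assumes "ae_C1 S F W DF"
  shows "DF \<in> borel_measurable borel"
proof -
  have "(\<lambda>x. indicator W x *\<^sub>R DF x) \<in> borel_measurable borel"
    using assms unfolding ae_C1_def by (intro borel_measurable_continuous_on_indicator) auto
  also have "(\<lambda>x. indicator W x *\<^sub>R DF x) = DF"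
    using assms unfolding ae_C1_def by (auto simp: indicator_def fun_eq_iff)
  finally show ?thesis .
qed

lemma ae_C1_continuous: "ae_C1 S F W DF \<Longrightarrow> continuous_on S F"
  unfolding ae_C1_def using lipschitz_on_continuous_on by blast

lemma ae_C1_AE: "ae_C1 S F W DF \<Longrightarrow> S \<in> sets lebesgue \<Longrightarrow> AE z in lebesgue_on S. z \<in> W"
proof -
  assume F: "ae_C1 S F W DF" and S: "S \<in> sets lebesgue"
  have "AE z in lebesgue. z \<notin> S - W"
    using F unfolding ae_C1_def negligible_iff_null_sets by (intro AE_not_in) blast
  then show ?thesis using S by (subst AE_restrict_space_iff) (auto elim: eventually_mono)
qed

lemma lipschitz_on_mult_bounded:
  fixes F G :: "'a::metric_space \<Rightarrow> real"
  assumes "L-lipschitz_on S F" "M-lipschitz_on S G"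
    and B: "\<And>x. x \<in> S \<Longrightarrow> \<bar>F x\<bar> \<le> B" "\<And>x. x \<in> S \<Longrightarrow> \<bar>G x\<bar> \<le> C"
  shows "(\<bar>C\<bar> * L + \<bar>B\<bar> * M)-lipschitz_on S (\<lambda>x. F x * G x)"
proof (rule lipschitz_onI)
  have LM: "0 \<le> L" "0 \<le> M" using assms lipschitz_on_nonneg by blast+
  then show "0 \<le> \<bar>C\<bar> * L + \<bar>B\<bar> * M" by simp
  fix x y assume xy: "x \<in> S" "y \<in> S"
  have "F x * G x - F y * G y = (F x - F y) * G x + F y * (G x - G y)" by (simp add: algebra_simps)
  also have "\<bar>\<dots>\<bar> \<le> \<bar>F x - F y\<bar> * \<bar>G x\<bar> + \<bar>F y\<bar> * \<bar>G x - G y\<bar>"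
    by (simp add: abs_mult[symmetric] abs_triangle_ineq)
  also have "\<dots> \<le> (L * dist x y) * \<bar>C\<bar> + \<bar>B\<bar> * (M * dist x y)"
  proof (intro add_mono mult_mono)
    show "\<bar>F x - F y\<bar> \<le> L * dist x y" "\<bar>G x - G y\<bar> \<le> M * dist x y"
      using lipschitz_onD[OF assms(1) xy] lipschitz_onD[OF assms(2) xy] by (auto simp: dist_real_def)
    show "\<bar>G x\<bar> \<le> \<bar>C\<bar>" "\<bar>F y\<bar> \<le> \<bar>B\<bar>" using B xy by fastforce+
  qed (use LM in auto)
  finally show "dist (F x * G x) (F y * G y) \<le> (\<bar>C\<bar> * L + \<bar>B\<bar> * M) * dist x y"
    by (simp add: dist_real_def algebra_simps)
qed

lemma ae_C1_mult:
  assumes F: "ae_C1 S F W DF" and G: "ae_C1 S G U DG"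
    and B: "\<And>x. x \<in> S \<Longrightarrow> \<bar>F x\<bar> \<le> B" "\<And>x. x \<in> S \<Longrightarrow> \<bar>G x\<bar> \<le> C"
  shows "ae_C1 S (\<lambda>z. F z * G z) (W \<inter> U)
    (\<lambda>z. if z \<in> W \<inter> U then F z *\<^sub>R DG z + G z *\<^sub>R DF z else 0)"
  unfolding ae_C1_def
proof (intro conjI ballI)
  obtain L M where "L-lipschitz_on S F" "M-lipschitz_on S G" using F G unfolding ae_C1_def by blast
  from lipschitz_on_mult_bounded[OF this B]
  show "\<exists>L. L-lipschitz_on S (\<lambda>x. F x * G x)" by blast
  have "S - W \<inter> U = (S - W) \<union> (S - U)" by blast
  then show "negligible (S - W \<inter> U)" using F G unfolding ae_C1_def by simp
  have "continuous_on (W \<inter> U) F" "continuous_on (W \<inter> U) G"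
    using F G ae_C1_continuous[OF F] ae_C1_continuous[OF G] unfolding ae_C1_def
    by (meson continuous_on_subset inf.coboundedI1)+
  moreover have "continuous_on (W \<inter> U) DF" "continuous_on (W \<inter> U) DG"
    using F G unfolding ae_C1_def by (meson continuous_on_subset inf_le1 inf_le2)+
  ultimately have "continuous_on (W \<inter> U) (\<lambda>z. F z *\<^sub>R DG z + G z *\<^sub>R DF z)"
    by (intro continuous_intros)
  then show "continuous_on (W \<inter> U) (\<lambda>z. if z \<in> W \<inter> U then F z *\<^sub>R DG z + G z *\<^sub>R DF z else 0)"
    by (rule continuous_on_eq) simp
qed (use F G in \<open>auto simp: ae_C1_def intro!: GDERIV_mult\<close>)

lemma C1_imp_ae_C1:
  assumes \<phi>: "C1_with_grad \<phi> D" and S: "convex S" and B: "\<And>z. z \<in> S \<Longrightarrow> norm (D z) \<le> B"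
  shows "ae_C1 S \<phi> (interior S) (\<lambda>z. if z \<in> interior S then D z else 0)"
  unfolding ae_C1_def
proof (intro conjI ballI)
  have "\<bar>B\<bar>-lipschitz_on S \<phi>"
  proof (rule bounded_derivative_imp_lipschitz[OF _ S, where f' = "\<lambda>z h. h \<bullet> D z"])
    show "(\<phi> has_derivative (\<lambda>h. h \<bullet> D x)) (at x within S)" for x
      using \<phi> unfolding C1_with_grad_def gderiv_def by (blast intro: has_derivative_at_withinI)
    show "onorm (\<lambda>h. h \<bullet> D x) \<le> \<bar>B\<bar>" if "x \<in> S" for x
    proof (rule onorm_le)
      fix h show "norm (h \<bullet> D x) \<le> \<bar>B\<bar> * norm h"
        using Cauchy_Schwarz_ineq2[of h "D x"] B[OF that]
        by (smt (verit, ccfv_SIG) mult.commute mult_left_mono norm_ge_zero real_norm_def)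
    qed
  qed simp
  then show "\<exists>L. L-lipschitz_on S \<phi>" by blast
  have "S - interior S \<subseteq> frontier S" using closure_subset by (auto simp: frontier_def)
  then show "negligible (S - interior S)" using negligible_convex_frontier[OF S] negligible_subset by blast
  have "continuous_on (interior S) D" using \<phi> unfolding C1_with_grad_def by (meson continuous_on_subset subset_UNIV)
  then show "continuous_on (interior S) (\<lambda>z. if z \<in> interior S then D z else 0)"
    by (rule continuous_on_eq) simp
qed (use \<phi> interior_subset in \<open>auto simp: C1_with_grad_def\<close>)

text \<open>The product \<open>\<psi> G\<close> has compact support in the cell, so the integral of each of its difference quotients
  is zero by translation invariance; the quotients converge to the partial derivative almost everywhere
  and are bounded by the Lipschitz constant.\<close>

lemma test_derivative_integral_zero:
  fixes \<psi> G :: "real^'d \<Rightarrow> real"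
  assumes \<psi>: "space_test False \<psi> D" and G: "ae_C1 unit_cell G W DG"
  shows "(LINT x|lebesgue_on unit_cell. \<psi> x * DG x $ j) = - (LINT x|lebesgue_on unit_cell. D x $ j * G x)"
proof -
  let ?C = "unit_cell :: (real^'d) set"
  let ?M = "lebesgue_on ?C"
  obtain K where K: "compact K" "K \<subseteq> interior ?C" "\<And>x. x \<notin> K \<Longrightarrow> \<psi> x = 0"
    using \<psi> unfolding space_test_def by auto
  have C1: "C1_with_grad \<psi> D" using \<psi> by (simp add: space_test_def)
  have D: "continuous_on UNIV D" "\<And>z. GDERIV \<psi> z :> D z" using C1 by (auto simp: C1_with_grad_def)
  obtain BD where BD: "\<And>x. x \<in> ?C \<Longrightarrow> norm (D x) \<le> BD"
    using compact_bounded_fun[OF unit_cell_props(3) continuous_on_subset[OF D(1)]] by auto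
  have ae\<psi>: "ae_C1 ?C \<psi> (interior ?C) (\<lambda>z. if z \<in> interior ?C then D z else 0)"
    by (rule C1_imp_ae_C1[OF C1 unit_cell_props(4) BD])
  obtain BG where BG: "\<And>x. x \<in> ?C \<Longrightarrow> norm (G x) \<le> BG"
    using compact_bounded_fun[OF unit_cell_props(3) ae_C1_continuous[OF G]] by auto
  obtain Bp where Bp: "\<And>x. x \<in> ?C \<Longrightarrow> norm (\<psi> x) \<le> Bp"
    using compact_bounded_fun[OF unit_cell_props(3) ae_C1_continuous[OF ae\<psi>]] by auto
  obtain LG where LG: "\<And>x. norm (DG x) \<le> LG" using ae_C1_bounded[OF G] by blast
  define P where "P = (\<lambda>x. \<psi> x * G x)"
  define DP where "DP = (\<lambda>x. \<psi> x *\<^sub>R DG x + G x *\<^sub>R D x)"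
  obtain L where L: "L-lipschitz_on ?C P"
    using ae_C1_mult[OF ae\<psi> G] Bp BG unfolding P_def ae_C1_def by (metis real_norm_def)
  have L0: "0 \<le> L" using lipschitz_on_nonneg[OF L] .
  have P0: "P x = 0" if "x \<notin> K" for x using K(3)[OF that] by (simp add: P_def)
  have KC: "K \<subseteq> ?C" using K(2) interior_subset by blast
  obtain e where e: "0 < e" "(\<Union>x\<in>K. ball x e) \<subseteq> interior ?C"
    using compact_subset_open_imp_ball_epsilon_subset[OF K(1) open_interior K(2)] by blast
  have near: "\<bar>P (x + h) - P x\<bar> \<le> L * norm h" if h: "norm h < e" for x h
  proof -
    consider "x \<in> K" | "x + h \<in> K" | "x \<notin> K" "x + h \<notin> K" by blast
    then show ?thesis
    proof cases
      case 1
      then have "x + h \<in> ball x e" using h by (simp add: dist_norm)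
      then have "x + h \<in> ?C" using e(2) 1 interior_subset by blast
      then show ?thesis using lipschitz_onD[OF L, of "x + h" x] 1 KC by (auto simp: dist_norm)
    next
      case 2
      then have "x \<in> ball (x + h) e" using h by (simp add: dist_norm)
      then have "x \<in> ?C" using e(2) 2 interior_subset by blast
      then show ?thesis using lipschitz_onD[OF L, of "x + h" x] 2 KC by (auto simp: dist_norm)
    next
      case 3
      then show ?thesis using P0 L0 by simp
    qed
  qed
  have Pc: "continuous_on ?C P" using L lipschitz_on_continuous_on by blast
  have Pm: "P \<in> borel_measurable borel"
  proof -
    have "(\<lambda>x. indicator ?C x *\<^sub>R P x) \<in> borel_measurable borel"
      using Pc unit_cell_props by (intro borel_measurable_continuous_on_indicator) auto
    also have "(\<lambda>x. indicator ?C x *\<^sub>R P x) = P" using P0 KC by (auto simp: indicator_def fun_eq_iff)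
    finally show ?thesis .
  qed
  have cC: "emeasure lborel ?C < \<infinity>" unfolding unit_cell_def by (rule emeasure_lborel_cbox_finite)
  have Pi: "integrable lborel P"
  proof (rule integrableI_bounded_set[where A = ?C and B = "\<bar>BG\<bar> * \<bar>Bp\<bar>"])
    show "AE x in lborel. x \<in> ?C \<longrightarrow> norm (P x) \<le> \<bar>BG\<bar> * \<bar>Bp\<bar>"
    proof (intro AE_I2 impI)
      fix x assume "x \<in> ?C"
      then have "\<bar>\<psi> x\<bar> \<le> \<bar>Bp\<bar>" "\<bar>G x\<bar> \<le> \<bar>BG\<bar>" using Bp BG by fastforce+
      then show "norm (P x) \<le> \<bar>BG\<bar> * \<bar>Bp\<bar>" 
        unfolding P_def real_norm_def abs_mult by (subst mult.commute, intro mult_mono) auto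
    qed
    show "AE x in lborel. x \<notin> ?C \<longrightarrow> P x = 0" using P0 KC by (intro AE_I2) auto
  qed (use Pm cC unit_cell_props in auto)
  \<comment> \<open>Steps \<open>r n\<close> below \<open>e\<close> and at most \<open>1\<close>: the first makes the Lipschitz bound valid across the boundary of
    the cell, the second keeps the supports of all quotients in a fixed box.\<close>
  define N where "N = nat \<lceil>1 / e\<rceil>"
  define r where "r = (\<lambda>n::nat. 1 / (real n + real N + 1))"
  have r: "0 < r n" "r n < e" "r n \<le> 1" for n
  proof -
    have "1 / e \<le> real N" by (simp add: N_def real_nat_ceiling_ge)
    then have "1 / e < real n + real N + 1" by linarith
    then show "r n < e" unfolding r_def using e(1) by (simp add: field_simps add_pos_nonneg)
    show "0 < r n" "r n \<le> 1" unfolding r_def by (auto simp: add_pos_nonneg)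
  qed
  have r0: "r \<longlonglongrightarrow> 0"
    using LIMSEQ_ignore_initial_segment[OF lim_inverse_n', of "N + 1"] by (simp add: r_def add_ac)
  have DPm: "(\<lambda>x. indicator ?C x * DP x $ j) \<in> borel_measurable lborel"
  proof -
    have "DG \<in> borel_measurable borel" by (rule ae_C1_measurable_grad[OF G])
    moreover have "D \<in> borel_measurable borel" using D(1) by (rule borel_measurable_continuous_onI)
    moreover have "\<psi> \<in> borel_measurable borel" using C1 by (rule C1_measurable)
    moreover have "(\<lambda>x. indicator ?C x *\<^sub>R G x) \<in> borel_measurable borel"
      using ae_C1_continuous[OF G] unit_cell_props by (intro borel_measurable_continuous_on_indicator) auto
    ultimately have "(\<lambda>x. indicator ?C x * (\<psi> x * (DG x \<bullet> axis j 1)) + (indicator ?C x *\<^sub>R G x) * (D x \<bullet> axis j 1)) \<in> borel_measurable borel"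
      using unit_cell_props(5) by (intro borel_measurable_add borel_measurable_times borel_measurable_inner borel_measurable_indicator) auto
    then show ?thesis
      by (simp add: DP_def inner_axis algebra_simps)
  qed
  define f where "f = (\<lambda>n x. (P (r n *\<^sub>R axis j 1 + x) - P x) / r n)"
  have nr: "norm (r n *\<^sub>R axis j (1::real) :: real^'d) = r n" for n using r(1)[of n] by (simp add: norm_axis_1)
  have f0: "(LINT x|lborel. f n x) = 0" for n
  proof -
    have "(LINT x|lborel. f n x) = ((LINT x|lborel. P (r n *\<^sub>R axis j 1 + x)) - (LINT x|lborel. P x)) / r n"
      unfolding f_def using Pi lborel_integrable_shift[OF Pi] by simp
    then show ?thesis using lborel_integral_shift[OF Pm] by simp
  qed
  have lim: "(\<lambda>n. LINT x|lborel. f n x) \<longlonglongrightarrow> (LINT x|lborel. indicator ?C x * DP x $ j)"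
  proof (rule integral_dominated_convergence[where w = "\<lambda>x. L * indicator (cbox (-1) 2) x"])
    have W: "AE x in lborel. x \<in> ?C \<longrightarrow> x \<in> W"
    proof -
      have "negligible (?C - W)" "?C - W \<in> sets borel"
        using G unit_cell_props unfolding ae_C1_def by auto
      then have "?C - W \<in> null_sets lborel" by (simp add: negligible_iff_null_sets null_sets_completion_iff)
      from AE_not_in[OF this] show ?thesis by eventually_elim auto
    qed
    then show "AE x in lborel. (\<lambda>n. f n x) \<longlonglongrightarrow> indicator ?C x * DP x $ j"
    proof eventually_elim
      case (elim x)
      have shift: "(\<lambda>n. r n *\<^sub>R axis j 1 + x) \<longlonglongrightarrow> 0 *\<^sub>R axis j 1 + x" by (intro tendsto_intros r0)
      show ?case
      proof (cases "x \<in> ?C")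
        case False
        then have "x \<in> - K" using KC by auto
        then have "\<forall>\<^sub>F n in sequentially. r n *\<^sub>R axis j 1 + x \<in> - K"
          using shift K(1) by (intro topological_tendstoD[OF shift]) (auto simp: compact_imp_closed open_Compl)
        then have "\<forall>\<^sub>F n in sequentially. f n x = 0"
          by eventually_elim (use P0 \<open>x \<in> - K\<close> in \<open>auto simp: f_def\<close>)
        then show ?thesis using False by (simp add: tendsto_eventually)
      next
        case True
        then have "GDERIV G x :> DG x" using elim G unfolding ae_C1_def by blast
        then have "GDERIV P x :> DP x" unfolding P_def DP_def by (intro GDERIV_mult D(2))
        then have "(P has_derivative (\<lambda>h. h \<bullet> DP x)) (at x)" by (simp add: gderiv_def)
        then have "((\<lambda>t::real. P (t *\<^sub>R axis j 1 + x)) has_derivative (\<lambda>t. (t *\<^sub>R axis j 1) \<bullet> DP x)) (at 0)"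
          by (intro has_derivative_compose[of "\<lambda>t. t *\<^sub>R axis j 1 + x" "\<lambda>t. t *\<^sub>R axis j 1" 0 UNIV P "\<lambda>h. h \<bullet> DP x"])
            (auto intro!: derivative_eq_intros)
        then have "((\<lambda>t::real. P (t *\<^sub>R axis j 1 + x)) has_real_derivative (DP x $ j)) (at 0)"
          unfolding has_field_derivative_def by (simp add: mult_commute_abs inner_axis')
        then have "((\<lambda>t. (P (t *\<^sub>R axis j 1 + x) - P x) / t) \<longlongrightarrow> DP x $ j) (at 0)"
          by (simp add: DERIV_def)
        moreover have "filterlim r (at 0) sequentially"
          unfolding filterlim_at using r0 r(1) by (auto simp: less_imp_neq[symmetric])
        ultimately have "(\<lambda>n. (P (r n *\<^sub>R axis j 1 + x) - P x) / r n) \<longlonglongrightarrow> DP x $ j"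
          by (rule filterlim_compose)
        then show ?thesis using True by (simp add: f_def)
      qed
    qed
    show "AE x in lborel. norm (f n x) \<le> L * indicator (cbox (-1) 2) x" for n
    proof (rule AE_I2)
      fix x :: "real^'d"
      have b: "norm (f n x) \<le> L"
        using near[of "r n *\<^sub>R axis j 1" x] r[of n] nr[of n]
        by (simp add: f_def add.commute divide_le_eq)
      show "norm (f n x) \<le> L * indicator (cbox (-1) 2) x"
      proof (cases "x \<in> cbox (-1) 2")
        case False
        then obtain i where i: "x $ i < -1 \<or> 2 < x $ i" by (auto simp: mem_box_cart not_le)
        have "\<bar>(r n *\<^sub>R axis j 1 :: real^'d) $ i\<bar> \<le> 1"
          using component_le_norm_cart[of "r n *\<^sub>R axis j 1 :: real^'d" i] nr[of n] r(3)[of n] by linarith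
        then have "(r n *\<^sub>R axis j 1 + x) $ i < 0 \<or> (r n *\<^sub>R axis j 1 + x) $ i > 1" using i by (auto simp del: vector_scaleR_component)
        then have "r n *\<^sub>R axis j 1 + x \<notin> ?C" unfolding unit_cell_def mem_box_cart
          by (metis not_le one_index zero_index)
        moreover have "x \<notin> ?C" using i unfolding unit_cell_def mem_box_cart
          by (metis (no_types, opaque_lifting) not_le one_index zero_index less_trans neg_less_0_iff_less one_less_numeral_iff semiring_norm(76) zero_less_one)
        ultimately have "P (r n *\<^sub>R axis j 1 + x) = 0" "P x = 0" using P0 KC by blast+
        then show ?thesis using False by (simp add: f_def)
      qed (use b in simp)
    qed
    show "f n \<in> borel_measurable lborel" for n unfolding f_def using Pm by measurable
    show "(\<lambda>x. indicator ?C x * DP x $ j) \<in> borel_measurable lborel" by (rule DPm)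
    show "integrable lborel (\<lambda>x::real^'d. L * indicator (cbox (-1) 2) x)"
      using emeasure_lborel_cbox_finite[of "-1::real^'d" 2]
      by (intro integrable_mult_right integrable_real_indicator) auto
  qed
  then have 0: "(LINT x|lborel. indicator ?C x * DP x $ j) = 0" using f0 by (simp add: LIMSEQ_const_iff)
  have m1: "(\<lambda>x. \<psi> x * DG x $ j) \<in> borel_measurable ?M"
    using borel_measurable_lebesgue_on[OF ae_C1_measurable_grad[OF G]] borel_measurable_lebesgue_on[OF C1_measurable[OF C1]]
    by (intro borel_measurable_times borel_measurable_component)
  have m2: "(\<lambda>x. D x $ j * G x) \<in> borel_measurable ?M"
    using D(1) ae_C1_continuous[OF G] unit_cell_props(2)
    by (intro borel_measurable_times borel_measurable_component continuous_lebesgue_on) (auto intro: continuous_on_subset)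
  have i1: "integrable ?M (\<lambda>x. \<psi> x * DG x $ j)"
  proof (rule integrable_bounded_lebesgue_on[OF unit_cell_props(1) m1, where B = "\<bar>Bp\<bar> * LG"])
    fix x assume "x \<in> ?C"
    then have "\<bar>\<psi> x\<bar> \<le> \<bar>Bp\<bar>" using Bp by fastforce
    moreover have "\<bar>DG x $ j\<bar> \<le> LG" using LG[of x] component_le_norm_cart[of "DG x" j] by linarith
    ultimately show "\<bar>\<psi> x * DG x $ j\<bar> \<le> \<bar>Bp\<bar> * LG" unfolding abs_mult by (intro mult_mono) auto
  qed
  have i2: "integrable ?M (\<lambda>x. D x $ j * G x)"
  proof (rule integrable_bounded_lebesgue_on[OF unit_cell_props(1) m2, where B = "\<bar>BD\<bar> * \<bar>BG\<bar>"])
    fix x assume x: "x \<in> ?C"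
    then have "\<bar>G x\<bar> \<le> \<bar>BG\<bar>" using BG by fastforce
    moreover have "\<bar>D x $ j\<bar> \<le> \<bar>BD\<bar>" using BD[OF x] component_le_norm_cart[of "D x" j] by linarith
    ultimately show "\<bar>D x $ j * G x\<bar> \<le> \<bar>BD\<bar> * \<bar>BG\<bar>" unfolding abs_mult by (intro mult_mono) auto
  qed
  have eq: "(\<lambda>x. \<psi> x * DG x $ j + D x $ j * G x) = (\<lambda>x. DP x $ j)" by (auto simp: DP_def fun_eq_iff)
  have "(LINT x|?M. \<psi> x * DG x $ j) + (LINT x|?M. D x $ j * G x) = (LINT x|?M. DP x $ j)"
    using i1 i2 unfolding eq[symmetric] by simp
  also have "\<dots> = (LINT x|lebesgue. indicator ?C x * DP x $ j)"
    using unit_cell_props(2) by (subst integral_restrict_space) auto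
  also have "\<dots> = (LINT x|lborel. indicator ?C x * DP x $ j)"
    by (rule integral_completion) (rule DPm)
  finally show ?thesis using 0 by linarith
qed

section \<open>Fields vanishing on the boundary of the cell\<close>

lemma L2_continuous_cell: "continuous_on unit_cell f \<Longrightarrow> (f :: real^'d \<Rightarrow> real) \<in> L2 unit_cell"
  using compact_bounded_fun[OF unit_cell_props(3)] L2_bounded[OF unit_cell_props(1) continuous_lebesgue_on[OF _ unit_cell_props(2)]]
  by (metis real_norm_def)

text \<open>Passing to the limit in the approximating test functions.  As these vanish near the boundary,
  no boundary term arises, whatever the values of \<open>G\<close> there.\<close>

lemma H10_integration_by_parts:
  fixes f :: "real^'d \<Rightarrow> real"
  assumes "f \<in> H10"
  shows "\<exists>g\<in>L2 unit_cell. \<forall>G W DG. ae_C1 unit_cell G W DG \<longrightarrow>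
    (\<forall>j. (LINT x|lebesgue_on unit_cell. f x * DG x $ j) = - (LINT x|lebesgue_on unit_cell. g x $ j * G x))"
proof -
  obtain g \<psi> D where f: "f \<in> L2 unit_cell" and g: "g \<in> L2 unit_cell" and t: "\<And>n::nat. space_test False (\<psi> n) (D n)"
    and l1: "(\<lambda>n. L2_norm unit_cell (\<lambda>x. \<psi> n x - f x)) \<longlonglongrightarrow> 0"
    and l2: "(\<lambda>n. L2_norm unit_cell (\<lambda>x. D n x - g x)) \<longlonglongrightarrow> 0"
    using assms unfolding H10_def by blast
  let ?M = "lebesgue_on (unit_cell :: (real^'d) set)"
  have C1: "C1_with_grad (\<psi> n) (D n)" for n using t by (simp add: space_test_def)
  have Dc: "continuous_on unit_cell (D n)" for n
    using C1[of n] unfolding C1_with_grad_def by (meson continuous_on_subset subset_UNIV)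
  have \<psi>L2: "\<psi> n \<in> L2 unit_cell" for n
    by (intro L2_continuous_cell continuous_on_subset[OF C1_continuous[OF C1]]) auto
  have DL2: "(\<lambda>x. D n x $ j) \<in> L2 unit_cell" for n j
    by (intro L2_continuous_cell continuous_intros Dc)
  have comp: "(\<lambda>x. w x $ j) \<in> L2 unit_cell" if "w \<in> L2 unit_cell" for w :: "real^'d \<Rightarrow> real^'d" and j
  proof -
    have "(\<lambda>x. w x $ j) \<in> borel_measurable ?M" using that by (auto simp: L2_def intro: borel_measurable_component)
    moreover have "integrable ?M (\<lambda>x. (w x $ j)\<^sup>2)"
    proof (rule Bochner_Integration.integrable_bound[where f = "\<lambda>x. (norm (w x))\<^sup>2", rotated])
      show "AE x in ?M. norm ((w x $ j)\<^sup>2) \<le> norm ((norm (w x))\<^sup>2)"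
        using component_le_norm_cart by (intro AE_I2) (auto intro!: power2_le_iff_abs_le[THEN iffD2] simp: abs_le_square_iff[symmetric])
    qed (use that in \<open>auto simp: L2_def intro: borel_measurable_component borel_measurable_power\<close>)
    ultimately show ?thesis by (simp add: L2_def)
  qed
  have gL2: "(\<lambda>x. g x $ j) \<in> L2 unit_cell" for j by (rule comp[OF g])
  have dL2: "(\<lambda>x. D n x - g x) \<in> L2 unit_cell" for n
  proof -
    have Dm: "D n \<in> borel_measurable ?M" by (rule continuous_lebesgue_on[OF Dc unit_cell_props(2)])
    have m: "(\<lambda>x. D n x - g x) \<in> borel_measurable ?M" using Dm g by (auto simp: L2_def)
    have "(norm (D n x - g x))\<^sup>2 = (\<Sum>j\<in>UNIV. (D n x $ j - g x $ j)\<^sup>2)" for x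
      by (simp add: norm_eq_sqrt_inner inner_vec_def power2_eq_square sum_nonneg)
    moreover have "integrable ?M (\<lambda>x. \<Sum>j\<in>UNIV. (D n x $ j - g x $ j)\<^sup>2)"
      using L2_diff[OF DL2 gL2] by (intro Bochner_Integration.integrable_sum) (simp add: L2_def)
    ultimately show ?thesis using m by (simp add: L2_def)
  qed
  have l2': "(\<lambda>n. L2_norm unit_cell (\<lambda>x. D n x $ j - g x $ j)) \<longlonglongrightarrow> 0" for j
  proof (rule Lim_null_comparison[OF _ l2], intro always_eventually allI)
    fix n
    have "(LINT x|?M. (D n x $ j - g x $ j)\<^sup>2) \<le> (LINT x|?M. (norm (D n x - g x))\<^sup>2)"
    proof (rule integral_mono)
      show "integrable ?M (\<lambda>x. (D n x $ j - g x $ j)\<^sup>2)" using L2_diff[OF DL2 gL2] by (simp add: L2_def)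
      show "integrable ?M (\<lambda>x. (norm (D n x - g x))\<^sup>2)" using dL2[of n] by (simp add: L2_def)
      show "(D n x $ j - g x $ j)\<^sup>2 \<le> (norm (D n x - g x))\<^sup>2" for x
        using component_le_norm_cart[of "D n x - g x" j] by (simp add: abs_le_square_iff[symmetric])
    qed
    then show "norm (L2_norm unit_cell (\<lambda>x. D n x $ j - g x $ j)) \<le> L2_norm unit_cell (\<lambda>x. D n x - g x)"
      by (simp add: L2_norm_def)
  qed
  show ?thesis
  proof (intro bexI[of _ g] allI impI)
    fix G W DG j assume G: "ae_C1 (unit_cell :: (real^'d) set) G W DG"
    obtain L where L: "\<And>x. norm (DG x) \<le> L" using ae_C1_bounded[OF G] by blast
    have DGL2: "(\<lambda>x. DG x $ j) \<in> L2 unit_cell"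
    proof (rule L2_bounded[OF unit_cell_props(1)])
      show "(\<lambda>x. DG x $ j) \<in> borel_measurable ?M"
        by (intro borel_measurable_component borel_measurable_lebesgue_on ae_C1_measurable_grad[OF G])
      show "\<bar>DG x $ j\<bar> \<le> L" for x using L[of x] component_le_norm_cart[of "DG x" j] by linarith
    qed
    have GL2: "G \<in> L2 unit_cell" by (rule L2_continuous_cell[OF ae_C1_continuous[OF G]])
    have "(\<lambda>n. L2_inner unit_cell (\<psi> n) (\<lambda>x. DG x $ j)) \<longlonglongrightarrow> L2_inner unit_cell f (\<lambda>x. DG x $ j)"
      by (rule L2_inner_tendsto[OF \<psi>L2 f DGL2 l1])
    moreover have "(\<lambda>n. L2_inner unit_cell (\<psi> n) (\<lambda>x. DG x $ j)) = (\<lambda>n. - L2_inner unit_cell (\<lambda>x. D n x $ j) G)"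
      using test_derivative_integral_zero[OF t G] by (simp add: L2_inner_def)
    moreover have "(\<lambda>n. - L2_inner unit_cell (\<lambda>x. D n x $ j) G) \<longlonglongrightarrow> - L2_inner unit_cell (\<lambda>x. g x $ j) G"
      by (intro tendsto_minus L2_inner_tendsto DL2 gL2 GL2 l2')
    ultimately have "L2_inner unit_cell f (\<lambda>x. DG x $ j) = - L2_inner unit_cell (\<lambda>x. g x $ j) G"
      by (metis LIMSEQ_unique)
    then show "(LINT x|?M. f x * DG x $ j) = - (LINT x|?M. g x $ j * G x)" by (simp add: L2_inner_def)
  qed (rule g)
qed

lemma L2_integrable_cell: "(f :: real^'d \<Rightarrow> real) \<in> L2 unit_cell \<Longrightarrow> integrable (lebesgue_on unit_cell) f"
  using L2_mult_integrable[of f unit_cell "\<lambda>_. 1"] L2_continuous_cell[of "\<lambda>_. 1"] by simp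

lemma weak_jac_component_integrable:
  fixes v :: "real^'d \<Rightarrow> real^'d"
  assumes A: "has_weak_jac per v A"
  shows "integrable (lebesgue_on unit_cell) (\<lambda>x. A x $ i $ j)"
proof (rule Bochner_Integration.integrable_bound)
  show "integrable (lebesgue_on unit_cell) A" using A by (simp add: has_weak_jac_def)
  then show "(\<lambda>x. A x $ i $ j) \<in> borel_measurable (lebesgue_on unit_cell)"
    by (intro borel_measurable_component borel_measurable_integrable)
  show "AE x in (lebesgue_on unit_cell). norm (A x $ i $ j) \<le> norm (A x)"
  proof (rule AE_I2)
    fix x show "norm (A x $ i $ j) \<le> norm (A x)"
      using component_le_norm_cart[of "A x $ i" j] Finite_Cartesian_Product.norm_nth_le[of "A x" i] by simp
  qed
qed

text \<open>Taking \<open>C\<^sup>1\<close> test functions for \<open>G\<close> in \<open>H10_integration_by_parts\<close> shows that the limit of the gradients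
  is a weak gradient; the fundamental lemma identifies it with the one chosen in \<open>A\<close>.\<close>

lemma H10_weak_jac_integration_by_parts:
  fixes v :: "real^'d \<Rightarrow> real^'d"
  assumes H: "(\<lambda>x. v x $ i) \<in> H10" and A: "has_weak_jac False v A" and G: "ae_C1 unit_cell G W DG"
  shows "(LINT x|lebesgue_on unit_cell. v x $ i * DG x $ j) = - (LINT x|lebesgue_on unit_cell. A x $ i $ j * G x)"
proof -
  let ?M = "lebesgue_on (unit_cell :: (real^'d) set)"
  obtain g where g: "g \<in> L2 unit_cell" and "\<forall>G W DG. ae_C1 unit_cell G W DG \<longrightarrow>
    (\<forall>j. (LINT x|?M. v x $ i * DG x $ j) = - (LINT x|?M. g x $ j * G x))"
    using H10_integration_by_parts[OF H] by (elim bexE)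
  note ibp = this(2)[rule_format]
  have Ai: "integrable ?M (\<lambda>x. A x $ i $ j)" by (rule weak_jac_component_integrable[OF A])
  have gi: "integrable ?M (\<lambda>x. g x $ j)"
  proof -
    have m: "(\<lambda>x. g x $ j) \<in> borel_measurable ?M" using g by (auto simp: L2_def intro: borel_measurable_component)
    have "integrable ?M (\<lambda>x. (norm (g x))\<^sup>2 + 1)"
      using g L2_integrable_cell[OF L2_continuous_cell[of "\<lambda>_. 1"]] by (auto simp: L2_def)
    then show ?thesis
    proof (rule Bochner_Integration.integrable_bound[OF _ m])
      have "norm (g x $ j) \<le> norm ((norm (g x))\<^sup>2 + 1)" for x
      proof -
        have "2 * norm (g x) * 1 \<le> (norm (g x))\<^sup>2 + 1\<^sup>2" by (rule sum_squares_bound)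
        then have "norm (g x) \<le> (norm (g x))\<^sup>2 + 1" using norm_ge_zero[of "g x"] by (simp only: power_one)
        then show ?thesis using component_le_norm_cart[of "g x" j] by simp
      qed
      then show "AE x in ?M. norm (g x $ j) \<le> norm ((norm (g x))\<^sup>2 + 1)" by (intro AE_I2)
    qed
  qed
  have "AE x::real^'d in ?M. A x $ i $ j - g x $ j = 0"
  proof (rule fundamental_lemma_cell[where per = False])
    show "integrable ?M (\<lambda>x. A x $ i $ j - g x $ j)" using Ai gi by simp
    fix \<psi> :: "real^'d \<Rightarrow> real" and D assume t: "space_test False \<psi> D"
    have C1: "C1_with_grad \<psi> D" using t by (simp add: space_test_def)
    obtain BD where BD: "\<And>x. x \<in> unit_cell \<Longrightarrow> norm (D x) \<le> BD"
      using compact_bounded_fun[OF unit_cell_props(3), of D] C1 unfolding C1_with_grad_def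
      by (metis continuous_on_subset subset_UNIV)
    have ae: "ae_C1 (unit_cell :: (real^'d) set) \<psi> (interior unit_cell) (\<lambda>z. if z \<in> interior unit_cell then D z else 0)"
      by (rule C1_imp_ae_C1[OF C1 unit_cell_props(4) BD])
    have "AE x::real^'d in ?M. x \<in> interior unit_cell" by (rule ae_C1_AE[OF ae unit_cell_props(2)])
    then have "(LINT x|?M. v x $ i * (if x \<in> interior unit_cell then D x else 0) $ j) = (LINT x|?M. v x $ i * D x $ j)"
      by (intro integral_cong_AE_lebesgue_on(1)[OF unit_cell_props(2)]) (auto elim: eventually_mono)
    then have "(LINT x|?M. g x $ j * \<psi> x) = (LINT x|?M. A x $ i $ j * \<psi> x)"
      using ibp[OF ae, of j] A t unfolding has_weak_jac_def by fastforce
    moreover obtain B where B: "\<And>x. x \<in> unit_cell \<Longrightarrow> norm (\<psi> x) \<le> B"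
      using compact_bounded_fun[OF unit_cell_props(3) ae_C1_continuous[OF ae]] by auto
    have "integrable ?M (\<lambda>x. A x $ i $ j * \<psi> x)" "integrable ?M (\<lambda>x. g x $ j * \<psi> x)"
      using Ai gi B borel_measurable_lebesgue_on[OF C1_measurable[OF C1]]
      by (auto intro!: integrable_mult_bounded[where B = B])
    ultimately show "(LINT x|?M. (A x $ i $ j - g x $ j) * \<psi> x) = 0"
      by (simp add: left_diff_distrib)
  qed
  then have "AE x in ?M. g x $ j * G x = A x $ i $ j * G x" by eventually_elim simp
  from integral_cong_AE_lebesgue_on(1)[OF unit_cell_props(2) this] show ?thesis using ibp[OF G] by simp
qed

section \<open>Mollification\<close>

lemma mollifier_exists:
  assumes \<delta>: "0 < \<delta>"
  obtains \<eta> :: "'a::euclidean_space \<Rightarrow> real" where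
    "continuous_on UNIV \<eta>" "\<And>y. 0 \<le> \<eta> y" "\<And>y. \<delta> \<le> norm y \<Longrightarrow> \<eta> y = 0"
    "integrable lborel \<eta>" "(LINT y|lborel. \<eta> y) = 1"
proof -
  define \<rho> where "\<rho> = (\<lambda>y::'a. max 0 (\<delta> - norm y))"
  have c: "continuous_on UNIV \<rho>" unfolding \<rho>_def by (intro continuous_intros)
  have m: "\<rho> \<in> borel_measurable borel" using c by (rule borel_measurable_continuous_onI)
  have fin: "emeasure lborel (cball (0::'a) \<delta>) < \<infinity>" using emeasure_lborel_cball_finite by blast
  have i: "integrable lborel \<rho>"
  proof (rule integrableI_bounded_set[where A = "cball 0 \<delta>" and B = \<delta>])
    show "AE x in lborel. x \<in> cball 0 \<delta> \<longrightarrow> norm (\<rho> x) \<le> \<delta>"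
      using \<delta> by (intro AE_I2) (auto simp: \<rho>_def)
    show "AE x in lborel. x \<notin> cball 0 \<delta> \<longrightarrow> \<rho> x = 0"
      by (intro AE_I2) (auto simp: \<rho>_def)
  qed (use m fin in auto)
  let ?B = "ball (0::'a) (\<delta>/2)"
  have "0 < measure lborel ?B"
  proof -
    have "emeasure lborel ?B \<noteq> 0"
      using open_not_negligible[of ?B] \<delta> by (auto simp: negligible_iff_null_sets null_sets_completion_iff null_sets_def)
    moreover have "emeasure lborel ?B < \<infinity>" using emeasure_lborel_ball_finite by blast
    ultimately show ?thesis by (simp add: measure_def enn2real_positive_iff zero_less_iff_neq_zero)
  qed
  then have "0 < (\<delta>/2) * measure lborel ?B" using \<delta> by simp
  also have "\<dots> = (LINT y|lborel. (\<delta>/2) * indicator ?B y)"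
    using \<delta> emeasure_lborel_ball_finite by simp
  also have "\<dots> \<le> (LINT y|lborel. \<rho> y)"
  proof (rule integral_mono[OF _ i])
    show "integrable lborel (\<lambda>y. (\<delta>/2) * indicat_real ?B y)"
      using emeasure_lborel_ball_finite[of "0::'a" "\<delta>/2"] by (intro integrable_mult_right integrable_real_indicator) auto
    show "(\<delta>/2) * indicator ?B y \<le> \<rho> y" for y by (auto simp: \<rho>_def indicator_def max_def)
  qed
  finally have pos: "0 < (LINT y|lborel. \<rho> y)" .
  show thesis
  proof (rule that[of "\<lambda>y. \<rho> y / (LINT y|lborel. \<rho> y)"])
    show "continuous_on UNIV (\<lambda>y. \<rho> y / (LINT y|lborel. \<rho> y))" using c pos by (intro continuous_intros) auto
  qed (use pos i in \<open>auto simp: \<rho>_def\<close>)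
qed

text \<open>A nonnegative kernel of mass one supported in a ball.  Continuity of the kernel suffices for a \<open>C\<^sup>1\<close>
  result, because the mollified function is already Lipschitz: its gradient is mollified as well, and
  mollifying a bounded function gives a continuous one.\<close>

locale mollification =
  fixes g :: "'a::euclidean_space \<Rightarrow> real" and W Dg L \<delta> and \<eta> :: "'a \<Rightarrow> real"
  assumes g: "ae_C1 UNIV g W Dg" and L: "L-lipschitz_on UNIV g"
    and \<delta>: "0 < \<delta>" and \<eta>c: "continuous_on UNIV \<eta>" and \<eta>0: "\<And>y. 0 \<le> \<eta> y" and \<eta>s: "\<And>y. \<delta> \<le> norm y \<Longrightarrow> \<eta> y = 0"
    and \<eta>i: "integrable lborel \<eta>" and \<eta>1: "(LINT y|lborel. \<eta> y) = 1"
begin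

definition moll :: "'a \<Rightarrow> real" where
  "moll x = (LINT y|lborel. \<eta> y * g (x + y))"

definition moll_grad :: "'a \<Rightarrow> 'a" where
  "moll_grad x = (LINT y|lborel. \<eta> y *\<^sub>R Dg (x + y))"

lemma g_measurable: "g \<in> borel_measurable borel"
  by (intro borel_measurable_continuous_onI ae_C1_continuous[OF g])

lemma Dg_measurable: "Dg \<in> borel_measurable borel"
  by (rule ae_C1_measurable_grad[OF g])

lemma \<eta>_measurable: "\<eta> \<in> borel_measurable borel"
  using \<eta>c by (rule borel_measurable_continuous_onI)

lemma Dg_le: "norm (Dg x) \<le> L"
  by (rule ae_C1_bound[OF g L])

lemma L_nonneg: "0 \<le> L" using lipschitz_on_nonneg[OF L] .

lemma g_le: "\<bar>g (x + y) - g x\<bar> \<le> L * norm y"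
  using lipschitz_onD[OF L, of "x + y" x] by (simp add: dist_norm)

lemma integrable_kernel:
  fixes f :: "'a \<Rightarrow> 'b::{banach, second_countable_topology}"
  assumes f: "f \<in> borel_measurable borel" and b: "\<And>y. norm y < \<delta> \<Longrightarrow> norm (f y) \<le> B"
  shows "integrable lborel (\<lambda>y. \<eta> y *\<^sub>R f y)"
proof (rule Bochner_Integration.integrable_bound)
  show "integrable lborel (\<lambda>y. B * \<eta> y)" using \<eta>i by simp
  show "(\<lambda>y. \<eta> y *\<^sub>R f y) \<in> borel_measurable lborel" using \<eta>_measurable f by simp
  have "norm (\<eta> y *\<^sub>R f y) \<le> norm (B * \<eta> y)" for y
  proof (cases "norm y < \<delta>")
    case True
    then have "norm (f y) \<le> \<bar>B\<bar>" using b by fastforce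
    then have "\<eta> y * norm (f y) \<le> \<eta> y * \<bar>B\<bar>" using \<eta>0[of y] by (intro mult_left_mono)
    then show ?thesis using \<eta>0[of y] by (simp add: abs_mult mult.commute)
  qed (use \<eta>s in auto)
  then show "AE y in lborel. norm (\<eta> y *\<^sub>R f y) \<le> norm (B * \<eta> y)" by (intro AE_I2)
qed

lemma norm_kernel_integral_le:
  fixes f :: "'a \<Rightarrow> 'b::{banach, second_countable_topology}"
  assumes f: "f \<in> borel_measurable borel" and b: "\<And>y. norm y < \<delta> \<Longrightarrow> norm (f y) \<le> B"
  shows "norm (LINT y|lborel. \<eta> y *\<^sub>R f y) \<le> B"
proof -
  have "norm (LINT y|lborel. \<eta> y *\<^sub>R f y) \<le> (LINT y|lborel. norm (\<eta> y *\<^sub>R f y))"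
    by (rule integral_norm_bound)
  also have "\<dots> \<le> (LINT y|lborel. B * \<eta> y)"
  proof (rule integral_mono)
    show "integrable lborel (\<lambda>y. norm (\<eta> y *\<^sub>R f y))" by (intro integrable_norm integrable_kernel[OF f b])
    show "integrable lborel (\<lambda>y. B * \<eta> y)" using \<eta>i by simp
    show "norm (\<eta> y *\<^sub>R f y) \<le> B * \<eta> y" for y
    proof (cases "norm y < \<delta>")
      case True
      then have "\<eta> y * norm (f y) \<le> \<eta> y * B" using \<eta>0[of y] b by (intro mult_left_mono)
      then show ?thesis using \<eta>0[of y] by (simp add: mult.commute)
    qed (use \<eta>s in auto)
  qed
  also have "\<dots> = B" using \<eta>1 by simp
  finally show ?thesis .
qed

lemma integrable_moll: "integrable lborel (\<lambda>y. \<eta> y * g (x + y))"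
proof -
  have "integrable lborel (\<lambda>y. \<eta> y *\<^sub>R g (x + y))"
  proof (rule integrable_kernel[where B = "\<bar>g x\<bar> + L * \<delta>"])
    show "(\<lambda>y. g (x + y)) \<in> borel_measurable borel" using g_measurable by simp
    fix y :: 'a assume "norm y < \<delta>"
    then have "L * norm y \<le> L * \<delta>" using L_nonneg by (intro mult_left_mono) auto
    then show "norm (g (x + y)) \<le> \<bar>g x\<bar> + L * \<delta>" using g_le[of x y] by simp
  qed
  then show ?thesis by simp
qed

lemma integrable_moll_grad: "integrable lborel (\<lambda>y. \<eta> y *\<^sub>R Dg (x + y))"
  using Dg_le Dg_measurable by (intro integrable_kernel[where B = L]) auto

lemma moll_close: "\<bar>moll x - g x\<bar> \<le> L * \<delta>"
proof -
  have "moll x - g x = (LINT y|lborel. \<eta> y * g (x + y)) - (LINT y|lborel. \<eta> y * g x)"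
    unfolding moll_def using \<eta>1 by simp
  also have "\<dots> = (LINT y|lborel. \<eta> y *\<^sub>R (g (x + y) - g x))"
    using integrable_moll \<eta>i by (simp add: right_diff_distrib)
  also have "norm \<dots> \<le> L * \<delta>"
  proof (rule norm_kernel_integral_le)
    show "(\<lambda>y. g (x + y) - g x) \<in> borel_measurable borel" using g_measurable by simp
    fix y :: 'a assume "norm y < \<delta>"
    then have "L * norm y \<le> L * \<delta>" using L_nonneg by (intro mult_left_mono) auto
    then show "norm (g (x + y) - g x) \<le> L * \<delta>" using g_le[of x y] by simp
  qed
  finally show ?thesis by simp
qed

lemma moll_grad_le: "norm (moll_grad x) \<le> L"
  unfolding moll_grad_def using Dg_le Dg_measurable by (intro norm_kernel_integral_le) auto

lemma moll_grad_close:
  assumes "\<And>y. norm y < \<delta> \<Longrightarrow> norm (Dg (x + y) - Dg x) \<le> e"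
  shows "norm (moll_grad x - Dg x) \<le> e"
proof -
  have "moll_grad x - Dg x = (LINT y|lborel. \<eta> y *\<^sub>R Dg (x + y)) - (LINT y|lborel. \<eta> y *\<^sub>R Dg x)"
    unfolding moll_grad_def using \<eta>1 \<eta>i by simp
  also have "\<dots> = (LINT y|lborel. \<eta> y *\<^sub>R (Dg (x + y) - Dg x))"
    using integrable_moll_grad \<eta>i by (simp add: scaleR_diff_right)
  also have "norm \<dots> \<le> e"
    using assms Dg_measurable by (intro norm_kernel_integral_le) auto
  finally show ?thesis .
qed

lemma AE_W: "AE y in lborel. x + y \<in> W"
proof -
  have "negligible (UNIV - W)" using g by (simp add: ae_C1_def)
  then have "negligible ((+) (- x) ` (UNIV - W))" by (rule negligible_translation)
  moreover have "open W" using g by (simp add: ae_C1_def)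
  then have "(+) (- x) ` (UNIV - W) \<in> sets borel"
    by (intro borel_closed closed_translation) (simp add: closed_def Compl_eq_Diff_UNIV[symmetric] double_diff)
  ultimately have "(+) (- x) ` (UNIV - W) \<in> null_sets lborel"
    by (simp add: negligible_iff_null_sets null_sets_completion_iff)
  from AE_not_in[OF this] show ?thesis
  proof eventually_elim
    case (elim y)
    show ?case
    proof (rule ccontr)
      assume "x + y \<notin> W"
      then have "- x + (x + y) \<in> (+) (- x) ` (UNIV - W)" by (intro imageI) auto
      with elim show False by simp
    qed
  qed
qed

text \<open>Dominated convergence for the remainder of the first order expansion, which tends to zero at almost
  every point and is bounded by twice the Lipschitz constant.\<close>

lemma moll_GDERIV: "GDERIV moll x :> moll_grad x"
proof -
  define R where "R = (\<lambda>h y. (g (x + h + y) - g (x + y) - h \<bullet> Dg (x + y)) / norm h)"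
  have bl: "bounded_linear (\<lambda>h. h \<bullet> moll_grad x)" by (rule bounded_linear_inner_left)
  have Rm: "R h \<in> borel_measurable borel" for h
    unfolding R_def using g_measurable Dg_measurable by measurable
  have eq: "(moll (x + h) - moll x - h \<bullet> moll_grad x) / norm h = (LINT y|lborel. \<eta> y * R h y)" for h
  proof -
    have i: "integrable lborel (\<lambda>y. \<eta> y * (h \<bullet> Dg (x + y)))"
      using integrable_inner_right[OF integrable_moll_grad, of h x] by simp
    have 1: "h \<bullet> moll_grad x = (LINT y|lborel. \<eta> y * (h \<bullet> Dg (x + y)))"
      unfolding moll_grad_def using integral_inner_right[OF integrable_moll_grad, of h x] by simp
    have "(LINT y|lborel. \<eta> y * R h y) =
      (LINT y|lborel. (\<eta> y * g (x + h + y) - \<eta> y * g (x + y) - \<eta> y * (h \<bullet> Dg (x + y))) / norm h)"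
      by (intro Bochner_Integration.integral_cong) (auto simp: R_def right_diff_distrib)
    also have "\<dots> = (moll (x + h) - moll x - h \<bullet> moll_grad x) / norm h"
      unfolding 1 moll_def using integrable_moll i by simp
    finally show ?thesis ..
  qed
  have Rb: "\<bar>R h y\<bar> \<le> 2 * L" for h y
  proof (cases "h = 0")
    case True
    then show ?thesis using L_nonneg by (simp add: R_def)
  next
    case False
    have "\<bar>g (x + h + y) - g (x + y) - h \<bullet> Dg (x + y)\<bar> \<le> L * norm h + L * norm h"
    proof -
      have "\<bar>h \<bullet> Dg (x + y)\<bar> \<le> norm h * norm (Dg (x + y))" by (rule Cauchy_Schwarz_ineq2)
      also have "\<dots> \<le> norm h * L" using Dg_le by (intro mult_left_mono) auto
      finally have "\<bar>h \<bullet> Dg (x + y)\<bar> \<le> L * norm h" by (simp add: mult.commute)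
      moreover have "\<bar>g (x + h + y) - g (x + y)\<bar> \<le> L * norm h" using g_le[of "x + y" h] by (simp add: add_ac)
      ultimately show ?thesis by linarith
    qed
    then show ?thesis using False by (simp add: R_def abs_divide divide_le_eq)
  qed
  have "((\<lambda>h. LINT y|lborel. \<eta> y * R h y) \<longlongrightarrow> (LINT y|lborel. \<eta> y * 0)) (at 0)"
    unfolding tendsto_at_iff_sequentially comp_def
  proof (intro allI impI)
    fix X :: "nat \<Rightarrow> 'a" assume X: "\<forall>i. X i \<in> UNIV - {0}" "X \<longlonglongrightarrow> 0"
    have X0: "filterlim X (at 0) sequentially" using X by (auto simp: filterlim_at)
    show "(\<lambda>n. LINT y|lborel. \<eta> y * R (X n) y) \<longlonglongrightarrow> (LINT y|lborel. \<eta> y * 0)"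
    proof (rule integral_dominated_convergence[where w = "\<lambda>y. 2 * L * \<eta> y"])
      show "AE y in lborel. (\<lambda>n. \<eta> y * R (X n) y) \<longlonglongrightarrow> \<eta> y * 0"
        using AE_W[of x]
      proof eventually_elim
        case (elim y)
        then have "GDERIV g (x + y) :> Dg (x + y)" using g by (simp add: ae_C1_def)
        then have "((\<lambda>h. norm (g (x + y + h) - g (x + y) - h \<bullet> Dg (x + y)) / norm h) \<longlongrightarrow> 0) (at 0)"
          unfolding gderiv_def has_derivative_at by blast
        then have "((\<lambda>h. norm (R h y)) \<longlongrightarrow> 0) (at 0)"
          unfolding R_def by (simp add: abs_divide add_ac)
        then have "((\<lambda>h. R h y) \<longlongrightarrow> 0) (at 0)" by (rule tendsto_norm_zero_cancel)
        from filterlim_compose[OF this X0] show ?case by (intro tendsto_intros)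
      qed
      have "\<bar>\<eta> y * R (X n) y\<bar> \<le> 2 * L * \<eta> y" for n y
        using mult_left_mono[OF Rb[of "X n" y] \<eta>0[of y]] \<eta>0[of y] by (simp add: abs_mult mult_ac)
      then show "AE y in lborel. norm (\<eta> y * R (X n) y) \<le> 2 * L * \<eta> y" for n by (intro AE_I2) simp
    qed (use \<eta>i \<eta>_measurable Rm in auto)
  qed
  then have "((\<lambda>h. (moll (x + h) - moll x - h \<bullet> moll_grad x) / norm h) \<longlongrightarrow> 0) (at 0)"
    by (simp add: eq)
  then have "((\<lambda>h. norm (moll (x + h) - moll x - h \<bullet> moll_grad x) / norm h) \<longlongrightarrow> 0) (at 0)"
    by (drule_tac tendsto_norm_zero) (simp add: abs_divide)
  then show ?thesis unfolding gderiv_def has_derivative_at using bl by blast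
qed

text \<open>After the substitution \<open>z = x + y\<close> the variable \<open>x\<close> occurs only in the continuous kernel.\<close>

lemma moll_grad_continuous: "continuous_on UNIV moll_grad"
  unfolding continuous_on_sequentially comp_def
proof (intro ballI allI impI)
  fix X :: "nat \<Rightarrow> 'a" and x assume "(\<forall>n. X n \<in> UNIV) \<and> X \<longlonglongrightarrow> x"
  then have X: "X \<longlonglongrightarrow> x" by simp
  have eq: "moll_grad a = (LINT z|lborel. \<eta> (z - a) *\<^sub>R Dg z)" for a
  proof -
    have "(\<lambda>z. \<eta> (z - a) *\<^sub>R Dg z) \<in> borel_measurable borel" using \<eta>_measurable Dg_measurable by measurable
    from lborel_integral_shift[OF this, of a] show ?thesis by (simp add: moll_grad_def)
  qed
  obtain B where B: "\<And>y. y \<in> cball 0 \<delta> \<Longrightarrow> norm (\<eta> y) \<le> B"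
    using compact_bounded_fun[OF compact_cball continuous_on_subset[OF \<eta>c subset_UNIV]] by blast
  have B0: "0 \<le> B" using B[of 0] \<delta> norm_ge_zero by (meson centre_in_cball less_imp_le order_trans)
  obtain r where r: "\<And>n. norm (X n) \<le> r"
    using convergent_imp_bounded[OF X] by (auto simp: bounded_iff)
  show "(\<lambda>n. moll_grad (X n)) \<longlonglongrightarrow> moll_grad x"
    unfolding eq
  proof (rule integral_dominated_convergence[where w = "\<lambda>z. (B * L) * indicator (cball 0 (r + \<delta>)) z"])
    show "AE z in lborel. (\<lambda>n. \<eta> (z - X n) *\<^sub>R Dg z) \<longlonglongrightarrow> \<eta> (z - x) *\<^sub>R Dg z"
    proof (intro AE_I2 tendsto_scaleR tendsto_const)
      fix z
      have "isCont \<eta> (z - x)" using \<eta>c by (simp add: continuous_on_eq_continuous_at)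
      then show "(\<lambda>n. \<eta> (z - X n)) \<longlonglongrightarrow> \<eta> (z - x)"
        by (rule isCont_tendsto_compose) (intro tendsto_intros X)
    qed
    have "norm (\<eta> (z - X n) *\<^sub>R Dg z) \<le> B * L * indicator (cball 0 (r + \<delta>)) z" for n z
    proof (cases "norm (z - X n) < \<delta>")
      case True
      then have "norm z \<le> r + \<delta>" using r[of n] norm_triangle_ineq[of "z - X n" "X n"] by simp
      moreover have "norm (\<eta> (z - X n)) * norm (Dg z) \<le> B * L"
        using B[of "z - X n"] True Dg_le B0 by (intro mult_mono) auto
      ultimately show ?thesis by simp
    next
      case False
      then show ?thesis using \<eta>s B0 L_nonneg by simp
    qed
    then show "AE z in lborel. norm (\<eta> (z - X n) *\<^sub>R Dg z) \<le> B * L * indicator (cball 0 (r + \<delta>)) z" for n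
      by (intro AE_I2)
    show "integrable lborel (\<lambda>z::'a. B * L * indicator (cball 0 (r + \<delta>)) z)"
      using emeasure_lborel_cball_finite[of "0::'a" "r + \<delta>"]
      by (intro integrable_mult_right integrable_real_indicator) auto
    show "(\<lambda>z. \<eta> (z - x) *\<^sub>R Dg z) \<in> borel_measurable lborel" "(\<lambda>z. \<eta> (z - X n) *\<^sub>R Dg z) \<in> borel_measurable lborel" for n
      using \<eta>_measurable Dg_measurable by measurable
  qed
qed

lemma moll_C1: "C1_with_grad moll moll_grad"
  using moll_GDERIV moll_grad_continuous by (simp add: C1_with_grad_def)

end

section \<open>Integration by parts in space\<close>

lemma lipschitz_subset_cell:
  assumes "L-lipschitz_on (spat per) v"
  shows "continuous_on unit_cell v"
  using assms lipschitz_on_continuous_on[of L "spat per" v] continuous_on_subset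
  by (cases per) (auto simp: spat_def)

lemma spat_superset: "unit_cell \<subseteq> spat per" by (simp add: spat_def)

lemma ae_C1_spat_AE:
  assumes G: "ae_C1 (spat per :: (real^'d) set) G W DG"
  shows "AE x in lebesgue_on unit_cell. x \<in> W"
proof -
  have "negligible (spat per - W)" using G by (simp add: ae_C1_def)
  then have "negligible (unit_cell - W)" by (rule negligible_subset) (use spat_superset in blast)
  then have "AE z in lebesgue. z \<notin> unit_cell - W" unfolding negligible_iff_null_sets by (rule AE_not_in)
  then show ?thesis using unit_cell_props(2) by (subst AE_restrict_space_iff) (auto elim: eventually_mono)
qed

text \<open>The mollified functions inherit the periodicity of \<open>G\<close> and are therefore admissible tests; both sides
  converge by dominated convergence, as the Lipschitz constant bounds all mollified gradients.\<close>

lemma periodic_integration_by_parts: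
  fixes v :: "real^'d \<Rightarrow> real^'d"
  assumes v: "M-lipschitz_on UNIV v" and A: "has_weak_jac True v A"
    and G: "ae_C1 UNIV G W DG" and perG: "periodic G"
  shows "(LINT x|lebesgue_on unit_cell. v x $ i * DG x $ j) = - (LINT x|lebesgue_on unit_cell. A x $ i $ j * G x)"
proof -
  let ?M = "lebesgue_on (unit_cell :: (real^'d) set)"
  obtain L where L: "L-lipschitz_on UNIV G" using G unfolding ae_C1_def by blast
  have L0: "0 \<le> L" using lipschitz_on_nonneg[OF L] .
  define \<delta> where "\<delta> = (\<lambda>n::nat. 1 / (real n + 1))"
  have \<delta>: "0 < \<delta> n" "\<delta> n \<le> 1" for n by (auto simp: \<delta>_def)
  have \<delta>0: "\<delta> \<longlonglongrightarrow> 0"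
    using LIMSEQ_ignore_initial_segment[OF lim_inverse_n', of 1] by (simp add: \<delta>_def add_ac)
  have "\<exists>\<eta>. mollification G W DG L (\<delta> n) \<eta>" for n
    using mollifier_exists[OF \<delta>(1)[of n]] G L \<delta>(1)[of n] unfolding mollification_def by metis
  then obtain \<eta> where mo: "\<And>n. mollification G W DG L (\<delta> n) (\<eta> n)" by metis
  define m where "m = (\<lambda>n. mollification.moll G (\<eta> n))"
  define dm where "dm = (\<lambda>n. mollification.moll_grad DG (\<eta> n))"
  have C1: "C1_with_grad (m n) (dm n)" for n
    unfolding m_def dm_def by (rule mollification.moll_C1[OF mo])
  have "periodic (m n)" for n
    using perG unfolding periodic_def m_def mollification.moll_def[OF mo]
    by (simp add: add.assoc add.commute[of _ "_ :: real^'d"] add.left_commute)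
  then have test: "space_test True (m n) (dm n)" for n
    using C1 by (simp add: space_test_def)
  have ibp: "(LINT x|?M. v x $ i * dm n x $ j) = - (LINT x|?M. A x $ i $ j * m n x)" for n
    using A test unfolding has_weak_jac_def by blast
  have vc: "continuous_on unit_cell v" by (rule lipschitz_subset_cell[of M True]) (use v in \<open>simp add: spat_def\<close>)
  obtain Bv where Bv: "\<And>x. x \<in> unit_cell \<Longrightarrow> norm (v x) \<le> Bv"
    using compact_bounded_fun[OF unit_cell_props(3) vc] by blast
  obtain BG where BG: "\<And>x. x \<in> unit_cell \<Longrightarrow> norm (G x) \<le> BG"
    using compact_bounded_fun[OF unit_cell_props(3)] ae_C1_continuous[OF G] by (metis continuous_on_subset subset_UNIV)
  have vm: "(\<lambda>x. v x $ i) \<in> borel_measurable ?M"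
    by (intro borel_measurable_component continuous_lebesgue_on vc unit_cell_props)
  have Ai: "integrable ?M (\<lambda>x. A x $ i $ j)" by (rule weak_jac_component_integrable[OF A])
  have AW: "AE x in ?M. x \<in> W"
    by (rule ae_C1_spat_AE[where per = True]) (use G in \<open>simp add: spat_def\<close>)
  have gradlim: "(\<lambda>n. dm n x) \<longlonglongrightarrow> DG x" if x: "x \<in> W" for x
  proof (rule LIMSEQ_I)
    fix e :: real assume e: "0 < e"
    have "isCont DG x" using G x unfolding ae_C1_def by (meson continuous_on_eq_continuous_at)
    then obtain d where d: "0 < d" "\<And>y. dist y x < d \<Longrightarrow> dist (DG y) (DG x) < e / 2"
      using e unfolding continuous_at_eps_delta by (metis half_gt_zero)
    obtain N where N: "\<And>n. n \<ge> N \<Longrightarrow> \<delta> n < d"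
      using order_tendstoD(2)[OF \<delta>0 d(1)] by (auto simp: eventually_sequentially)
    have "norm (dm n x - DG x) < e" if n: "n \<ge> N" for n
    proof -
      have "norm (dm n x - DG x) \<le> e / 2"
        unfolding dm_def
      proof (rule mollification.moll_grad_close[OF mo])
        fix y :: "real^'d" assume "norm y < \<delta> n"
        then show "norm (DG (x + y) - DG x) \<le> e / 2"
          using d(2)[of "x + y"] N[OF n] by (simp add: dist_norm)
      qed
      then show ?thesis using e by simp
    qed
    then show "\<exists>N. \<forall>n\<ge>N. norm (dm n x - DG x) < e" by blast
  qed
  have close: "\<bar>m n x - G x\<bar> \<le> L * \<delta> n" for n x
    unfolding m_def by (rule mollification.moll_close[OF mo])
  have lim: "(\<lambda>n. m n x) \<longlonglongrightarrow> G x" for x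
  proof (rule LIM_zero_cancel, rule Lim_null_comparison)
    show "\<forall>\<^sub>F n in sequentially. norm (m n x - G x) \<le> L * \<delta> n" using close by simp
    show "(\<lambda>n. L * \<delta> n) \<longlonglongrightarrow> 0" using tendsto_mult[OF tendsto_const \<delta>0, of L] by simp
  qed
  have l1: "(\<lambda>n. LINT x|?M. v x $ i * dm n x $ j) \<longlonglongrightarrow> (LINT x|?M. v x $ i * DG x $ j)"
  proof (rule integral_dominated_convergence[where w = "\<lambda>x. \<bar>Bv\<bar> * L"])
    show "AE x in ?M. (\<lambda>n. v x $ i * dm n x $ j) \<longlonglongrightarrow> v x $ i * DG x $ j"
      using AW by eventually_elim (intro tendsto_intros gradlim)
    show "AE x in ?M. norm (v x $ i * dm n x $ j) \<le> \<bar>Bv\<bar> * L" for n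
    proof (rule AE_I2)
      fix x :: "real^'d" assume "x \<in> space ?M"
      then have "norm (v x) \<le> Bv" using Bv by (simp add: space_restrict_space)
      then have "\<bar>v x $ i\<bar> \<le> \<bar>Bv\<bar>" using component_le_norm_cart[of "v x" i] by linarith
      moreover have "norm (dm n x) \<le> L" unfolding dm_def by (rule mollification.moll_grad_le[OF mo])
      then have "\<bar>dm n x $ j\<bar> \<le> L" using component_le_norm_cart[of "dm n x" j] by linarith
      ultimately show "norm (v x $ i * dm n x $ j) \<le> \<bar>Bv\<bar> * L"
        unfolding real_norm_def abs_mult by (intro mult_mono) auto
    qed
    show "integrable ?M (\<lambda>x. \<bar>Bv\<bar> * L)"
      by (rule L2_integrable_cell) (rule L2_continuous_cell, simp)
    have "dm n \<in> borel_measurable borel" for n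
      using C1[of n] unfolding C1_with_grad_def by (intro borel_measurable_continuous_onI) blast
    then show "(\<lambda>x. v x $ i * dm n x $ j) \<in> borel_measurable ?M" for n
      by (intro borel_measurable_times vm borel_measurable_component borel_measurable_lebesgue_on)
    show "(\<lambda>x. v x $ i * DG x $ j) \<in> borel_measurable ?M"
      by (intro borel_measurable_times vm borel_measurable_component borel_measurable_lebesgue_on ae_C1_measurable_grad[OF G])
  qed
  have l2: "(\<lambda>n. LINT x|?M. A x $ i $ j * m n x) \<longlonglongrightarrow> (LINT x|?M. A x $ i $ j * G x)"
  proof (rule integral_dominated_convergence[where w = "\<lambda>x. \<bar>A x $ i $ j\<bar> * (\<bar>BG\<bar> + L)"])
    show "AE x in ?M. (\<lambda>n. A x $ i $ j * m n x) \<longlonglongrightarrow> A x $ i $ j * G x"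
      by (intro AE_I2 tendsto_intros lim)
    show "AE x in ?M. norm (A x $ i $ j * m n x) \<le> \<bar>A x $ i $ j\<bar> * (\<bar>BG\<bar> + L)" for n
    proof (rule AE_I2)
      fix x :: "real^'d" assume "x \<in> space ?M"
      then have "\<bar>G x\<bar> \<le> BG" using BG by (simp add: space_restrict_space)
      moreover have "L * \<delta> n \<le> L * 1" using \<delta> L0 by (intro mult_left_mono) auto
      ultimately have "\<bar>m n x\<bar> \<le> \<bar>BG\<bar> + L" using close[of n x] by linarith
      then show "norm (A x $ i $ j * m n x) \<le> \<bar>A x $ i $ j\<bar> * (\<bar>BG\<bar> + L)"
        by (simp add: abs_mult mult_left_mono)
    qed
    show "integrable ?M (\<lambda>x. \<bar>A x $ i $ j\<bar> * (\<bar>BG\<bar> + L))" using Ai by simp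
    show "(\<lambda>x. A x $ i $ j * m n x) \<in> borel_measurable ?M" for n
      by (intro borel_measurable_times borel_measurable_integrable[OF Ai] borel_measurable_lebesgue_on C1_measurable[OF C1])
    show "(\<lambda>x. A x $ i $ j * G x) \<in> borel_measurable ?M"
      by (intro borel_measurable_times borel_measurable_integrable[OF Ai] borel_measurable_lebesgue_on
         borel_measurable_continuous_onI ae_C1_continuous[OF G])
  qed
  show ?thesis using l1 tendsto_minus[OF l2] unfolding ibp by (rule LIMSEQ_unique)
qed

lemma velocity_has_weak_jac:
  assumes "velocity_space per V normV" "v \<in> V"
  shows "has_weak_jac per v (weak_jac per v)"
proof -
  have "\<exists>A. has_weak_jac per v A" using assms unfolding velocity_space_def W1inf_def by blast
  then show ?thesis unfolding weak_jac_def by (rule someI_ex)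
qed

lemma velocity_continuous:
  assumes "velocity_space per V normV" "v \<in> V"
  shows "continuous_on unit_cell v"
  using assms lipschitz_subset_cell unfolding velocity_space_def by blast

lemma space_integration_by_parts:
  fixes v :: "real^'d \<Rightarrow> real^'d"
  assumes V: "velocity_space per V normV" "v \<in> V"
    and H: "\<not> per \<Longrightarrow> \<forall>i. (\<lambda>x. v x $ i) \<in> H10"
    and G: "ae_C1 (spat per) G W DG" and perG: "per \<Longrightarrow> periodic G"
  shows "integrable (lebesgue_on unit_cell) (\<lambda>x. v x \<bullet> DG x)"
    and "integrable (lebesgue_on unit_cell) (\<lambda>x. weak_div per v x * G x)"
    and "(LINT x|lebesgue_on unit_cell. v x \<bullet> DG x) = - (LINT x|lebesgue_on unit_cell. weak_div per v x * G x)"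
proof -
  let ?M = "lebesgue_on (unit_cell :: (real^'d) set)"
  let ?A = "weak_jac per v"
  note A = velocity_has_weak_jac[OF V]
  have vc: "continuous_on unit_cell v" by (rule velocity_continuous[OF V])
  have Gc: "continuous_on unit_cell G" using ae_C1_continuous[OF G] spat_superset continuous_on_subset by blast
  have ibp: "(LINT x|?M. v x $ i * DG x $ i) = - (LINT x|?M. ?A x $ i $ i * G x)" for i
  proof (cases per)
    case True
    have S: "spat per = (UNIV :: (real^'d) set)" using True by (simp add: spat_def)
    obtain L where "L-lipschitz_on UNIV v" using V unfolding velocity_space_def S by blast
    then show ?thesis using periodic_integration_by_parts[of L v ?A G W DG i i] A G perG True unfolding S by simp
  next
    case False
    then show ?thesis using H10_weak_jac_integration_by_parts[of v i ?A G W DG i] H A G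
      by (simp add: spat_def)
  qed
  obtain Bv where Bv: "\<And>x. x \<in> unit_cell \<Longrightarrow> norm (v x) \<le> Bv"
    using compact_bounded_fun[OF unit_cell_props(3) vc] by blast
  obtain BG where BG: "\<And>x. x \<in> unit_cell \<Longrightarrow> norm (G x) \<le> BG"
    using compact_bounded_fun[OF unit_cell_props(3) Gc] by blast
  obtain L where L: "\<And>x. norm (DG x) \<le> L" using ae_C1_bounded[OF G] by blast
  have i1: "integrable ?M (\<lambda>x. v x $ i * DG x $ i)" for i
  proof (rule integrable_bounded_lebesgue_on[OF unit_cell_props(1)])
    show "(\<lambda>x. v x $ i * DG x $ i) \<in> borel_measurable ?M"
      by (intro borel_measurable_times borel_measurable_component continuous_lebesgue_on vc unit_cell_props
          borel_measurable_lebesgue_on ae_C1_measurable_grad[OF G])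
    fix x :: "real^'d" assume "x \<in> unit_cell"
    then have "\<bar>v x $ i\<bar> \<le> \<bar>Bv\<bar>" using component_le_norm_cart[of "v x" i] Bv[of x] by linarith
    moreover have "\<bar>DG x $ i\<bar> \<le> L" using component_le_norm_cart[of "DG x" i] L[of x] by linarith
    ultimately show "\<bar>v x $ i * DG x $ i\<bar> \<le> \<bar>Bv\<bar> * L" unfolding abs_mult by (intro mult_mono) auto
  qed
  have i2: "integrable ?M (\<lambda>x. ?A x $ i $ i * G x)" for i
    using BG by (intro integrable_mult_bounded[where B = BG] weak_jac_component_integrable[OF A]
       continuous_lebesgue_on Gc unit_cell_props) (auto simp: space_restrict_space)
  have e1: "(\<lambda>x. v x \<bullet> DG x) = (\<lambda>x. \<Sum>i\<in>UNIV. v x $ i * DG x $ i)" by (simp add: inner_vec_def)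
  have e2: "(\<lambda>x. weak_div per v x * G x) = (\<lambda>x. \<Sum>i\<in>UNIV. ?A x $ i $ i * G x)"
    by (simp add: weak_div_def trace_def sum_distrib_right)
  show "integrable ?M (\<lambda>x. v x \<bullet> DG x)" unfolding e1 using i1 by simp
  show "integrable ?M (\<lambda>x. weak_div per v x * G x)" unfolding e2 using i2 by simp
  show "(LINT x|?M. v x \<bullet> DG x) = - (LINT x|?M. weak_div per v x * G x)"
    unfolding e1 e2 using i1 i2 ibp by (simp add: sum_negf)
qed

lemma unit_cell_not_negligible: "\<not> negligible (unit_cell :: (real^'d) set)"
  unfolding unit_cell_def negligible_interval interval_eq_empty_cart by simp

text \<open>An exceptional point in the open cell would give a nonempty open, hence non-null, exceptional set.\<close>

lemma AE_bound_imp_bound_cell: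
  fixes v :: "real^'d \<Rightarrow> 'b::real_normed_vector"
  assumes vc: "continuous_on unit_cell v" and ae: "AE x in lebesgue_on unit_cell. norm (v x) \<le> K"
    and x: "x \<in> unit_cell"
  shows "norm (v x) \<le> K"
proof -
  have box: "norm (v y) \<le> K" if y: "y \<in> box 0 1" for y
  proof (rule ccontr)
    assume n: "\<not> norm (v y) \<le> K"
    let ?U = "box 0 1 \<inter> (\<lambda>x. norm (v x)) -` {K <..}"
    have "continuous_on (box 0 1) (\<lambda>x. norm (v x))"
      using vc box_subset_cbox[of 0 "1::real^'d"] unfolding unit_cell_def
      by (intro continuous_on_norm) (rule continuous_on_subset)
    then have "open ?U" by (rule continuous_open_preimage) auto
    moreover have "y \<in> ?U" using y n by simp
    ultimately have nn: "\<not> negligible ?U" using open_not_negligible by blast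
    have "AE x in lebesgue. x \<in> unit_cell \<longrightarrow> norm (v x) \<le> K"
      using ae by (subst (asm) AE_restrict_space_iff) (auto simp: unit_cell_props)
    then have "AE x in lebesgue. x \<notin> ?U"
      by eventually_elim (use box_subset_cbox[of 0 "1::real^'d"] in \<open>auto simp: unit_cell_def\<close>)
    then have "?U \<in> null_sets lebesgue" using \<open>open ?U\<close> by (subst AE_iff_null_sets) auto
    then show False using nn by (simp add: negligible_iff_null_sets)
  qed
  have "box 0 (1::real^'d) \<noteq> {}" unfolding interval_eq_empty_cart by simp
  then have cl: "closure (box 0 (1::real^'d)) = unit_cell" by (simp add: closure_box unit_cell_def)
  show ?thesis
    using continuous_on_closure_norm_le[of "box 0 1" v K] vc box x unfolding cl by blast
qed

text \<open>Both essential suprema in the \<open>W\<^bsup>1,\<infinity>\<^esup>\<close> norm are nonnegative because the cell is not a null set, so each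
  is bounded by the sum.  Homogeneity and the triangle inequality give \<open>normV v \<ge> 0\<close>.\<close>

lemma velocity_bounds:
  fixes V :: "(real^'d \<Rightarrow> real^'d) set"
  assumes V: "velocity_space per V normV"
  shows "\<exists>C\<ge>0. \<forall>v\<in>V. 0 \<le> normV v \<and> (\<forall>x\<in>unit_cell. norm (v x) \<le> C * normV v) \<and>
    (AE x in lebesgue_on unit_cell. \<bar>weak_div per v x\<bar> \<le> C * normV v)"
proof -
  let ?M = "lebesgue_on (unit_cell :: (real^'d) set)"
  obtain C where C: "\<And>v. v \<in> V \<Longrightarrow> W1inf_norm per v \<le> ereal (C * normV v)"
    using V unfolding velocity_space_def by blast
  have nonneg: "0 \<le> normV v" if v: "v \<in> V" for v
  proof -
    have s: "(\<lambda>x. c *\<^sub>R v x) \<in> V \<and> normV (\<lambda>x. c *\<^sub>R v x) = \<bar>c\<bar> * normV v" for c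
      using V v unfolding velocity_space_def by blast
    have tri: "normV (\<lambda>x. v x + w x) \<le> normV v + normV w" if "w \<in> V" for w
      using V v that unfolding velocity_space_def by blast
    have "normV (\<lambda>x. v x + (-1) *\<^sub>R v x) \<le> normV v + normV (\<lambda>x. (-1) *\<^sub>R v x)"
      by (rule tri[OF conjunct1[OF s]])
    moreover have "(\<lambda>x. v x + (-1) *\<^sub>R v x) = (\<lambda>x. 0 *\<^sub>R v x)" by simp
    ultimately show ?thesis using s[of 0] s[of "-1"] by simp
  qed
  have ess0: "0 \<le> esssup ?M (\<lambda>x. ereal (norm (f x)))" for f :: "real^'d \<Rightarrow> 'z::real_normed_vector"
  proof (rule ccontr)
    assume "\<not> 0 \<le> esssup ?M (\<lambda>x. ereal (norm (f x)))"
    then have neg: "esssup ?M (\<lambda>x. ereal (norm (f x))) < 0" by simp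
    have "AE x in ?M. ereal (norm (f x)) \<le> esssup ?M (\<lambda>x. ereal (norm (f x)))" by (rule esssup_AE)
    then have "AE x in ?M. False"
    proof eventually_elim
      case (elim x)
      with neg have "ereal (norm (f x)) < 0" by (rule le_less_trans[rotated])
      then show ?case by simp
    qed
    then have "AE x in lebesgue. x \<notin> (unit_cell :: (real^'d) set)"
      by (subst (asm) AE_restrict_space_iff) (auto simp: unit_cell_props)
    then have "(unit_cell :: (real^'d) set) \<in> null_sets lebesgue"
      using unit_cell_props(2) by (subst AE_iff_null_sets)
    then show False using unit_cell_not_negligible[where 'd = 'd] by (simp add: negligible_iff_null_sets)
  qed
  define K where "K = max 0 C * (1 + real CARD('d))"
  have K0: "0 \<le> K" by (simp add: K_def)
  have "0 \<le> normV v \<and> (\<forall>x\<in>unit_cell. norm (v x) \<le> K * normV v) \<and>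
    (AE x in ?M. \<bar>weak_div per v x\<bar> \<le> K * normV v)" if v: "v \<in> V" for v
  proof -
    let ?s1 = "esssup ?M (\<lambda>x. ereal (norm (v x)))" and ?s2 = "esssup ?M (\<lambda>x. ereal (norm (weak_jac per v x)))"
    have C': "?s1 + ?s2 \<le> ereal (max 0 C * normV v)"
    proof -
      have "C * normV v \<le> max 0 C * normV v" using nonneg[OF v] by (intro mult_right_mono) auto
      then show ?thesis using C[OF v] unfolding W1inf_norm_def by (meson ereal_less_eq(3) order_trans)
    qed
    have s1: "?s1 \<le> ereal (max 0 C * normV v)"
      using C' ess0[of "weak_jac per v"] by (meson ereal_le_add_self order_trans)
    have s2: "?s2 \<le> ereal (max 0 C * normV v)"
      using C' ess0[of v] by (meson ereal_le_add_self2 order_trans)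
    have KC: "max 0 C * normV v \<le> K * normV v"
      unfolding K_def using nonneg[OF v] by (intro mult_right_mono) (auto simp: distrib_left)
    have ae1: "AE x in ?M. norm (v x) \<le> K * normV v"
      using esssup_AE[of "\<lambda>x. ereal (norm (v x))" ?M]
    proof eventually_elim
      case (elim x)
      then have "ereal (norm (v x)) \<le> ereal (max 0 C * normV v)" using s1 by (rule order_trans)
      then show ?case using KC by simp
    qed
    have vc: "continuous_on unit_cell v" by (rule velocity_continuous[OF V v])
    have all: "\<forall>x\<in>unit_cell. norm (v x) \<le> K * normV v"
      using AE_bound_imp_bound_cell[OF vc ae1] by blast
    have ae2: "AE x in ?M. \<bar>weak_div per v x\<bar> \<le> K * normV v"
      using esssup_AE[of "\<lambda>x. ereal (norm (weak_jac per v x))" ?M]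
    proof eventually_elim
      case (elim x)
      then have "ereal (norm (weak_jac per v x)) \<le> ereal (max 0 C * normV v)" using s2 by (rule order_trans)
      then have n: "norm (weak_jac per v x) \<le> max 0 C * normV v" by simp
      have "\<bar>weak_div per v x\<bar> \<le> (\<Sum>i\<in>UNIV. \<bar>weak_jac per v x $ i $ i\<bar>)"
        unfolding weak_div_def trace_def by (rule sum_abs)
      also have "\<dots> \<le> (\<Sum>i\<in>(UNIV::'d set). max 0 C * normV v)"
      proof (rule sum_mono)
        fix i
        show "\<bar>weak_jac per v x $ i $ i\<bar> \<le> max 0 C * normV v"
          using component_le_norm_cart[of "weak_jac per v x $ i" i] Finite_Cartesian_Product.norm_nth_le[of "weak_jac per v x" i] n
          by linarith
      qed
      also have "\<dots> = real CARD('d) * (max 0 C * normV v)" by simp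
      also have "\<dots> \<le> K * normV v"
        unfolding K_def using nonneg[OF v] by (simp add: algebra_simps)
      finally show ?case .
    qed
    show ?thesis using nonneg[OF v] all ae2 by blast
  qed
  then show ?thesis using K0 by blast
qed

section \<open>Slicing space-time\<close>

text \<open>The integral of a difference quotient is a difference of two averages over short intervals, one
  at each end.\<close>

lemma ae_C1_fundamental_theorem:
  fixes f :: "real \<Rightarrow> real"
  assumes f: "ae_C1 {0..1} f U f'" and s: "0 \<le> s" "s \<le> 1"
  shows "(LINT t|lebesgue_on {0..s}. f' t) = f s - f 0"
proof -
  let ?M = "lebesgue_on {0..s}"
  obtain L where L: "L-lipschitz_on {0..1} f" using f unfolding ae_C1_def by blast
  have L0: "0 \<le> L" using lipschitz_on_nonneg[OF L] .
  \<comment> \<open>Extending \<open>f\<close> by its end values keeps it Lipschitz and allows forward differences up to \<open>s = 1\<close>.\<close>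
  define c where "c = (\<lambda>t::real. max 0 (min 1 t))"
  define F where "F = (\<lambda>t. f (c t))"
  have c01: "c t \<in> {0..1}" for t by (auto simp: c_def)
  have F_lip: "\<bar>F a - F b\<bar> \<le> L * \<bar>a - b\<bar>" for a b
  proof -
    have "\<bar>F a - F b\<bar> \<le> L * \<bar>c a - c b\<bar>"
      using lipschitz_onD[OF L c01 c01, of a b] by (simp add: F_def dist_real_def)
    also have "\<dots> \<le> L * \<bar>a - b\<bar>" using L0 by (intro mult_left_mono) (auto simp: c_def)
    finally show ?thesis .
  qed
  have Fc: "continuous_on UNIV F"
    using L0 F_lip by (intro lipschitz_on_continuous_on[of L] lipschitz_onI) (auto simp: dist_real_def)
  have Fint: "F integrable_on {a..b}" for a b
    by (rule integrable_continuous_real) (rule continuous_on_subset[OF Fc], simp)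
  define h where "h = (\<lambda>n::nat. 1 / (real n + 1))"
  have h: "0 < h n" for n by (simp add: h_def)
  have h0: "h \<longlonglongrightarrow> 0"
    using LIMSEQ_ignore_initial_segment[OF lim_inverse_n', of 1] by (simp add: h_def add_ac)
  have hat: "filterlim h (at 0) sequentially"
    unfolding filterlim_at using h0 h by (auto simp: less_imp_neq[symmetric])
  have lim1: "(\<lambda>n. LINT t|?M. (F (t + h n) - F t) / h n) \<longlonglongrightarrow> (LINT t|?M. f' t)"
  proof (rule integral_dominated_convergence[where w = "\<lambda>t. L"])
    have "AE t in lebesgue. t \<notin> {0..1} - U"
      using f unfolding ae_C1_def negligible_iff_null_sets by (intro AE_not_in) blast
    then have "AE t in lebesgue. t \<in> {0..s} \<longrightarrow> t \<in> U" by eventually_elim (use s in auto)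
    then have "AE t in ?M. t \<in> U" by (subst AE_restrict_space_iff) auto
    then show "AE t in ?M. (\<lambda>n. (F (t + h n) - F t) / h n) \<longlonglongrightarrow> f' t"
    proof eventually_elim
      case (elim t)
      have U: "open U" "U \<subseteq> {0..1}" using f by (auto simp: ae_C1_def)
      have "(f has_real_derivative f' t) (at t)" using f elim by (auto simp: ae_C1_def)
      moreover have "\<forall>\<^sub>F x in nhds t. f x = F x"
        using eventually_nhds_in_open[OF U(1) elim] by eventually_elim (use U(2) in \<open>auto simp: F_def c_def\<close>)
      ultimately have "(F has_real_derivative f' t) (at t)"
        using DERIV_cong_ev[of t t f F "f' t" "f' t"] by simp
      then have "((\<lambda>h. (F (t + h) - F t) / h) \<longlongrightarrow> f' t) (at 0)" by (simp add: DERIV_def)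
      from filterlim_compose[OF this hat] show ?case .
    qed
    show "AE t in ?M. norm ((F (t + h n) - F t) / h n) \<le> L" for n
    proof (rule AE_I2)
      fix t show "norm ((F (t + h n) - F t) / h n) \<le> L"
        using F_lip[of "t + h n" t] h[of n] by (simp add: abs_divide divide_le_eq)
    qed
    show "f' \<in> borel_measurable ?M" by (rule borel_measurable_lebesgue_on[OF ae_C1_measurable_grad[OF f]])
    show "(\<lambda>t. (F (t + h n) - F t) / h n) \<in> borel_measurable ?M" for n
      by (intro borel_measurable_lebesgue_on borel_measurable_continuous_onI continuous_intros
          continuous_on_compose2[OF Fc]) (use h[of n] in auto)
    show "integrable ?M (\<lambda>t. L)"
      by (simp add: finite_measure.integrable_const finite_measure_lebesgue_on)
  qed
  have eqn: "(LINT t|?M. (F (t + h n) - F t) / h n) = integral {s..s + h n} F / h n - integral {0..0 + h n} F / h n" for n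
  proof -
    have co: "continuous_on {0..s} (\<lambda>t. F (t + h n))"
      by (intro continuous_on_compose2[OF Fc] continuous_intros) auto
    have i1: "integrable ?M (\<lambda>t. F (t + h n))" "integrable ?M F"
      using integrable_continuous_real[OF co] co Fc by (auto intro!: continuous_imp_integrable_real continuous_on_subset[OF Fc])
    have "(LINT t|?M. (F (t + h n) - F t) / h n) = ((LINT t|?M. F (t + h n)) - (LINT t|?M. F t)) / h n"
      using i1 by simp
    also have "(LINT t|?M. F (t + h n)) = integral {0..s} (\<lambda>t. F (t + h n))"
      using i1 by (intro lebesgue_integral_eq_integral) auto
    also have "(LINT t|?M. F t) = integral {0..s} F"
      using i1 by (intro lebesgue_integral_eq_integral) auto
    also have "integral {0..s} (\<lambda>t. F (t + h n)) = integral {h n..s + h n} F"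
      using integral_shift_real_ivl[of "h n" "h n" "s + h n" F] by (simp add: add.commute)
    also have "integral {h n..s + h n} F - integral {0..s} F = integral {s..s + h n} F - integral {0..0 + h n} F"
    proof -
      have "integral {0..h n} F + integral {h n..s + h n} F = integral {0..s + h n} F"
        using s h[of n] by (intro Henstock_Kurzweil_Integration.integral_combine Fint) auto
      moreover have "integral {0..s} F + integral {s..s + h n} F = integral {0..s + h n} F"
        using s h[of n] by (intro Henstock_Kurzweil_Integration.integral_combine Fint) auto
      ultimately show ?thesis by simp
    qed
    finally show ?thesis by (simp add: diff_divide_distrib)
  qed
  have avg: "(\<lambda>n. integral {a..a + h n} F / h n) \<longlonglongrightarrow> F a" for a
  proof (rule LIM_zero_cancel, rule Lim_null_comparison)
    show "(\<lambda>n. L * h n) \<longlonglongrightarrow> 0" using tendsto_mult[OF tendsto_const h0, of L] by simp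
    show "\<forall>\<^sub>F n in sequentially. norm (integral {a..a + h n} F / h n - F a) \<le> L * h n"
    proof (intro always_eventually allI)
      fix n
      have "integral {a..a + h n} F - h n * F a = integral {a..a + h n} (\<lambda>t. F t - F a)"
        using h[of n] by (subst Henstock_Kurzweil_Integration.integral_diff) (auto intro!: Fint)
      also have "norm \<dots> \<le> (L * h n) * (a + h n - a)"
      proof (rule integral_bound)
        show "continuous_on {a..a + h n} (\<lambda>t. F t - F a)" by (intro continuous_intros continuous_on_subset[OF Fc]) auto
        fix t assume t: "t \<in> {a..a + h n}"
        have "norm (F t - F a) \<le> L * \<bar>t - a\<bar>" using F_lip by simp
        also have "\<dots> \<le> L * h n" using t L0 by (intro mult_left_mono) auto
        finally show "norm (F t - F a) \<le> L * h n" .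
      qed (use h[of n] in simp)
      finally have "\<bar>integral {a..a + h n} F - h n * F a\<bar> / h n \<le> L * h n"
        using h[of n] by (simp add: divide_le_eq)
      moreover have "integral {a..a + h n} F / h n - F a = (integral {a..a + h n} F - h n * F a) / h n"
        using h[of n] by (simp add: field_simps)
      ultimately show "norm (integral {a..a + h n} F / h n - F a) \<le> L * h n"
        using h[of n] by (simp add: abs_divide)
    qed
  qed
  have "(\<lambda>n. LINT t|?M. (F (t + h n) - F t) / h n) \<longlonglongrightarrow> F s - F 0"
    unfolding eqn by (intro tendsto_diff avg)
  from LIMSEQ_unique[OF lim1 this] show ?thesis using s by (simp add: F_def c_def)
qed

lemma closed_spacetime: "closed (spacetime per :: ((real^'d) \<times> real) set)"
  unfolding spacetime_def spat_def unit_cell_def by (auto intro!: closed_Times)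

text \<open>The exceptional set \<open>S - W\<close> is a Borel null set, so almost all of its slices are null sets.\<close>

lemma ae_C1_space_slice:
  fixes F :: "(real^'d) \<times> real \<Rightarrow> real"
  assumes F: "ae_C1 (spacetime per) F W DF"
  shows "AE t in lebesgue_on {0..1}. ae_C1 (spat per) (\<lambda>x. F (x, t)) {x. (x, t) \<in> W} (\<lambda>x. fst (DF (x, t)))"
proof -
  let ?S = "spacetime per :: ((real^'d) \<times> real) set"
  have W: "open W" "W \<subseteq> ?S" using F by (auto simp: ae_C1_def)
  have "?S - W \<in> null_sets lborel"
  proof -
    have "?S - W \<in> sets borel" using closed_spacetime[of per] W(1) by (intro sets.Diff borel_closed borel_open)
    moreover have "negligible (?S - W)" using F by (simp add: ae_C1_def)
    ultimately show ?thesis by (simp add: negligible_iff_null_sets null_sets_completion_iff)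
  qed
  then have "AE z in lborel. z \<notin> ?S - W" by (rule AE_not_in)
  from AE_lborel_slices(2)[OF this] have "AE t in lborel. AE x in lborel. (x, t) \<notin> ?S - W" .
  then have "AE t in lebesgue. AE x in lborel. (x, t) \<notin> ?S - W" by (rule AE_completion)
  then have "AE t in lebesgue_on {0..1}. t \<in> {0..1} \<and> (AE x in lborel. (x, t) \<notin> ?S - W)"
    by (subst AE_restrict_space_iff) (auto elim: eventually_mono)
  then show ?thesis
  proof eventually_elim
    case (elim t)
    then have t: "t \<in> {0..1}" and ae: "AE x in lborel. (x, t) \<notin> ?S - W" by auto
    let ?Wt = "{x. (x, t) \<in> W}"
    have pc: "continuous_on UNIV (\<lambda>x::real^'d. (x, t))" by (intro continuous_intros)
    obtain L where L: "L-lipschitz_on ?S F" using F unfolding ae_C1_def by blast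
    have "L-lipschitz_on (spat per) (\<lambda>x. F (x, t))"
    proof (rule lipschitz_onI[OF _ lipschitz_on_nonneg[OF L]])
      fix x y :: "real^'d" assume "x \<in> spat per" "y \<in> spat per"
      then show "dist (F (x, t)) (F (y, t)) \<le> L * dist x y"
        using lipschitz_onD[OF L, of "(x, t)" "(y, t)"] t by (simp add: spacetime_def dist_Pair_Pair)
    qed
    moreover have op: "open ?Wt"
      using open_vimage[OF W(1) pc] by (simp add: vimage_def)
    moreover have "?Wt \<subseteq> spat per" using W(2) by (auto simp: spacetime_def)
    moreover have "negligible (spat per - ?Wt)"
    proof -
      have "closed (spat per :: (real^'d) set)" by (auto simp: spat_def unit_cell_def)
      then have b: "spat per - ?Wt \<in> sets borel" using op by auto
      have "AE x in lborel. x \<notin> spat per - ?Wt"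
        using ae by eventually_elim (use t in \<open>auto simp: spacetime_def\<close>)
      then have "spat per - ?Wt \<in> null_sets lborel" using b by (subst AE_iff_null_sets) auto
      then show ?thesis using b by (simp add: negligible_iff_null_sets null_sets_completion_iff)
    qed
    moreover have "GDERIV (\<lambda>x. F (x, t)) x :> fst (DF (x, t))" if "(x, t) \<in> W" for x
    proof -
      have "(F has_derivative (\<lambda>h. h \<bullet> DF (x, t))) (at (x, t))" using F that unfolding ae_C1_def gderiv_def by blast
      then have "((\<lambda>x. F (x, t)) has_derivative (\<lambda>h. (h, 0) \<bullet> DF (x, t))) (at x)"
        by (intro has_derivative_compose[of "\<lambda>x. (x, t)" "\<lambda>h. (h, 0)" x UNIV F]) (auto intro!: derivative_eq_intros)
      then show ?thesis by (simp add: gderiv_def inner_prod_def)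
    qed
    moreover have "continuous_on ?Wt (\<lambda>x. fst (DF (x, t)))"
    proof -
      have "continuous_on W DF" using F by (simp add: ae_C1_def)
      moreover have "continuous_on ?Wt (\<lambda>x. (x, t))" by (intro continuous_intros)
      ultimately have "continuous_on ?Wt (\<lambda>x. DF (x, t))" by (rule continuous_on_compose2) auto
      then show ?thesis by (rule continuous_on_fst)
    qed
    moreover have "fst (DF (x, t)) = 0" if "(x, t) \<notin> W" for x using F that by (simp add: ae_C1_def)
    ultimately show ?case unfolding ae_C1_def by blast
  qed
qed

lemma ae_C1_time_slice:
  fixes F :: "(real^'d) \<times> real \<Rightarrow> real"
  assumes F: "ae_C1 (spacetime per) F W DF"
  shows "AE x in lebesgue_on unit_cell. ae_C1 {0..1} (\<lambda>t. F (x, t)) {t. (x, t) \<in> W} (\<lambda>t. snd (DF (x, t)))"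
proof -
  let ?S = "spacetime per :: ((real^'d) \<times> real) set"
  have W: "open W" "W \<subseteq> ?S" using F by (auto simp: ae_C1_def)
  have "?S - W \<in> null_sets lborel"
  proof -
    have "?S - W \<in> sets borel" using closed_spacetime[of per] W(1) by (intro sets.Diff borel_closed borel_open)
    moreover have "negligible (?S - W)" using F by (simp add: ae_C1_def)
    ultimately show ?thesis by (simp add: negligible_iff_null_sets null_sets_completion_iff)
  qed
  then have "AE z in lborel. z \<notin> ?S - W" by (rule AE_not_in)
  from AE_lborel_slices(1)[OF this] have "AE x in lborel. AE t in lborel. (x, t) \<notin> ?S - W" .
  then have "AE x in lebesgue. AE t in lborel. (x, t) \<notin> ?S - W" by (rule AE_completion)
  then have "AE x in lebesgue_on unit_cell. x \<in> unit_cell \<and> (AE t in lborel. (x, t) \<notin> ?S - W)"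
    by (subst AE_restrict_space_iff) (auto simp: unit_cell_props elim: eventually_mono)
  then show ?thesis
  proof eventually_elim
    case (elim x)
    then have x: "x \<in> spat per" and ae: "AE t in lborel. (x, t) \<notin> ?S - W" using spat_superset by auto
    let ?Wx = "{t. (x, t) \<in> W}"
    have pc: "continuous_on UNIV (\<lambda>t::real. (x, t))" by (intro continuous_intros)
    obtain L where L: "L-lipschitz_on ?S F" using F unfolding ae_C1_def by blast
    have "L-lipschitz_on {0..1} (\<lambda>t. F (x, t))"
    proof (rule lipschitz_onI[OF _ lipschitz_on_nonneg[OF L]])
      fix s t :: real assume "s \<in> {0..1}" "t \<in> {0..1}"
      then show "dist (F (x, s)) (F (x, t)) \<le> L * dist s t"
        using lipschitz_onD[OF L, of "(x, s)" "(x, t)"] x by (simp add: spacetime_def dist_Pair_Pair)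
    qed
    moreover have op: "open ?Wx"
      using open_vimage[OF W(1) pc] by (simp add: vimage_def)
    moreover have "?Wx \<subseteq> {0..1}" using W(2) by (auto simp: spacetime_def)
    moreover have "negligible ({0..1} - ?Wx)"
    proof -
      have b: "{0..1} - ?Wx \<in> sets borel" using op by auto
      have "AE t in lborel. t \<notin> {0..1} - ?Wx"
        using ae by eventually_elim (use x in \<open>auto simp: spacetime_def\<close>)
      then have "{0..1} - ?Wx \<in> null_sets lborel" using b by (subst AE_iff_null_sets) auto
      then show ?thesis using b by (simp add: negligible_iff_null_sets null_sets_completion_iff)
    qed
    moreover have "GDERIV (\<lambda>t. F (x, t)) t :> snd (DF (x, t))" if "(x, t) \<in> W" for t
    proof -
      have "(F has_derivative (\<lambda>h. h \<bullet> DF (x, t))) (at (x, t))" using F that unfolding ae_C1_def gderiv_def by blast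
      then have "((\<lambda>t. F (x, t)) has_derivative (\<lambda>h. (0, h) \<bullet> DF (x, t))) (at t)"
        by (intro has_derivative_compose[of "\<lambda>t. (x, t)" "\<lambda>h. (0, h)" t UNIV F]) (auto intro!: derivative_eq_intros)
      then show ?thesis unfolding gderiv_def by (simp add: inner_prod_def)
    qed
    moreover have "continuous_on ?Wx (\<lambda>t. snd (DF (x, t)))"
    proof -
      have "continuous_on W DF" using F by (simp add: ae_C1_def)
      moreover have "continuous_on ?Wx (\<lambda>t. (x, t))" by (intro continuous_intros)
      ultimately have "continuous_on ?Wx (\<lambda>t. DF (x, t))" by (rule continuous_on_compose2) auto
      then show ?thesis by (rule continuous_on_snd)
    qed
    moreover have "snd (DF (x, t)) = 0" if "(x, t) \<notin> W" for t using F that by (simp add: ae_C1_def)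
    ultimately show ?case unfolding ae_C1_def by blast
  qed
qed

lemma spacetime_fundamental_theorem:
  fixes F :: "(real^'d) \<times> real \<Rightarrow> real"
  assumes F: "ae_C1 (spacetime per) F W DF" and s: "0 \<le> s" "s \<le> 1"
  shows "(LINT t|lebesgue_on {0..s}. LINT x|lebesgue_on unit_cell. snd (DF (x, t))) =
    (LINT x|lebesgue_on unit_cell. F (x, s)) - (LINT x|lebesgue_on unit_cell. F (x, 0))"
proof -
  let ?M = "lebesgue_on (unit_cell :: (real^'d) set)"
  obtain L where L: "\<And>z. norm (DF z) \<le> L" using ae_C1_bounded[OF F] by blast
  have m: "(\<lambda>z. snd (DF z)) \<in> borel_measurable borel"
    by (rule measurable_compose[OF ae_C1_measurable_grad[OF F]])
      (intro borel_measurable_continuous_onI continuous_intros)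
  have b: "\<bar>snd (DF z)\<bar> \<le> L" for z
    using norm_snd_le[of "snd (DF z)" "fst (DF z)"] L[of z] by simp
  have Fx: "integrable ?M (\<lambda>x. F (x, r))" if "r \<in> {0..1}" for r
  proof (rule L2_integrable_cell, rule L2_continuous_cell)
    have "unit_cell \<times> {r} \<subseteq> spacetime per" using that spat_superset by (auto simp: spacetime_def)
    then show "continuous_on unit_cell (\<lambda>x. F (x, r))"
      by (intro continuous_on_compose2[OF ae_C1_continuous[OF F]] continuous_intros) auto
  qed
  have "(LINT t|lebesgue_on {0..s}. LINT x|?M. snd (DF (x, t))) = (LINT x|?M. LINT t|lebesgue_on {0..s}. snd (DF (x, t)))"
    by (rule Fubini_swap_lebesgue_on[OF m b unit_cell_props(3) compact_Icc])
  also have "\<dots> = (LINT x|?M. F (x, s) - F (x, 0))"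
  proof (rule integral_cong_AE_lebesgue_on(1)[OF unit_cell_props(2)])
    show "AE x in ?M. (LINT t|lebesgue_on {0..s}. snd (DF (x, t))) = F (x, s) - F (x, 0)"
      using ae_C1_time_slice[OF F] by eventually_elim (rule ae_C1_fundamental_theorem[OF _ s])
  qed
  also have "\<dots> = (LINT x|?M. F (x, s)) - (LINT x|?M. F (x, 0))"
    using Fx s by simp
  finally show ?thesis .
qed

lemma Omega_props: "compact (Omega :: ((real^'d) \<times> real) set)" "Omega \<in> sets lebesgue" "Omega \<in> lmeasurable"
  unfolding Omega_cbox by auto

section \<open>Green's formula for the transport operator\<close>

lemma Omega_subset: "Omega \<subseteq> spacetime per"
  using spat_superset by (auto simp: Omega_def spacetime_def)

text \<open>Lebesgue measurability of \<open>h\<close> does not pass to the product by composition with the projection alone;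
  a null set of times has to be removed, whose preimage is a null set of space-time.\<close>

lemma integrable_snd_Omega:
  fixes h :: "real \<Rightarrow> real"
  assumes h: "integrable (lebesgue_on {0..1}) h"
  shows "integrable (lebesgue_on (Omega :: ((real^'d) \<times> real) set)) (\<lambda>z. h (snd z))"
proof -
  let ?C = "unit_cell :: (real^'d) set"
  have h0: "integrable lebesgue (\<lambda>t. indicat_real {0..1} t * h t)"
    using h by (subst (asm) integrable_restrict_space) auto
  obtain g where g: "g \<in> borel_measurable lborel" and gh: "AE t in lborel. indicat_real {0..1} t * h t = g t"
    using completion_ex_borel_measurable_real[OF borel_measurable_integrable[OF h0]] by auto
  have gi: "integrable lborel g"
    using integral_cong_AE_lebesgue(2)[OF AE_completion[OF gh]] h0 g by (simp add: integrable_completion)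
  define k where "k = (\<lambda>x t. indicat_real ?C x * g t)"
  have cC: "emeasure lborel ?C < \<infinity>" unfolding unit_cell_def by (rule emeasure_lborel_cbox_finite)
  have ind: "integrable lborel (indicat_real ?C)"
    using cC unit_cell_props(5) by (intro integrable_real_indicator) auto
  have km: "case_prod k \<in> borel_measurable (lborel \<Otimes>\<^sub>M lborel)"
  proof -
    have [measurable]: "?C \<in> sets lborel" using unit_cell_props(5) by simp
    show ?thesis unfolding k_def using g by measurable
  qed
  have "integrable (lborel \<Otimes>\<^sub>M lborel) (case_prod k)"
  proof (rule lborel_pair.Fubini_integrable[OF km])
    show "integrable lborel (\<lambda>x. LINT y|lborel. norm (case (x, y) of (x, t) \<Rightarrow> k x t))"
      using ind by (simp add: k_def abs_mult)
    show "AE x in lborel. integrable lborel (\<lambda>y. case (x, y) of (x, t) \<Rightarrow> k x t)"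
      using gi by (simp add: k_def)
  qed
  then have ki: "integrable lebesgue (case_prod k)"
    unfolding lborel_prod by (simp add: integrable_completion borel_measurable_integrable)
  obtain N where N: "{t \<in> space lborel. indicat_real {0..1} t * h t \<noteq> g t} \<subseteq> N" "emeasure lborel N = 0" "N \<in> sets lborel"
    using AE_E[OF gh] by blast
  then have "N \<in> null_sets lborel" by auto
  then have "UNIV \<times> N \<in> null_sets (lborel \<Otimes>\<^sub>M lborel)"
    by (intro lborel.times_in_null_sets2) auto
  then have "UNIV \<times> N \<in> null_sets (lborel :: ((real^'d) \<times> real) measure)" unfolding lborel_prod .
  then have "AE z::(real^'d) \<times> real in lborel. z \<notin> UNIV \<times> N" by (rule AE_not_in)
  then have "AE z::(real^'d) \<times> real in lborel. case_prod k z = indicat_real Omega z * h (snd z)"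
  proof eventually_elim
    case (elim z)
    then have "indicat_real {0..1} (snd z) * h (snd z) = g (snd z)" using N(1) by (auto simp: mem_Times_iff)
    then have "g (snd z) = indicat_real {0..1} (snd z) * h (snd z)" by simp
    then show ?case by (auto simp: k_def Omega_def indicator_def mem_Times_iff split_beta' of_bool_def split: if_splits)
  qed
  from integral_cong_AE_lebesgue(2)[OF AE_completion[OF this]] ki
  have "integrable lebesgue (\<lambda>z::(real^'d) \<times> real. indicat_real Omega z * h (snd z))" by simp
  then show ?thesis using Omega_props(2) by (subst integrable_restrict_space) auto
qed

lemma L2_snd_Omega:
  fixes h :: "real \<Rightarrow> real"
  assumes h: "h \<in> L2 {0..1}"
  shows "(\<lambda>z. h (snd z)) \<in> L2 (Omega :: ((real^'d) \<times> real) set)"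
proof -
  have "integrable (lebesgue_on {0..1}) h" by (rule L2_integrable_compact[OF compact_Icc h])
  from integrable_snd_Omega[OF this]
  have "(\<lambda>z. h (snd z)) \<in> borel_measurable (lebesgue_on (Omega :: ((real^'d) \<times> real) set))"
    by (rule borel_measurable_integrable)
  moreover have "integrable (lebesgue_on {0..1}) (\<lambda>t. (h t)\<^sup>2)" using h by (simp add: L2_def)
  from integrable_snd_Omega[OF this]
  have "integrable (lebesgue_on (Omega :: ((real^'d) \<times> real) set)) (\<lambda>z. (h (snd z))\<^sup>2)" .
  ultimately show ?thesis by (simp add: L2_def)
qed

lemma GDERIV_unique: "GDERIV f x :> a \<Longrightarrow> GDERIV f x :> b \<Longrightarrow> a = b"
proof -
  assume "GDERIV f x :> a" "GDERIV f x :> b"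
  then have "(\<lambda>h. h \<bullet> a) = (\<lambda>h. h \<bullet> b)" unfolding gderiv_def by (rule has_derivative_unique)
  then have "\<forall>h. h \<bullet> a = h \<bullet> b" by metis
  then show ?thesis by (metis vector_eq_ldot)
qed

lemma lattice_reduce:
  fixes x :: "real^'d"
  obtains k where "k \<in> lattice_vectors" "x + k \<in> unit_cell"
proof
  show "(\<chi> i. - of_int \<lfloor>x $ i\<rfloor>) \<in> lattice_vectors" by (simp add: lattice_vectors_def)
  show "x + (\<chi> i. - of_int \<lfloor>x $ i\<rfloor>) \<in> unit_cell"
    unfolding unit_cell_def mem_box_cart
  proof (intro allI conjI)
    fix i
    show "0 $ i \<le> (x + (\<chi> i. - of_int \<lfloor>x $ i\<rfloor>)) $ i" by simp
    show "(x + (\<chi> i. - of_int \<lfloor>x $ i\<rfloor>)) $ i \<le> 1 $ i"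
      using real_of_int_floor_add_one_gt[of "x $ i"] by simp linarith
  qed
qed

lemma spacetime_reduce:
  fixes f :: "(real^'d) \<times> real \<Rightarrow> 'b"
  assumes z: "z \<in> spacetime per" and per: "per \<Longrightarrow> \<forall>t\<in>{0..1}. periodic (\<lambda>x. f (x, t))"
  obtains z' where "z' \<in> Omega" "f z' = f z"
proof (cases per)
  case False
  then have "z \<in> Omega" using z by (simp add: spacetime_def Omega_def spat_def)
  then show ?thesis using that by blast
next
  case True
  obtain k where k: "k \<in> lattice_vectors" "fst z + k \<in> unit_cell" using lattice_reduce .
  have t: "snd z \<in> {0..1}" using z by (auto simp: spacetime_def)
  have "f (fst z + k, snd z) = f z"
    using per[OF True] t k(1) unfolding periodic_def by fastforce
  moreover have "(fst z + k, snd z) \<in> Omega" using k(2) t by (simp add: Omega_def)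
  ultimately show ?thesis using that by blast
qed

lemma spacetime_bounded:
  fixes f :: "(real^'d) \<times> real \<Rightarrow> 'b::real_normed_vector"
  assumes c: "continuous_on Omega f" and per: "per \<Longrightarrow> \<forall>t\<in>{0..1}. periodic (\<lambda>x. f (x, t))"
  obtains B where "\<And>z. z \<in> spacetime per \<Longrightarrow> norm (f z) \<le> B"
proof -
  obtain B where B: "\<And>z. z \<in> Omega \<Longrightarrow> norm (f z) \<le> B"
    using compact_bounded_fun[OF Omega_props(1) c] by blast
  have "norm (f z) \<le> B" if "z \<in> spacetime per" for z
    using spacetime_reduce[OF that per] B by metis
  then show ?thesis using that by blast
qed

lemma convex_spacetime: "convex (spacetime per :: ((real^'d) \<times> real) set)"
  unfolding spacetime_def spat_def by (intro convex_Times) (auto simp: unit_cell_props)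

text \<open>Derivatives are unique, and translating \<open>\<phi>\<close> by a lattice vector does not change it.\<close>

lemma periodic_gradient:
  fixes \<phi> :: "(real^'d) \<times> real \<Rightarrow> real"
  assumes D: "\<And>z. GDERIV \<phi> z :> D z" and p: "\<forall>t. periodic (\<lambda>x. \<phi> (x, t))"
  shows "periodic (\<lambda>x. D (x, t))"
  unfolding periodic_def
proof (intro ballI allI)
  fix k x :: "real^'d" assume k: "k \<in> lattice_vectors"
  have "((\<lambda>z. \<phi> (z + (k, 0))) has_derivative (\<lambda>h. h \<bullet> D ((x, t) + (k, 0)))) (at (x, t))"
    using D[of "(x, t) + (k, 0)"] unfolding gderiv_def
    by (intro has_derivative_compose[of "\<lambda>z. z + (k, 0)" "\<lambda>h. h" "(x, t)" UNIV \<phi> "\<lambda>h. h \<bullet> D ((x, t) + (k, 0))"])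
      (auto intro!: derivative_eq_intros)
  moreover have "(\<lambda>z. \<phi> (z + (k, 0))) = \<phi>"
    using p k by (auto simp: periodic_def fun_eq_iff)
  ultimately have "GDERIV \<phi> (x, t) :> D (x + k, t)" by (simp add: gderiv_def)
  from GDERIV_unique[OF this D] show "D (x + k, t) = D (x, t)" .
qed

lemma spacetime_test_ae_C1:
  fixes \<phi> :: "(real^'d) \<times> real \<Rightarrow> real"
  assumes \<phi>: "spacetime_test per \<phi> D"
  shows "ae_C1 (spacetime per) \<phi> (interior (spacetime per)) (\<lambda>z. if z \<in> interior (spacetime per) then D z else 0)"
    and "\<exists>B. \<forall>z\<in>spacetime per. \<bar>\<phi> z\<bar> \<le> B"
proof -
  have C1: "C1_with_grad \<phi> D" using \<phi> by (simp add: spacetime_test_def)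
  have D: "continuous_on Omega D" using C1 unfolding C1_with_grad_def by (meson continuous_on_subset subset_UNIV)
  have p: "per \<Longrightarrow> \<forall>t. periodic (\<lambda>x. \<phi> (x, t))" using \<phi> by (simp add: spacetime_test_def)
  then have pD: "per \<Longrightarrow> \<forall>t\<in>{0..1}. periodic (\<lambda>x. D (x, t))"
    using C1 periodic_gradient[of \<phi> D] unfolding C1_with_grad_def by blast
  obtain B where B: "\<And>z. z \<in> spacetime per \<Longrightarrow> norm (D z) \<le> B" using spacetime_bounded[OF D pD] by blast
  show "ae_C1 (spacetime per) \<phi> (interior (spacetime per)) (\<lambda>z. if z \<in> interior (spacetime per) then D z else 0)"
    by (rule C1_imp_ae_C1[OF C1 convex_spacetime B])
  have "continuous_on Omega \<phi>" using C1_continuous[OF C1] continuous_on_subset by blast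
  then obtain B where "\<And>z. z \<in> spacetime per \<Longrightarrow> norm (\<phi> z) \<le> B" using spacetime_bounded[of \<phi> per] p by blast
  then show "\<exists>B. \<forall>z\<in>spacetime per. \<bar>\<phi> z\<bar> \<le> B" by (intro exI[of _ B]) auto
qed

definition spatially_periodic :: "bool \<Rightarrow> ((real^'d) \<times> real \<Rightarrow> real) \<Rightarrow> bool" where
  "spatially_periodic per f \<longleftrightarrow> (per \<longrightarrow> (\<forall>t\<in>{0..1}. periodic (\<lambda>x. f (x, t))))"

lemma slice_integrable:
  fixes f :: "(real^'d) \<times> real \<Rightarrow> real"
  assumes "continuous_on Omega f" "t \<in> {0..1}"
  shows "continuous_on unit_cell (\<lambda>x. f (x, t))" "integrable (lebesgue_on unit_cell) (\<lambda>x. f (x, t))"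
proof -
  show "continuous_on unit_cell (\<lambda>x. f (x, t))"
    by (rule continuous_on_compose2[OF assms(1)]) (use assms(2) in \<open>auto simp: Omega_def intro!: continuous_intros\<close>)
  then show "integrable (lebesgue_on unit_cell) (\<lambda>x. f (x, t))" by (intro L2_integrable_cell L2_continuous_cell)
qed

locale transport =
  fixes per :: bool and V :: "(real^'d \<Rightarrow> real^'d) set" and normV u
  assumes V: "velocity_space per V normV" and u: "admissible_velocity per V normV u"
begin

abbreviation "cellM \<equiv> lebesgue_on (unit_cell :: (real^'d) set)"
abbreviation "OmegaM \<equiv> lebesgue_on (Omega :: ((real^'d) \<times> real) set)"

definition speed :: "real \<Rightarrow> real" where
  "speed t = normV (\<lambda>x. u x t)"

lemma u_in_V: "t \<in> {0..1} \<Longrightarrow> (\<lambda>x. u x t) \<in> V"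
  using u by (simp add: admissible_velocity_def L2_time_def)

lemma u_measurable: "(\<lambda>z. u (fst z) (snd z)) \<in> borel_measurable OmegaM"
  using u by (simp add: admissible_velocity_def L2_time_def)

lemma speed_L2: "speed \<in> L2 {0..1}"
  using u by (simp add: admissible_velocity_def L2_time_def speed_def[abs_def])

lemma u_bounds:
  "\<exists>C\<ge>0. (\<forall>t\<in>{0..1}. 0 \<le> speed t) \<and> (\<forall>z\<in>Omega. norm (u (fst z) (snd z)) \<le> C * speed (snd z)) \<and>
    (\<forall>t\<in>{0..1}. AE x in cellM. \<bar>weak_div per (\<lambda>y. u y t) x\<bar> \<le> C * speed t)"
proof -
  obtain C where C: "0 \<le> C" "\<forall>v\<in>V. 0 \<le> normV v \<and> (\<forall>x\<in>unit_cell. norm (v x) \<le> C * normV v) \<and>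
    (AE x in cellM. \<bar>weak_div per v x\<bar> \<le> C * normV v)" using velocity_bounds[OF V] by blast
  show ?thesis
  proof (intro exI[of _ C] conjI ballI C(1))
    fix t :: real assume "t \<in> {0..1}"
    then show "0 \<le> speed t" "AE x in cellM. \<bar>weak_div per (\<lambda>y. u y t) x\<bar> \<le> C * speed t"
      using bspec[OF C(2) u_in_V] by (simp_all add: speed_def)
  next
    fix z :: "(real^'d) \<times> real" assume "z \<in> Omega"
    then have "snd z \<in> {0..1}" "fst z \<in> unit_cell" by (auto simp: Omega_def)
    then show "norm (u (fst z) (snd z)) \<le> C * speed (snd z)"
      using bspec[OF C(2) u_in_V[of "snd z"]] by (simp add: speed_def)
  qed
qed

text \<open>The speed \<open>t \<mapsto> \<parallel>u(\<cdot>, t)\<parallel>\<^sub>V\<close> is square integrable in time and bounds \<open>u\<close> uniformly in space.\<close>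

lemma transport_of_gradient_L2:
  assumes Df: "Df \<in> borel_measurable borel" "\<And>z. norm (Df z) \<le> L"
  shows "(\<lambda>z. bvec u z \<bullet> Df z) \<in> L2 (Omega :: ((real^'d) \<times> real) set)"
proof -
  obtain C where C: "0 \<le> C" "\<forall>t\<in>{0..1}. 0 \<le> speed t" "\<forall>z\<in>Omega. norm (u (fst z) (snd z)) \<le> C * speed (snd z)"
    using u_bounds by blast
  have m: "(\<lambda>z. bvec u z \<bullet> Df z) \<in> borel_measurable OmegaM"
  proof -
    have c1: "(\<lambda>z. fst (Df z)) \<in> borel_measurable borel" and c2: "(\<lambda>z. snd (Df z)) \<in> borel_measurable borel"
      by (rule measurable_compose[OF Df(1)], intro borel_measurable_continuous_onI continuous_intros)+
    have "(\<lambda>z. u (fst z) (snd z) \<bullet> fst (Df z) + snd (Df z)) \<in> borel_measurable OmegaM"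
      by (intro borel_measurable_add borel_measurable_inner u_measurable borel_measurable_lebesgue_on c1 c2)
    then show ?thesis by (simp add: bvec_def inner_prod_def)
  qed
  have "(\<lambda>z::(real^'d) \<times> real. (L * C) * speed (snd z) + L) \<in> L2 Omega"
    by (intro L2_add L2_scale L2_snd_Omega speed_L2 L2_continuous_compact Omega_props continuous_intros)
  with m show ?thesis
  proof (rule L2_dominated)
    fix z :: "(real^'d) \<times> real" assume z: "z \<in> Omega"
    have n: "norm (fst (Df z)) \<le> L" "\<bar>snd (Df z)\<bar> \<le> L"
      using Df(2)[of z] norm_fst_le[of "fst (Df z)" "snd (Df z)"] norm_snd_le[of "snd (Df z)" "fst (Df z)"] by auto
    have "\<bar>u (fst z) (snd z) \<bullet> fst (Df z)\<bar> \<le> norm (u (fst z) (snd z)) * norm (fst (Df z))"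
      by (rule Cauchy_Schwarz_ineq2)
    also have "\<dots> \<le> (C * speed (snd z)) * L"
      using bspec[OF C(3) z] n(1) by (intro mult_mono) (auto intro: order_trans[OF norm_ge_zero])
    finally show "\<bar>bvec u z \<bullet> Df z\<bar> \<le> (L * C) * speed (snd z) + L"
      using n(2) by (simp add: bvec_def inner_prod_def algebra_simps abs_if split: if_splits)
  qed
qed

text \<open>Only almost every time is good: the hyperplane of a fixed time may contain faces of the mesh, on
  which no spatial gradient is available.\<close>

lemma slice_integration_by_parts:
  assumes F: "ae_C1 (spacetime per) F W DF" and p: "spatially_periodic per F"
  shows "AE t in lebesgue_on {0..1}. t \<in> {0..1} \<and> (AE x in cellM. (x, t) \<in> W) \<and>
    integrable cellM (\<lambda>x. u x t \<bullet> fst (DF (x, t))) \<and>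
    integrable cellM (\<lambda>x. weak_div per (\<lambda>y. u y t) x * F (x, t)) \<and>
    (LINT x|cellM. u x t \<bullet> fst (DF (x, t))) = - (LINT x|cellM. weak_div per (\<lambda>y. u y t) x * F (x, t))"
proof -
  have "AE t in lebesgue_on {0..1}. t \<in> {0..1::real}" by (rule AE_I2) (simp add: space_restrict_space)
  with ae_C1_space_slice[OF F] show ?thesis
  proof eventually_elim
    case (elim t)
    have H: "\<not> per \<Longrightarrow> \<forall>i. (\<lambda>x. u x t $ i) \<in> H10" using u elim(2) by (simp add: admissible_velocity_def)
    have pt: "per \<Longrightarrow> periodic (\<lambda>x. F (x, t))" using p elim(2) by (simp add: spatially_periodic_def)
    have "AE x in cellM. (x, t) \<in> W" using ae_C1_spat_AE[OF elim(1)] by simp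
    with space_integration_by_parts[OF V u_in_V[OF elim(2)] H elim(1) pt] elim(2) show ?case by simp
  qed
qed

lemma spatially_periodic_bounded:
  assumes "ae_C1 (spacetime per) F W DF" "spatially_periodic per F"
  obtains B where "\<And>z. z \<in> spacetime per \<Longrightarrow> \<bar>F z\<bar> \<le> B"
proof -
  have c: "continuous_on Omega F" using ae_C1_continuous[OF assms(1)] Omega_subset continuous_on_subset by blast
  obtain B where "\<And>z. z \<in> spacetime per \<Longrightarrow> norm (F z) \<le> B"
    by (rule spacetime_bounded[OF c, of per]) (use assms(2) in \<open>auto simp: spatially_periodic_def\<close>)
  then show ?thesis using that by auto
qed

text \<open>The inner integral of the adjoint pairing contains the slice-wise chosen divergence, which is not known to
  be jointly measurable.  The integration by parts in space eliminates it: for almost every \<open>t\<close> the inner integral is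
  \<open>\<integral>\<partial>\<^sub>t(f \<phi>) - \<integral>\<phi> b \<cdot> \<nabla>f\<close>, where both integrands are integrable over space-time.\<close>

lemma green:
  assumes f: "ae_C1 (spacetime per) f W Df" and p: "spatially_periodic per f" and \<phi>: "spacetime_test per \<phi> D"
  shows "adjoint_pairing per u f \<phi> D + L2_inner Omega (\<lambda>z. bvec u z \<bullet> Df z) \<phi> =
    L2_inner unit_cell (\<lambda>x. f (x, 1)) (\<lambda>x. \<phi> (x, 1)) - L2_inner unit_cell (\<lambda>x. f (x, 0)) (\<lambda>x. \<phi> (x, 0))"
proof -
  obtain Bf where Bf: "\<And>z. z \<in> spacetime per \<Longrightarrow> \<bar>f z\<bar> \<le> Bf" using spatially_periodic_bounded[OF f p] by blast
  note ae\<phi> = spacetime_test_ae_C1(1)[OF \<phi>]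
  obtain Bp where Bp: "\<And>z. z \<in> spacetime per \<Longrightarrow> \<bar>\<phi> z\<bar> \<le> Bp" using spacetime_test_ae_C1(2)[OF \<phi>] by blast
  define P where "P = (\<lambda>z. f z * \<phi> z)"
  define PW where "PW = W \<inter> interior (spacetime per)"
  define DP where "DP = (\<lambda>z. if z \<in> PW then f z *\<^sub>R (if z \<in> interior (spacetime per) then D z else 0) + \<phi> z *\<^sub>R Df z else 0)"
  have P: "ae_C1 (spacetime per) P PW DP"
    using ae_C1_mult[OF f ae\<phi> Bf Bp] unfolding P_def PW_def DP_def .
  have pP: "spatially_periodic per P"
    using p \<phi> by (auto simp: spatially_periodic_def spacetime_test_def periodic_def P_def)
  obtain Lf where Lf: "\<And>z. norm (Df z) \<le> Lf" using ae_C1_bounded[OF f] by blast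
  obtain LP where LP: "\<And>z. norm (DP z) \<le> LP" using ae_C1_bounded[OF P] by blast
  have T: "(\<lambda>z. bvec u z \<bullet> Df z) \<in> L2 Omega"
    by (rule transport_of_gradient_L2[OF ae_C1_measurable_grad[OF f] Lf])
  have \<phi>L2: "\<phi> \<in> L2 Omega"
    using ae_C1_continuous[OF ae\<phi>] Omega_subset by (intro L2_continuous_compact Omega_props) (rule continuous_on_subset)
  have iM: "integrable OmegaM (\<lambda>z. (bvec u z \<bullet> Df z) * \<phi> z)" by (rule L2_mult_integrable[OF T \<phi>L2])
  have sm: "(\<lambda>z. snd (DP z)) \<in> borel_measurable borel"
    by (rule measurable_compose[OF ae_C1_measurable_grad[OF P]]) (intro borel_measurable_continuous_onI continuous_intros)
  have sb: "\<bar>snd (DP z)\<bar> \<le> LP" for z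
    using LP[of z] norm_snd_le[of "snd (DP z)" "fst (DP z)"] by auto
  have iK: "integrable OmegaM (\<lambda>z. snd (DP z))"
    by (rule integrable_bounded_lebesgue_on[OF Omega_props(3) borel_measurable_lebesgue_on[OF sm] sb])
  have bC: "unit_cell \<in> sets borel" "{0..1::real} \<in> sets borel" by (auto simp: unit_cell_props)
  note FM = Fubini_lebesgue_on[OF bC, folded Omega_def, OF iM] and FK = Fubini_lebesgue_on[OF bC, folded Omega_def, OF iK]
  let ?J = "\<lambda>t. LINT x|cellM. f (x, t) * (bvec u (x, t) \<bullet> D (x, t) + weak_div per (\<lambda>y. u y t) x * \<phi> (x, t))"
  let ?K = "\<lambda>t. LINT x|cellM. snd (DP (x, t))"
  let ?L = "\<lambda>t. LINT x|cellM. (bvec u (x, t) \<bullet> Df (x, t)) * \<phi> (x, t)"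
  have J: "AE t in lebesgue_on {0..1}. ?J t = ?K t - ?L t"
    using slice_integration_by_parts[OF P pP] FM(1) FK(1)
  proof eventually_elim
    case (elim t)
    then have i1: "integrable cellM (\<lambda>x. u x t \<bullet> fst (DP (x, t)))"
      and i2: "integrable cellM (\<lambda>x. weak_div per (\<lambda>y. u y t) x * P (x, t))"
      and e: "(LINT x|cellM. u x t \<bullet> fst (DP (x, t))) = - (LINT x|cellM. weak_div per (\<lambda>y. u y t) x * P (x, t))"
      and W: "AE x in cellM. (x, t) \<in> PW" by auto
    have "AE x in cellM. f (x, t) * (bvec u (x, t) \<bullet> D (x, t) + weak_div per (\<lambda>y. u y t) x * \<phi> (x, t)) =
       snd (DP (x, t)) + u x t \<bullet> fst (DP (x, t)) + weak_div per (\<lambda>y. u y t) x * P (x, t) - (bvec u (x, t) \<bullet> Df (x, t)) * \<phi> (x, t)"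
      using W
    proof eventually_elim
      case (elim x)
      then have "DP (x, t) = f (x, t) *\<^sub>R D (x, t) + \<phi> (x, t) *\<^sub>R Df (x, t)"
        by (simp add: DP_def PW_def)
      then show ?case
        by (simp add: P_def bvec_def inner_prod_def inner_add_right algebra_simps)
    qed
    from integral_cong_AE_lebesgue_on(1)[OF unit_cell_props(2) this]
    have "?J t = (LINT x|cellM. snd (DP (x, t)) + u x t \<bullet> fst (DP (x, t)) + weak_div per (\<lambda>y. u y t) x * P (x, t) - (bvec u (x, t) \<bullet> Df (x, t)) * \<phi> (x, t))" .
    also have "\<dots> = ?K t + (LINT x|cellM. u x t \<bullet> fst (DP (x, t))) + (LINT x|cellM. weak_div per (\<lambda>y. u y t) x * P (x, t)) - ?L t"
      using i1 i2 elim(2,3) by simp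
    finally show ?case using e by simp
  qed
  have "adjoint_pairing per u f \<phi> D = (LINT t|lebesgue_on {0..1}. ?K t - ?L t)"
    unfolding adjoint_pairing_def by (rule integral_cong_AE_lebesgue_on(1)[OF _ J]) simp
  also have "\<dots> = (LINT t|lebesgue_on {0..1}. ?K t) - (LINT t|lebesgue_on {0..1}. ?L t)"
    using FM(2) FK(2) by simp
  also have "(LINT t|lebesgue_on {0..1}. ?L t) = L2_inner Omega (\<lambda>z. bvec u z \<bullet> Df z) \<phi>"
    using FM(3) by (simp add: L2_inner_def)
  also have "(LINT t|lebesgue_on {0..1}. ?K t) = (LINT x|cellM. P (x, 1)) - (LINT x|cellM. P (x, 0))"
    by (rule spacetime_fundamental_theorem[OF P]) auto
  finally show ?thesis by (simp add: L2_inner_def P_def)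
qed

end

section \<open>Uniqueness for the transport equation\<close>

text \<open>With \<open>k > K\<close>, at a maximum \<open>s0\<close> of \<open>E(s) exp(- 2 k s)\<close>, with value \<open>m\<close>, the hypothesis yields
  \<open>E(s0) \<le> m (exp(2 k s0) - 1) / 2\<close>, that is, \<open>m exp(2 k s0) \<le> m (exp(2 k s0) - 1) / 2\<close>; hence \<open>m \<le> 0\<close>.\<close>

lemma gronwall_zero:
  fixes E :: "real \<Rightarrow> real"
  assumes E: "continuous_on {0..1} E" "\<And>s. s \<in> {0..1} \<Longrightarrow> 0 \<le> E s"
    and K: "0 \<le> K" "\<And>s. s \<in> {0..1} \<Longrightarrow> E s \<le> K * (LINT t|lebesgue_on {0..s}. E t)"
    and s: "s \<in> {0..1}"
  shows "E s = 0"
proof -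
  define k where "k = K + 1"
  have k: "0 < k" "K \<le> k" using K(1) by (auto simp: k_def)
  have "continuous_on {0..1} (\<lambda>s. E s * exp (- 2 * k * s))"
    by (intro continuous_intros E(1))
  then obtain s0 where s0: "s0 \<in> {0..1}" and mx: "\<And>t. t \<in> {0..1} \<Longrightarrow> E t * exp (- 2 * k * t) \<le> E s0 * exp (- 2 * k * s0)"
    using continuous_attains_sup[of "{0..1::real}" "\<lambda>s. E s * exp (- 2 * k * s)"] by auto
  define m where "m = E s0 * exp (- 2 * k * s0)"
  have m0: "0 \<le> m" using E(2)[OF s0] by (simp add: m_def)
  have bound: "E t \<le> m * exp (2 * k * t)" if "t \<in> {0..1}" for t
  proof -
    have "E t = (E t * exp (- 2 * k * t)) * exp (2 * k * t)"
      by (simp add: mult.assoc exp_add[symmetric])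
    also have "\<dots> \<le> m * exp (2 * k * t)"
      using mx[OF that] unfolding m_def by (intro mult_right_mono) auto
    finally show ?thesis .
  qed
  have sub: "{0..s0} \<subseteq> {0..1}" using s0 by auto
  have iE: "integrable (lebesgue_on {0..s0}) E"
    by (rule continuous_imp_integrable_real) (rule continuous_on_subset[OF E(1) sub])
  have iX: "integrable (lebesgue_on {0..s0}) (\<lambda>t. m * exp (2 * k * t))"
    by (rule continuous_imp_integrable_real) (intro continuous_intros)
  have "(LINT t|lebesgue_on {0..s0}. E t) \<le> (LINT t|lebesgue_on {0..s0}. m * exp (2 * k * t))"
    by (rule integral_mono[OF iE iX]) (use bound sub in \<open>auto simp: space_restrict_space\<close>)
  also have "\<dots> = integral {0..s0} (\<lambda>t. m * exp (2 * k * t))"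
    using iX by (intro lebesgue_integral_eq_integral) auto
  also have "\<dots> = m * exp (2 * k * s0) / (2 * k) - m * exp (2 * k * 0) / (2 * k)"
  proof (rule integral_unique, rule fundamental_theorem_of_calculus)
    show "0 \<le> s0" using s0 by simp
    fix t assume "t \<in> {0..s0}"
    show "((\<lambda>t. m * exp (2 * k * t) / (2 * k)) has_vector_derivative m * exp (2 * k * t)) (at t within {0..s0})"
      unfolding has_real_derivative_iff_has_vector_derivative[symmetric]
      using k(1) by (auto intro!: derivative_eq_intros)
  qed
  finally have int: "(LINT t|lebesgue_on {0..s0}. E t) \<le> m * (exp (2 * k * s0) - 1) / (2 * k)"
    by (simp add: diff_divide_distrib right_diff_distrib)
  have nn: "0 \<le> (LINT t|lebesgue_on {0..s0}. E t)"
    using E(2) sub by (intro integral_nonneg_AE AE_I2) (auto simp: space_restrict_space)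
  have "m * exp (2 * k * s0) = E s0" by (simp add: m_def mult.assoc exp_add[symmetric])
  also have "\<dots> \<le> k * (LINT t|lebesgue_on {0..s0}. E t)"
    using K(2)[OF s0] mult_right_mono[OF k(2) nn] by linarith
  also have "\<dots> \<le> k * (m * (exp (2 * k * s0) - 1) / (2 * k))" using int k(1) by (intro mult_left_mono) auto
  also have "\<dots> = m * (exp (2 * k * s0) - 1) / 2" using k(1) by simp
  finally have "m * (exp (2 * k * s0) + 1) \<le> 0" by (simp add: algebra_simps)
  moreover have "0 < exp (2 * k * s0) + 1" by (simp add: add_pos_pos)
  ultimately have "m = 0" using m0 by (simp add: mult_le_0_iff)
  then show ?thesis using bound[OF s] E(2)[OF s] by simp
qed

lemma AE_Omega_slices:
  fixes P :: "(real^'d) \<times> real \<Rightarrow> bool"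
  assumes "AE z in lebesgue_on Omega. P z"
  shows "AE t in lebesgue_on {0..1}. AE x in lebesgue_on unit_cell. P (x, t)"
proof -
  have "AE z in lebesgue. z \<in> Omega \<longrightarrow> P z"
    using assms Omega_props(2) by (subst (asm) AE_restrict_space_iff) auto
  then have "AE z in lborel. z \<in> Omega \<longrightarrow> P z" by (simp only: AE_completion_iff)
  from AE_completion[OF AE_lborel_slices(2)[OF this]]
  have 1: "AE t in lebesgue. AE x in lborel. (x, t) \<in> Omega \<longrightarrow> P (x, t)" .
  have "AE t in lebesgue. t \<in> {0..1} \<longrightarrow> (AE x in lebesgue_on unit_cell. P (x, t))"
    using 1
  proof eventually_elim
    case (elim t)
    show ?case
    proof
      assume t: "t \<in> {0..1}"
      have "AE x in lebesgue. x \<in> unit_cell \<longrightarrow> P (x, t)"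
        using AE_completion[OF elim] by eventually_elim (use t in \<open>auto simp: Omega_def\<close>)
      then show "AE x in lebesgue_on unit_cell. P (x, t)"
        using unit_cell_props(2) by (subst AE_restrict_space_iff) auto
    qed
  qed
  then show ?thesis by (subst AE_restrict_space_iff) auto
qed

context transport
begin

text \<open>The energy estimate.  As the speed is only square integrable in time, the Cauchy-Schwarz inequality
  turns \<open>e(s) \<le> \<integral>\<^sub>0\<^sup>s C \<parallel>u\<parallel>\<^sub>V e\<close> into an inequality for \<open>e\<^sup>2\<close> with a constant factor.\<close>

lemma transport_uniqueness:
  assumes f: "ae_C1 (spacetime per) f W Df" and p: "spatially_periodic per f"
    and T0: "AE z in OmegaM. bvec u z \<bullet> Df z = 0" and init: "\<And>x. x \<in> unit_cell \<Longrightarrow> f (x, 0) = 0"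
    and z: "z \<in> Omega"
  shows "f z = 0"
proof -
  obtain B where B: "\<And>z. z \<in> spacetime per \<Longrightarrow> \<bar>f z\<bar> \<le> B" using spatially_periodic_bounded[OF f p] by blast
  define F where "F = (\<lambda>z. f z * f z)"
  define DF where "DF = (\<lambda>z. if z \<in> W \<inter> W then f z *\<^sub>R Df z + f z *\<^sub>R Df z else 0)"
  have F: "ae_C1 (spacetime per) F (W \<inter> W) DF" unfolding F_def DF_def by (rule ae_C1_mult[OF f f B B])
  have pF: "spatially_periodic per F" using p by (auto simp: spatially_periodic_def periodic_def F_def)
  have Fc: "continuous_on Omega F" using ae_C1_continuous[OF F] Omega_subset continuous_on_subset by blast
  obtain C where C: "0 \<le> C" "\<forall>t\<in>{0..1}. 0 \<le> speed t" "\<forall>t\<in>{0..1}. AE x in cellM. \<bar>weak_div per (\<lambda>y. u y t) x\<bar> \<le> C * speed t"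
    using u_bounds by blast
  define e where "e = (\<lambda>s. LINT x|cellM. F (x, s))"
  have Fi: "integrable cellM (\<lambda>x. F (x, s))" if "s \<in> {0..1}" for s by (rule slice_integrable(2)[OF Fc that])
  have F0: "0 \<le> F z" for z by (simp add: F_def)
  have e0: "0 \<le> e s" for s unfolding e_def using F0 by simp
  have ec: "continuous_on {0..1} e"
  proof -
    obtain L where L: "L-lipschitz_on (spacetime per) F" using F unfolding ae_C1_def by blast
    have ci: "integrable cellM (\<lambda>x. L * c)" for c by (intro L2_integrable_cell L2_continuous_cell continuous_intros)
    have "(L * measure cellM unit_cell)-lipschitz_on {0..1} e"
    proof (rule lipschitz_onI)
      show "0 \<le> L * measure cellM unit_cell" using lipschitz_on_nonneg[OF L] by simp
      fix s t :: real assume st: "s \<in> {0..1}" "t \<in> {0..1}"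
      have "e s - e t = (LINT x|cellM. F (x, s) - F (x, t))" unfolding e_def using Fi st by simp
      also have "\<bar>\<dots>\<bar> \<le> (LINT x|cellM. \<bar>F (x, s) - F (x, t)\<bar>)" by (rule integral_abs_bound)
      also have "\<dots> \<le> (LINT x|cellM. L * \<bar>s - t\<bar>)"
      proof (rule integral_mono)
        show "integrable cellM (\<lambda>x. \<bar>F (x, s) - F (x, t)\<bar>)" using Fi st by simp
        fix x assume "x \<in> space cellM"
        then have "(x, s) \<in> spacetime per" "(x, t) \<in> spacetime per"
          using st spat_superset by (auto simp: spacetime_def space_restrict_space)
        from lipschitz_onD[OF L this] show "\<bar>F (x, s) - F (x, t)\<bar> \<le> L * \<bar>s - t\<bar>"
          by (simp add: dist_Pair_Pair dist_real_def)
      qed (rule ci)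
      also have "\<dots> = (L * measure cellM unit_cell) * \<bar>s - t\<bar>"
        by (simp add: space_restrict_space mult_ac)
      finally show "dist (e s) (e t) \<le> (L * measure cellM unit_cell) * dist s t" by (simp add: dist_real_def)
    qed
    then show ?thesis by (rule lipschitz_on_continuous_on)
  qed
  let ?K = "\<lambda>t. LINT x|cellM. snd (DF (x, t))"
  obtain LF where LF: "\<And>z. norm (DF z) \<le> LF" using ae_C1_bounded[OF F] by blast
  have sm: "(\<lambda>z. snd (DF z)) \<in> borel_measurable borel"
    by (rule measurable_compose[OF ae_C1_measurable_grad[OF F]]) (intro borel_measurable_continuous_onI continuous_intros)
  have sb: "\<bar>snd (DF z)\<bar> \<le> LF" for z
    using LF[of z] norm_snd_le[of "snd (DF z)" "fst (DF z)"] by auto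
  have iK: "integrable OmegaM (\<lambda>z. snd (DF z))"
    by (rule integrable_bounded_lebesgue_on[OF Omega_props(3) borel_measurable_lebesgue_on[OF sm] sb])
  have bC: "unit_cell \<in> sets borel" "{0..1::real} \<in> sets borel" by (auto simp: unit_cell_props)
  note FK = Fubini_lebesgue_on[OF bC, folded Omega_def, OF iK]
  have Kb: "AE t in lebesgue_on {0..1}. ?K t \<le> C * speed t * e t"
    using slice_integration_by_parts[OF F pF] AE_Omega_slices[OF T0] FK(1)
  proof eventually_elim
    case (elim t)
    then have t: "t \<in> {0..1}" and i1: "integrable cellM (\<lambda>x. u x t \<bullet> fst (DF (x, t)))"
      and i2: "integrable cellM (\<lambda>x. weak_div per (\<lambda>y. u y t) x * F (x, t))"
      and ibp: "(LINT x|cellM. u x t \<bullet> fst (DF (x, t))) = - (LINT x|cellM. weak_div per (\<lambda>y. u y t) x * F (x, t))"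
      and W: "AE x in cellM. (x, t) \<in> W \<inter> W" by auto
    have "AE x in cellM. snd (DF (x, t)) = - (u x t \<bullet> fst (DF (x, t)))"
      using W elim(2)
    proof eventually_elim
      case (elim x)
      have "bvec u (x, t) \<bullet> DF (x, t) = 2 * f (x, t) * (bvec u (x, t) \<bullet> Df (x, t))"
        using elim(1) by (simp add: DF_def inner_add_right)
      then have "u x t \<bullet> fst (DF (x, t)) + snd (DF (x, t)) = 0" using elim(2) by (simp add: bvec_def inner_prod_def)
      then show ?case by linarith
    qed
    from integral_cong_AE_lebesgue_on(1)[OF unit_cell_props(2) this]
    have "?K t = (LINT x|cellM. weak_div per (\<lambda>y. u y t) x * F (x, t))" using i1 ibp by simp
    also have "\<dots> \<le> (LINT x|cellM. C * speed t * F (x, t))"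
    proof (rule integral_mono_AE[OF i2])
      show "integrable cellM (\<lambda>x. C * speed t * F (x, t))" using Fi[OF t] by simp
      show "AE x in cellM. weak_div per (\<lambda>y. u y t) x * F (x, t) \<le> C * speed t * F (x, t)"
        using bspec[OF C(3) t] by eventually_elim (use F0 in \<open>auto intro!: mult_right_mono\<close>)
    qed
    also have "\<dots> = C * speed t * e t" by (simp add: e_def)
    finally show ?case .
  qed
  have spL2: "(\<lambda>t. C * speed t) \<in> L2 {0..1}" by (intro L2_scale speed_L2)
  have eL2: "e \<in> L2 {0..1}" using ec by (rule L2_continuous_compact[OF compact_Icc])
  define Kc where "Kc = L2_inner {0..1} (\<lambda>t. C * speed t) (\<lambda>t. C * speed t)"
  have Kc0: "0 \<le> Kc" unfolding Kc_def L2_inner_def by simp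
  have L2sub: "h \<in> L2 {0..s}" if "h \<in> L2 {0..1}" "s \<in> {0..1}" for h :: "real \<Rightarrow> real" and s
  proof -
    have "integrable (lebesgue_on {0..s}) h"
      by (rule integrable_lebesgue_on_subset[OF L2_integrable_compact[OF compact_Icc that(1)]]) (use that in auto)
    moreover have "integrable (lebesgue_on {0..1}) (\<lambda>z. (h z)\<^sup>2)" using that(1) by (simp add: L2_def)
    then have "integrable (lebesgue_on {0..s}) (\<lambda>z. (h z)\<^sup>2)"
      by (rule integrable_lebesgue_on_subset) (use that in auto)
    ultimately show ?thesis using borel_measurable_integrable by (auto simp: L2_def)
  qed
  have grow: "(e s)\<^sup>2 \<le> Kc * (LINT t|lebesgue_on {0..s}. (e t)\<^sup>2)" if s: "s \<in> {0..1}" for s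
  proof -
    have sub: "{0..s} \<subseteq> {0..1}" using s by auto
    have "e s = (LINT t|lebesgue_on {0..s}. ?K t)"
    proof -
      have "(LINT x|cellM. F (x, 0)) = (LINT x|cellM. 0)"
        using init by (intro Bochner_Integration.integral_cong) (auto simp: space_restrict_space F_def)
      then show ?thesis using spacetime_fundamental_theorem[OF F, of s] s by (simp add: e_def)
    qed
    also have "\<dots> \<le> (LINT t|lebesgue_on {0..s}. C * speed t * e t)"
    proof (rule integral_mono_AE)
      show "integrable (lebesgue_on {0..s}) ?K"
        by (rule integrable_lebesgue_on_subset[OF FK(2)]) (use sub in auto)
      show "integrable (lebesgue_on {0..s}) (\<lambda>t. C * speed t * e t)"
        by (rule L2_mult_integrable[OF L2sub[OF spL2 s] L2sub[OF eL2 s]])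
      show "AE t in lebesgue_on {0..s}. ?K t \<le> C * speed t * e t"
        by (rule AE_lebesgue_on_subset[OF Kb]) (use sub in auto)
    qed
    also have "\<dots> = L2_inner {0..s} (\<lambda>t. C * speed t) e" by (simp add: L2_inner_def)
    finally have "(e s)\<^sup>2 \<le> (L2_inner {0..s} (\<lambda>t. C * speed t) e)\<^sup>2" using e0[of s] by (intro power_mono)
    also have "\<dots> \<le> L2_inner {0..s} (\<lambda>t. C * speed t) (\<lambda>t. C * speed t) * L2_inner {0..s} e e"
      by (rule L2_inner_CS[OF L2sub[OF spL2 s] L2sub[OF eL2 s]])
    also have "\<dots> \<le> Kc * L2_inner {0..s} e e"
    proof (rule mult_right_mono)
      show "L2_inner {0..s} (\<lambda>t. C * speed t) (\<lambda>t. C * speed t) \<le> Kc"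
        unfolding Kc_def L2_inner_def by (rule integral_subset_le[OF L2_mult_integrable[OF spL2 spL2]]) (use sub in auto)
    qed (simp add: L2_inner_def)
    finally show ?thesis by (simp add: L2_inner_def power2_eq_square)
  qed
  have es: "e s = 0" if s: "s \<in> {0..1}" for s
    using gronwall_zero[of "\<lambda>s. (e s)\<^sup>2" Kc s] ec Kc0 grow s by (auto intro: continuous_intros)
  have zt: "snd z \<in> {0..1}" "fst z \<in> unit_cell" using z by (auto simp: Omega_def)
  have "AE x in cellM. F (x, snd z) = 0"
    using es[OF zt(1)] integral_nonneg_eq_0_iff_AE[OF Fi[OF zt(1)]] F0 by (simp add: e_def)
  then have "AE x in cellM. norm (F (x, snd z)) \<le> 0" by eventually_elim simp
  from AE_bound_imp_bound_cell[OF slice_integrable(1)[OF Fc zt(1)] this zt(2)]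
  have "F z = 0" by simp
  then show ?thesis by (simp add: F_def)
qed

end

section \<open>Piecewise affine functions on a mesh\<close>

text \<open>Along a segment this is the one-dimensional statement \<open>lipschitz_on_closed_Union\<close>.\<close>

lemma lipschitz_on_convex_finite_cover:
  fixes f :: "'a::real_normed_vector \<Rightarrow> real"
  assumes S: "convex S" and L: "0 \<le> L"
    and cover: "\<And>x y. x \<in> S \<Longrightarrow> y \<in> S \<Longrightarrow> \<exists>C. finite C \<and> (\<forall>U\<in>C. closed U \<and> L-lipschitz_on (U \<inter> S) f) \<and> closed_segment x y \<subseteq> \<Union>C"
  shows "L-lipschitz_on S f"
proof (rule lipschitz_onI[OF _ L])
  fix x y assume xy: "x \<in> S" "y \<in> S"
  obtain C where C: "finite C" "\<And>U. U \<in> C \<Longrightarrow> closed U" "\<And>U. U \<in> C \<Longrightarrow> L-lipschitz_on (U \<inter> S) f" "closed_segment x y \<subseteq> \<Union>C"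
    using cover[OF xy] by blast
  define p where "p = (\<lambda>s::real. (1 - s) *\<^sub>R x + s *\<^sub>R y)"
  have pS: "p s \<in> S" "p s \<in> closed_segment x y" if "s \<in> {0..1}" for s
    using that xy S unfolding p_def convex_alt closed_segment_def by auto
  have pd: "dist (p s) (p t) = dist x y * \<bar>s - t\<bar>" for s t
  proof -
    have "p s - p t = (s - t) *\<^sub>R (y - x)" by (simp add: p_def algebra_simps)
    then show ?thesis by (simp add: dist_norm norm_minus_commute)
  qed
  have "(L * dist x y)-lipschitz_on {0..1} (\<lambda>s. f (p s))"
  proof (rule lipschitz_on_closed_Union[where U = "\<lambda>U. {0..1} \<inter> p -` U" and I = C])
    fix U assume U: "U \<in> C"
    show "(L * dist x y)-lipschitz_on ({0..1} \<inter> p -` U) (\<lambda>s. f (p s))"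
    proof (rule lipschitz_onI)
      fix s t assume "s \<in> {0..1} \<inter> p -` U" "t \<in> {0..1} \<inter> p -` U"
      then have "p s \<in> U \<inter> S" "p t \<in> U \<inter> S" using pS by auto
      from lipschitz_onD[OF C(3)[OF U] this] show "dist (f (p s)) (f (p t)) \<le> L * dist x y * dist s t"
        by (simp add: pd dist_real_def mult.assoc)
    qed (use L in simp)
    have "continuous_on {0..1} p" unfolding p_def by (intro continuous_intros)
    then show "closed ({0..1} \<inter> p -` U)" by (intro continuous_closed_preimage C(2) U) auto
  next
    show "{0..1} \<subseteq> (\<Union>U\<in>C. {0..1} \<inter> p -` U)" using C(4) pS(2) by blast
  qed (use C(1) L in auto)
  from lipschitz_onD[OF this, of 0 1] show "dist (f x) (f y) \<le> L * dist x y"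
    by (simp add: p_def)
qed

lemma finite_lattice_box: "finite {k \<in> lattice_vectors. \<forall>i. a \<le> k $ i \<and> k $ i \<le> (b::real)}"
proof -
  let ?Z = "{x \<in> \<int>. a \<le> x \<and> x \<le> b}"
  have "{k \<in> lattice_vectors. \<forall>i. a \<le> k $ i \<and> k $ i \<le> b} \<subseteq> (\<lambda>f. \<chi> i. f i) ` (PiE UNIV (\<lambda>_. ?Z))"
  proof
    fix k assume "k \<in> {k \<in> lattice_vectors. \<forall>i. a \<le> k $ i \<and> k $ i \<le> b}"
    then have "(\<lambda>i. k $ i) \<in> PiE UNIV (\<lambda>_. ?Z)" by (auto simp: lattice_vectors_def PiE_def)
    then have "(\<chi> i. k $ i) \<in> (\<lambda>f. \<chi> i. f i) ` (PiE UNIV (\<lambda>_. ?Z))" by (rule imageI)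
    then show "k \<in> (\<lambda>f. \<chi> i. f i) ` (PiE UNIV (\<lambda>_. ?Z))" by simp
  qed
  moreover have "finite ((\<lambda>f. \<chi> i. f i) ` (PiE UNIV (\<lambda>_. ?Z)))"
    by (intro finite_imageI finite_PiE finite_int_segment) auto
  ultimately show ?thesis by (rule finite_subset)
qed

lemma countable_lattice: "countable (lattice_vectors :: (real^'d) set)"
proof -
  have "(lattice_vectors :: (real^'d) set) \<subseteq> (\<Union>n::nat. {k \<in> lattice_vectors. \<forall>i. - real n \<le> k $ i \<and> k $ i \<le> real n})"
  proof
    fix k :: "real^'d" assume k: "k \<in> lattice_vectors"
    obtain n :: nat where n: "norm k \<le> real n" using real_arch_simple by blast
    have "- real n \<le> k $ i \<and> k $ i \<le> real n" for i
      using component_le_norm_cart[of k i] n by (simp add: abs_le_iff)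
    then show "k \<in> (\<Union>n::nat. {k \<in> lattice_vectors. \<forall>i. - real n \<le> k $ i \<and> k $ i \<le> real n})" using k by blast
  qed
  moreover have "countable (\<Union>n::nat. {k \<in> (lattice_vectors :: (real^'d) set). \<forall>i. - real n \<le> k $ i \<and> k $ i \<le> real n})"
    by (rule countable_UN) (auto intro!: countable_finite finite_lattice_box)
  ultimately show ?thesis by (rule countable_subset)
qed

lemma lattice_uminus: "k \<in> lattice_vectors \<Longrightarrow> - k \<in> lattice_vectors"
  by (simp add: lattice_vectors_def)

text \<open>The points off the faces of the mesh, where the elements of \<open>Gh\<close> are locally affine.\<close>

definition mesh_interior :: "((real^'d) \<times> real) set set \<Rightarrow> ((real^'d) \<times> real) set" where
  "mesh_interior T = (\<Union>K\<in>T. interior K)"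

text \<open>Defined through the derivative and not through the coefficients of the affine pieces, so that
  linearity in \<open>f\<close> follows from uniqueness of derivatives.\<close>

definition mesh_grad :: "((real^'d) \<times> real) set set \<Rightarrow> ((real^'d) \<times> real \<Rightarrow> real) \<Rightarrow> (real^'d) \<times> real \<Rightarrow> (real^'d) \<times> real" where
  "mesh_grad T f z = (if z \<in> mesh_interior T then THE D. GDERIV f z :> D else 0)"

lemma mesh_grad_eqI: "z \<in> mesh_interior T \<Longrightarrow> GDERIV f z :> D \<Longrightarrow> mesh_grad T f z = D"
  unfolding mesh_grad_def using GDERIV_unique by (auto intro!: the_equality)

definition cells :: "((real^'d) \<times> real) set set \<Rightarrow> ((real^'d) \<times> real) set set" where
  "cells T = {K \<in> T. K \<inter> Omega \<noteq> {}}"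

locale fe_mesh =
  fixes per :: bool and T :: "((real^'d) \<times> real) set set"
  assumes mesh: "mesh per T"
begin

lemma cell_simplex: "K \<in> T \<Longrightarrow> int DIM((real^'d) \<times> real) simplex K"
  using mesh unfolding mesh_def by blast

lemma Union_mesh: "\<Union>T = spacetime per"
  using mesh unfolding mesh_def by blast

lemma finite_cells: "finite (cells T)"
  using mesh unfolding mesh_def cells_def by blast

lemma Omega_cells: "Omega \<subseteq> \<Union>(cells T)"
  using Union_mesh Omega_subset unfolding cells_def by blast

lemma mesh_translate: "per \<Longrightarrow> K \<in> T \<Longrightarrow> k \<in> lattice_vectors \<Longrightarrow> (\<lambda>z. z + (k, 0)) ` K \<in> T"
  using mesh unfolding mesh_def by blast

lemma open_mesh_interior: "open (mesh_interior T)"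
  unfolding mesh_interior_def by auto

lemma mesh_interior_subset: "mesh_interior T \<subseteq> spacetime per"
  unfolding mesh_interior_def Union_mesh[symmetric] using interior_subset by blast

lemma mesh_interior_translate:
  assumes per and z: "z \<in> mesh_interior T" and k: "k \<in> lattice_vectors"
  shows "z + (k, 0) \<in> mesh_interior T"
proof -
  obtain K where K: "K \<in> T" "z \<in> interior K" using z by (auto simp: mesh_interior_def)
  have "(\<lambda>z. z + (k, 0)) ` interior K \<subseteq> interior ((\<lambda>z. z + (k, 0)) ` K)"
    using interior_subset by (intro interior_maximal image_mono open_translation[of "interior K" "(k, 0)", simplified add.commute[of "(k, 0)"]]) auto
  then show ?thesis using K mesh_translate[OF \<open>per\<close> K(1) k] by (auto simp: mesh_interior_def)
qed

lemma negligible_Omega_faces: "negligible (Omega - mesh_interior T)"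
proof -
  have "Omega - mesh_interior T \<subseteq> \<Union>(frontier ` cells T)"
  proof
    fix z assume z: "z \<in> Omega - mesh_interior T"
    then obtain K where K: "K \<in> cells T" "z \<in> K" using Omega_cells by blast
    then have "z \<notin> interior K" using z by (auto simp: cells_def mesh_interior_def)
    then have "z \<in> frontier K" using K(2) closure_subset by (auto simp: frontier_def)
    then show "z \<in> \<Union>(frontier ` cells T)" using K by blast
  qed
  moreover have "negligible (\<Union>(frontier ` cells T))"
    using finite_cells cell_simplex convex_simplex negligible_convex_frontier
    by (intro negligible_Union) (auto simp: cells_def)
  ultimately show ?thesis using negligible_subset by blast
qed

text \<open>Space-time minus the open cells is covered by countably many lattice translates of the part over the
  unit cell, which lies in finitely many boundaries of convex sets.\<close>

lemma negligible_faces: "negligible (spacetime per - mesh_interior T)"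
proof (cases per)
  case False
  then show ?thesis using negligible_Omega_faces by (simp add: spacetime_def Omega_def spat_def)
next
  case True
  have "spacetime per - mesh_interior T \<subseteq> (\<Union>k\<in>lattice_vectors. (+) (k, 0) ` (Omega - mesh_interior T))"
  proof
    fix z assume z: "z \<in> spacetime per - mesh_interior T"
    obtain k where k: "k \<in> lattice_vectors" "fst z + k \<in> unit_cell" using lattice_reduce .
    have "z + (k, 0) \<in> Omega" using z k(2) by (auto simp: Omega_def spacetime_def mem_Times_iff)
    moreover have "z + (k, 0) \<notin> mesh_interior T"
    proof
      assume "z + (k, 0) \<in> mesh_interior T"
      from mesh_interior_translate[OF True this lattice_uminus[OF k(1)]] show False using z by (simp add: add.assoc zero_prod_def[symmetric])
    qed
    moreover have "z = (- k, 0) + (z + (k, 0))" by (simp add: prod_eq_iff)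
    ultimately show "z \<in> (\<Union>k\<in>lattice_vectors. (+) (k, 0) ` (Omega - mesh_interior T))"
      using lattice_uminus[OF k(1)] by blast
  qed
  moreover have "negligible (\<Union>((\<lambda>k. (+) (k, 0) ` (Omega - mesh_interior T)) ` lattice_vectors))"
    using countable_lattice negligible_Omega_faces negligible_translation
    by (intro negligible_countable_Union) auto
  ultimately show ?thesis using negligible_subset by blast
qed

lemma Gh_affine: "f \<in> Gh per T \<Longrightarrow> K \<in> T \<Longrightarrow> \<exists>a c. \<forall>z\<in>K. f z = a \<bullet> z + c"
  by (simp add: Gh_def)

lemma affine_on_cell_GDERIV:
  assumes ac: "\<And>z. z \<in> K \<Longrightarrow> f z = a \<bullet> z + c" and z: "z \<in> interior K"
  shows "GDERIV f z :> a"
proof -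
  have "((\<lambda>z. a \<bullet> z) has_derivative (\<lambda>h. a \<bullet> h)) (at z)"
    by (intro bounded_linear_imp_has_derivative bounded_linear_inner_right)
  from has_derivative_add[OF this has_derivative_const, of c]
  have "((\<lambda>z. a \<bullet> z + c) has_derivative (\<lambda>h. a \<bullet> h)) (at z)" by simp
  then have "(f has_derivative (\<lambda>h. a \<bullet> h)) (at z)"
  proof (rule has_derivative_transform_within_open[OF _ open_interior z])
    fix x assume "x \<in> interior K"
    then have "x \<in> K" using interior_subset by blast
    then show "a \<bullet> x + c = f x" by (simp add: ac)
  qed
  moreover have "(\<lambda>h. a \<bullet> h) = (\<lambda>h. h \<bullet> a)" by (simp only: inner_commute)
  ultimately show ?thesis by (simp add: gderiv_def)
qed

lemma mesh_grad_constant: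
  assumes f: "f \<in> Gh per T" and K: "K \<in> T"
  shows "\<exists>a. \<forall>z\<in>interior K. GDERIV f z :> a \<and> mesh_grad T f z = a"
proof -
  obtain a c where "\<forall>z\<in>K. f z = a \<bullet> z + c" using Gh_affine[OF f K] by (elim exE)
  note ac = bspec[OF this]
  have "GDERIV f z :> a \<and> mesh_grad T f z = a" if z: "z \<in> interior K" for z
  proof
    show D: "GDERIV f z :> a" using ac z by (rule affine_on_cell_GDERIV)
    have "z \<in> mesh_interior T" using z K by (auto simp: mesh_interior_def)
    then show "mesh_grad T f z = a" using D by (rule mesh_grad_eqI)
  qed
  then show ?thesis by blast
qed

lemma Gh_GDERIV:
  assumes f: "f \<in> Gh per T" and z: "z \<in> mesh_interior T"
  shows "GDERIV f z :> mesh_grad T f z"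
proof -
  obtain K where K: "K \<in> T" "z \<in> interior K" using z by (auto simp: mesh_interior_def)
  from mesh_grad_constant[OF f K(1)] K(2) show ?thesis by metis
qed

lemma Gh_periodic: "f \<in> Gh per T \<Longrightarrow> spatially_periodic per f"
  by (simp add: Gh_def spatially_periodic_def)

lemma Gh_lipschitz_Omega:
  assumes f: "f \<in> Gh per T"
  shows "\<exists>L. L-lipschitz_on Omega f"
proof -
  have "\<forall>K\<in>cells T. \<exists>a c. \<forall>z\<in>K. f z = a \<bullet> z + c" using Gh_affine[OF f] by (simp add: cells_def)
  from bchoice[OF this] obtain a where "\<forall>K\<in>cells T. \<exists>c. \<forall>z\<in>K. f z = a K \<bullet> z + c" by blast
  from bchoice[OF this] obtain c where "\<forall>K\<in>cells T. \<forall>z\<in>K. f z = a K \<bullet> z + c K" by blast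
  note ac = bspec[OF bspec[OF this]]
  define L where "L = (\<Sum>K\<in>cells T. norm (a K))"
  have L0: "0 \<le> L" by (simp add: L_def sum_nonneg)
  have "L-lipschitz_on Omega f"
  proof (rule lipschitz_on_convex_finite_cover[OF _ L0])
    show "convex (Omega :: ((real^'d) \<times> real) set)" unfolding Omega_cbox by (rule convex_box)
    fix x y :: "(real^'d) \<times> real" assume "x \<in> Omega" "y \<in> Omega"
    then have "closed_segment x y \<subseteq> Omega" unfolding Omega_cbox by (intro closed_segment_subset convex_box)
    then have "closed_segment x y \<subseteq> \<Union>(cells T)" using Omega_cells by blast
    moreover have "closed K \<and> L-lipschitz_on (K \<inter> Omega) f" if K: "K \<in> cells T" for K
    proof
      show "closed K" using K cell_simplex closed_simplex by (auto simp: cells_def)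
      show "L-lipschitz_on (K \<inter> Omega) f"
      proof (rule lipschitz_onI[OF _ L0])
        fix x y assume "x \<in> K \<inter> Omega" "y \<in> K \<inter> Omega"
        then have "f x - f y = a K \<bullet> (x - y)" using ac[OF K] by (simp add: inner_diff_right)
        also have "\<bar>\<dots>\<bar> \<le> norm (a K) * norm (x - y)" by (rule Cauchy_Schwarz_ineq2)
        also have "\<dots> \<le> L * norm (x - y)"
          unfolding L_def using K finite_cells by (intro mult_right_mono member_le_sum) auto
        finally show "dist (f x) (f y) \<le> L * dist x y" by (simp add: dist_norm)
      qed
    qed
    ultimately show "\<exists>C. finite C \<and> (\<forall>U\<in>C. closed U \<and> L-lipschitz_on (U \<inter> Omega) f) \<and> closed_segment x y \<subseteq> \<Union>C"
      using finite_cells by blast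
  qed
  then show ?thesis by blast
qed

text \<open>In the periodic case a segment is covered by finitely many translates of \<open>Omega\<close>, on each of which
  \<open>f\<close> has the Lipschitz constant it has on \<open>Omega\<close>.\<close>

lemma Gh_lipschitz:
  assumes f: "f \<in> Gh per T"
  shows "\<exists>L. L-lipschitz_on (spacetime per) f"
proof -
  obtain L where L: "L-lipschitz_on Omega f" using Gh_lipschitz_Omega[OF f] by blast
  show ?thesis
  proof (cases per)
    case False
    then show ?thesis using L by (auto simp: spacetime_def Omega_def spat_def)
  next
    case True
    have per: "f (x + k, t) = f (x, t)" if "t \<in> {0..1}" "k \<in> lattice_vectors" for x k t
      using f that True by (auto simp: Gh_def periodic_def)
    have "L-lipschitz_on (spacetime per) f"
    proof (rule lipschitz_on_convex_finite_cover[OF convex_spacetime lipschitz_on_nonneg[OF L]])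
      fix x y :: "(real^'d) \<times> real" assume xy: "x \<in> spacetime per" "y \<in> spacetime per"
      have seg: "closed_segment x y \<subseteq> spacetime per" using xy convex_spacetime by (rule closed_segment_subset)
      have "bounded (closed_segment x y)" by (rule bounded_closed_segment)
      then obtain R where R: "\<And>z. z \<in> closed_segment x y \<Longrightarrow> norm z \<le> R" by (auto simp: bounded_iff)
      define I where "I = {k \<in> (lattice_vectors :: (real^'d) set). \<forall>i. - (R + 1) \<le> k $ i \<and> k $ i \<le> R + 1}"
      define C where "C = (\<lambda>k. (+) (k, 0) ` (Omega :: ((real^'d) \<times> real) set)) ` I"
      have "finite C" unfolding C_def I_def by (intro finite_imageI finite_lattice_box)
      moreover have "closed U \<and> L-lipschitz_on (U \<inter> spacetime per) f" if "U \<in> C" for U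
      proof -
        obtain k where k: "k \<in> lattice_vectors" "U = (+) (k, 0) ` Omega" using \<open>U \<in> C\<close> by (auto simp: C_def I_def)
        have "closed U" unfolding k(2) by (intro closed_translation compact_imp_closed Omega_props)
        moreover have "L-lipschitz_on (U \<inter> spacetime per) f"
        proof (rule lipschitz_onI[OF _ lipschitz_on_nonneg[OF L]])
          fix p q assume "p \<in> U \<inter> spacetime per" "q \<in> U \<inter> spacetime per"
          then have "p \<in> (+) (k, 0) ` Omega" "q \<in> (+) (k, 0) ` Omega" unfolding k(2) by simp_all
          then obtain p' q' where pq: "p' \<in> Omega" "q' \<in> Omega" "p = (k, 0) + p'" "q = (k, 0) + q'" by (elim imageE)
          have shift: "f ((k, 0) + w) = f w" if w: "w \<in> Omega" for w
            using per[OF _ k(1), of "snd w" "fst w"] w by (simp add: Omega_def mem_Times_iff add.commute[of k] prod.collapse plus_prod_def)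
          have "f p = f p'" "f q = f q'"
            unfolding pq(3,4) by (rule shift[OF pq(1)], rule shift[OF pq(2)])
          then show "dist (f p) (f q) \<le> L * dist p q"
            using lipschitz_onD[OF L pq(1,2)] pq(3,4) by (simp add: dist_norm)
        qed
        ultimately show ?thesis by blast
      qed
      moreover have "closed_segment x y \<subseteq> \<Union>C"
      proof
        fix z assume z: "z \<in> closed_segment x y"
        obtain k where k: "k \<in> lattice_vectors" "fst z + k \<in> unit_cell" using lattice_reduce .
        have "z \<in> spacetime per" using seg z by (rule subsetD)
        then have zO: "z + (k, 0) \<in> Omega"
          using k(2) by (simp add: Omega_def spacetime_def mem_Times_iff)
        have "- k \<in> I"
        proof -
          have "\<bar>fst z $ i\<bar> \<le> R" for i
            using component_le_norm_cart[of "fst z" i] norm_fst_le[of "fst z" "snd z"] R[OF z] by simp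
          then have c: "\<bar>fst z $ i\<bar> \<le> R \<and> 0 \<le> fst z $ i + k $ i \<and> fst z $ i + k $ i \<le> 1" for i
            using k(2) by (simp add: unit_cell_def mem_box_cart)
          have "- (R + 1) \<le> (- k) $ i \<and> (- k) $ i \<le> R + 1" for i
            using c[of i] unfolding vector_uminus_component abs_le_iff by linarith
          then show ?thesis using lattice_uminus[OF k(1)] by (simp add: I_def)
        qed
        moreover have "z = (- k, 0) + (z + (k, 0))" by (simp add: prod_eq_iff)
        ultimately show "z \<in> \<Union>C" using zO unfolding C_def by blast
      qed
      ultimately show "\<exists>C. finite C \<and> (\<forall>U\<in>C. closed U \<and> L-lipschitz_on (U \<inter> spacetime per) f) \<and> closed_segment x y \<subseteq> \<Union>C"
        by blast
    qed
    then show ?thesis by blast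
  qed
qed

lemma Gh_ae_C1:
  assumes f: "f \<in> Gh per T"
  shows "ae_C1 (spacetime per) f (mesh_interior T) (mesh_grad T f)"
  unfolding ae_C1_def
proof (intro conjI ballI allI impI)
  show "continuous_on (mesh_interior T) (mesh_grad T f)"
    unfolding mesh_interior_def
  proof (rule continuous_on_open_UN)
    fix K assume "K \<in> T"
    from mesh_grad_constant[OF f this] obtain a where "\<And>z. z \<in> interior K \<Longrightarrow> mesh_grad T f z = a" by blast
    then show "continuous_on (interior K) (mesh_grad T f)"
      by (intro continuous_on_eq[OF continuous_on_const]) simp
  qed simp
qed (use Gh_lipschitz[OF f] open_mesh_interior mesh_interior_subset negligible_faces Gh_GDERIV[OF f] in \<open>auto simp: mesh_grad_def\<close>)

lemma Gh_add:
  assumes "f \<in> Gh per T" "g \<in> Gh per T"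
  shows "(\<lambda>z. f z + g z) \<in> Gh per T"
proof -
  have "\<exists>a c. \<forall>z\<in>K. f z + g z = a \<bullet> z + c" if K: "K \<in> T" for K
  proof -
    obtain a c where 1: "\<forall>z\<in>K. f z = a \<bullet> z + c" using Gh_affine[OF assms(1) K] by (elim exE)
    obtain b e where 2: "\<forall>z\<in>K. g z = b \<bullet> z + e" using Gh_affine[OF assms(2) K] by (elim exE)
    from 1 2 show ?thesis by (intro exI[of _ "a + b"] exI[of _ "c + e"]) (simp add: inner_add_left)
  qed
  then show ?thesis using assms unfolding Gh_def by (auto intro!: continuous_on_add simp: periodic_def)
qed

lemma Gh_scale:
  assumes "f \<in> Gh per T"
  shows "(\<lambda>z. r * f z) \<in> Gh per T"
proof -
  have "\<exists>a c. \<forall>z\<in>K. r * f z = a \<bullet> z + c" if K: "K \<in> T" for K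
  proof -
    obtain a c where "\<forall>z\<in>K. f z = a \<bullet> z + c" using Gh_affine[OF assms K] by (elim exE)
    then show ?thesis by (intro exI[of _ "r *\<^sub>R a"] exI[of _ "r * c"]) (auto simp: distrib_left)
  qed
  then show ?thesis using assms unfolding Gh_def by (auto intro!: continuous_on_mult continuous_on_const simp: periodic_def)
qed

lemma mesh_grad_add:
  assumes "f \<in> Gh per T" "g \<in> Gh per T"
  shows "mesh_grad T (\<lambda>z. f z + g z) z = mesh_grad T f z + mesh_grad T g z"
proof (cases "z \<in> mesh_interior T")
  case True
  show ?thesis by (rule mesh_grad_eqI[OF True]) (intro GDERIV_add Gh_GDERIV assms True)
qed (simp add: mesh_grad_def)

lemma mesh_grad_scale:
  assumes "f \<in> Gh per T"
  shows "mesh_grad T (\<lambda>z. r * f z) z = r *\<^sub>R mesh_grad T f z"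
proof (cases "z \<in> mesh_interior T")
  case True
  show ?thesis
  proof (rule mesh_grad_eqI[OF True])
    from GDERIV_mult[OF GDERIV_const Gh_GDERIV[OF assms True], of r]
    show "GDERIV (\<lambda>z. r * f z) z :> r *\<^sub>R mesh_grad T f z" by simp
  qed
qed (simp add: mesh_grad_def)

lemma Gh_continuous_Omega: "f \<in> Gh per T \<Longrightarrow> continuous_on Omega f"
  by (rule continuous_on_subset[OF _ Omega_subset[of per]]) (simp add: Gh_def)

lemma Gh_zero_Omega_imp_zero:
  assumes f: "f \<in> Gh per T" and z: "z \<in> spacetime per" and 0: "\<And>z. z \<in> Omega \<Longrightarrow> f z = 0"
  shows "f z = 0"
  using spacetime_reduce[OF z, of f] Gh_periodic[OF f] 0 unfolding spatially_periodic_def by metis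

text \<open>This is the finite dimensionality of \<open>Gh\<close> in the form in which the linear algebra uses it: an affine
  function that vanishes at the vertices of a simplex vanishes on the simplex.\<close>

lemma Gh_determined_by_vertices:
  "\<exists>P. finite P \<and> (\<forall>f\<in>Gh per T. (\<forall>p\<in>P. f p = 0) \<longrightarrow> (\<forall>z\<in>Omega. f z = 0))"
proof -
  have "\<forall>K\<in>cells T. \<exists>C. finite C \<and> K = convex hull C"
    using cell_simplex aff_independent_finite unfolding cells_def simplex_def by blast
  then obtain C where C: "\<And>K. K \<in> cells T \<Longrightarrow> finite (C K)" "\<And>K. K \<in> cells T \<Longrightarrow> K = convex hull (C K)" by metis
  have "f z = 0" if f: "f \<in> Gh per T" and 0: "\<And>p. p \<in> (\<Union>K\<in>cells T. C K) \<Longrightarrow> f p = 0" and z: "z \<in> Omega" for f z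
  proof -
    obtain K where K: "K \<in> cells T" "z \<in> K" using z Omega_cells by blast
    then have "K \<in> T" by (simp add: cells_def)
    from Gh_affine[OF f this] obtain a c where "\<forall>z\<in>K. f z = a \<bullet> z + c" by (elim exE)
    note ac = bspec[OF this]
    have "convex {z. a \<bullet> z = - c}" by (rule convex_hyperplane)
    moreover have "C K \<subseteq> {z. a \<bullet> z = - c}"
    proof
      fix p assume p: "p \<in> C K"
      have "C K \<subseteq> K" using C(2)[OF K(1)] hull_subset by metis
      then have "p \<in> K" using p by blast
      from ac[OF this] 0[of p] p K(1) have "a \<bullet> p + c = 0" by auto
      then show "p \<in> {z. a \<bullet> z = - c}" by simp
    qed
    ultimately have "convex hull (C K) \<subseteq> {z. a \<bullet> z = - c}" by (rule hull_minimal[rotated])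
    then have "a \<bullet> z = - c" using K C(2)[OF K(1)] by blast
    then show ?thesis using ac[OF K(2)] by simp
  qed
  note zero = this
  show ?thesis
  proof (intro exI[of _ "\<Union>K\<in>cells T. C K"] conjI ballI impI)
    show "finite (\<Union>K\<in>cells T. C K)" using finite_cells C(1) by blast
    fix f and z :: "(real^'d) \<times> real"
    assume "f \<in> Gh per T" "\<forall>p\<in>(\<Union>K\<in>cells T. C K). f p = 0" "z \<in> Omega"
    then show "f z = 0" using zero[of f z] by blast
  qed
qed

end

section \<open>Semidefinite forms on functions determined by finitely many values\<close>

definition fun_subspace :: "('z \<Rightarrow> real) set \<Rightarrow> bool" where
  "fun_subspace U \<longleftrightarrow> (\<lambda>z. 0) \<in> U \<and> (\<forall>f\<in>U. \<forall>g\<in>U. (\<lambda>z. f z + g z) \<in> U) \<and> (\<forall>c. \<forall>f\<in>U. (\<lambda>z. c * f z) \<in> U)"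

text \<open>Symmetric, bilinear and positive semidefinite on the function space \<open>U\<close>.  Semidefiniteness is what
  is available: finite element functions are arbitrary outside space-time.\<close>

definition psd_form :: "('z \<Rightarrow> real) set \<Rightarrow> (('z \<Rightarrow> real) \<Rightarrow> ('z \<Rightarrow> real) \<Rightarrow> real) \<Rightarrow> bool" where
  "psd_form U p \<longleftrightarrow> (\<forall>f\<in>U. \<forall>g\<in>U. p f g = p g f) \<and>
     (\<forall>f\<in>U. \<forall>g\<in>U. \<forall>h\<in>U. p (\<lambda>z. f z + g z) h = p f h + p g h) \<and>
     (\<forall>c. \<forall>f\<in>U. \<forall>h\<in>U. p (\<lambda>z. c * f z) h = c * p f h) \<and> (\<forall>f\<in>U. 0 \<le> p f f)"

lemma psd_form_subset: "psd_form U p \<Longrightarrow> U' \<subseteq> U \<Longrightarrow> psd_form U' p"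
  unfolding psd_form_def by (meson subsetD)

lemma psd_form_rules:
  assumes "psd_form U p" "f \<in> U" "g \<in> U" "h \<in> U"
  shows "p f g = p g f" "p (\<lambda>z. f z + g z) h = p f h + p g h" "p (\<lambda>z. c * f z) h = c * p f h" "0 \<le> p f f"
  using assms unfolding psd_form_def by auto

lemma fun_subspace_add_scale:
  assumes "fun_subspace U" "f \<in> U" "g \<in> U"
  shows "(\<lambda>z. f z + g z) \<in> U" "(\<lambda>z. c * f z) \<in> U"
  using assms unfolding fun_subspace_def by auto

lemma fun_subspace_lin:
  assumes "fun_subspace U" "f \<in> U" "g \<in> U"
  shows "(\<lambda>z. f z + c * g z) \<in> U"
  by (rule fun_subspace_add_scale(1)[OF assms(1,2) fun_subspace_add_scale(2)[OF assms(1,3,3)]])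

lemma psd_form_lin:
  assumes U: "fun_subspace U" and p: "psd_form U p" and "f \<in> U" "g \<in> U" "h \<in> U"
  shows "p (\<lambda>z. f z + c * g z) h = p f h + c * p g h"
proof -
  have "(\<lambda>z. c * g z) \<in> U" by (rule fun_subspace_add_scale(2)[OF U assms(4,4)])
  then show ?thesis
    using psd_form_rules(2)[OF p assms(3) _ assms(5), of "\<lambda>z. c * g z"] psd_form_rules(3)[OF p assms(4,4,5)] by simp
qed

lemma psd_form_square:
  assumes U: "fun_subspace U" and p: "psd_form U p" and f: "f \<in> U" and g: "g \<in> U"
  shows "p (\<lambda>z. f z + c * g z) (\<lambda>z. f z + c * g z) = p f f + 2 * c * p f g + c\<^sup>2 * p g g"
proof -
  let ?h = "\<lambda>z. f z + c * g z"
  have h: "?h \<in> U" by (rule fun_subspace_lin[OF U f g])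
  have "p ?h ?h = p f ?h + c * p g ?h" by (rule psd_form_lin[OF U p f g h])
  also have "p f ?h = p ?h f" by (rule psd_form_rules(1)[OF p f h f])
  also have "p g ?h = p ?h g" by (rule psd_form_rules(1)[OF p g h f])
  also have "p ?h f = p f f + c * p g f" by (rule psd_form_lin[OF U p f g f])
  also have "p ?h g = p f g + c * p g g" by (rule psd_form_lin[OF U p f g g])
  finally show ?thesis using psd_form_rules(1)[OF p g f f] by (simp add: algebra_simps power2_eq_square)
qed

lemma psd_form_CS:
  assumes U: "fun_subspace U" and p: "psd_form U p" and f: "f \<in> U" and g: "g \<in> U"
  shows "(p f g)\<^sup>2 \<le> p f f * p g g"
proof (rule psd_discriminant)
  show "0 \<le> p f f + 2 * t * p f g + t\<^sup>2 * p g g" for t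
    unfolding psd_form_square[OF U p f g, symmetric]
    using psd_form_rules(4)[OF p fun_subspace_lin[OF U f g]] f by blast
  show "0 \<le> p g g" by (rule psd_form_rules(4)[OF p g g g])
qed

lemma psd_form_null:
  assumes "fun_subspace U" "psd_form U p" "f \<in> U" "g \<in> U" "p f f = 0"
  shows "p g f = 0"
  using psd_form_CS[OF assms(1,2,4,3)] assms(5) by simp

lemma fun_subspace_vanishing:
  assumes "fun_subspace U"
  shows "fun_subspace {f \<in> U. f x = 0}"
  using assms unfolding fun_subspace_def by auto

text \<open>Induction on the evaluation points \<open>P\<close>: the functions in \<open>M\<close> that vanish at a further point have
  codimension at most one, and a Gram-Schmidt step adds the missing direction.  If that direction is a null
  vector of the form, it is orthogonal to everything and can be ignored.\<close>

lemma orthogonal_projection_exists: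
  assumes U: "fun_subspace U" and p: "psd_form U p"
  shows "finite P \<Longrightarrow> fun_subspace M \<Longrightarrow> M \<subseteq> U \<Longrightarrow> \<forall>f\<in>M. (\<forall>x\<in>P. f x = 0) \<longrightarrow> p f f = 0 \<Longrightarrow> g \<in> U \<Longrightarrow>
    \<exists>s\<in>M. \<forall>f\<in>M. p (\<lambda>z. g z - s z) f = 0"
proof (induction P arbitrary: M g rule: finite_induct)
  case (empty M g)
  have "p g f = 0" if "f \<in> M" for f
    using psd_form_null[OF U p _ empty(4), of f] empty that by auto
  then show ?case using empty(1) by (intro bexI[of _ "\<lambda>z. 0"]) (auto simp: fun_subspace_def)
next
  case (insert x P M g)
  let ?M = "{f \<in> M. f x = 0}"
  have sM: "fun_subspace ?M" by (rule fun_subspace_vanishing[OF insert(4)])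
  have MU: "?M \<subseteq> U" using insert(5) by blast
  have null: "\<forall>f\<in>?M. (\<forall>x\<in>P. f x = 0) \<longrightarrow> p f f = 0" using insert(6) by auto
  note IH = insert.IH[OF sM MU null]
  show ?case
  proof (cases "?M = M")
    case True
    then show ?thesis using IH[OF insert(7)] by simp
  next
    case False
    then obtain b0 where b0: "b0 \<in> M" "b0 x \<noteq> 0" by blast
    obtain s2 where s2: "s2 \<in> ?M" "\<forall>f\<in>?M. p (\<lambda>z. b0 z - s2 z) f = 0" using IH[of b0] b0(1) insert(5) by blast
    obtain s1 where s1: "s1 \<in> ?M" "\<forall>f\<in>?M. p (\<lambda>z. g z - s1 z) f = 0" using IH[OF insert(7)] by blast
    define b where "b = (\<lambda>z. b0 z - s2 z)"
    define d where "d = (\<lambda>z. g z - s1 z)"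
    have bM: "b \<in> M" using fun_subspace_lin[OF insert(4) b0(1), of s2 "-1"] s2(1) by (simp add: b_def)
    have bx: "b x \<noteq> 0" using b0 s2(1) by (simp add: b_def)
    have bU: "b \<in> U" using bM insert(5) by blast
    have dU: "d \<in> U" using fun_subspace_lin[OF U insert(7), of s1 "-1"] s1(1) MU by (auto simp: d_def)
    define c where "c = p d b / p b b"
    define s where "s = (\<lambda>z. s1 z + c * b z)"
    have sM': "s \<in> M" unfolding s_def using s1(1) bM by (intro fun_subspace_lin[OF insert(4)]) auto
    have gs: "(\<lambda>z. g z - s z) = (\<lambda>z. d z + (- c) * b z)" by (auto simp: s_def d_def fun_eq_iff)
    have gsU: "(\<lambda>z. g z - s z) \<in> U" unfolding gs by (rule fun_subspace_lin[OF U dU bU])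
    have ob: "p (\<lambda>z. g z - s z) b = 0"
    proof -
      have "p (\<lambda>z. g z - s z) b = p d b + (- c) * p b b" unfolding gs by (rule psd_form_lin[OF U p dU bU bU])
      also have "\<dots> = 0"
        using psd_form_null[OF U p bU dU] by (cases "p b b = 0") (auto simp: c_def)
      finally show ?thesis .
    qed
    have o: "p (\<lambda>z. g z - s z) f = 0" if f: "f \<in> ?M" for f
    proof -
      have fU: "f \<in> U" using f MU by blast
      have "p (\<lambda>z. g z - s z) f = p d f + (- c) * p b f" unfolding gs by (rule psd_form_lin[OF U p dU bU fU])
      then show ?thesis using s1(2) s2(2) f by (simp add: b_def d_def)
    qed
    have "p (\<lambda>z. g z - s z) f = 0" if f: "f \<in> M" for f
    proof -
      define r where "r = f x / b x"
      define f' where "f' = (\<lambda>z. f z + (- r) * b z)"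
      have "f' \<in> M" unfolding f'_def by (rule fun_subspace_lin[OF insert(4) f bM])
      moreover have "f' x = 0" using bx by (simp add: f'_def r_def)
      ultimately have f': "f' \<in> ?M" by blast
      then have f'U: "f' \<in> U" using MU by blast
      have "f = (\<lambda>z. f' z + r * b z)" by (auto simp: f'_def fun_eq_iff)
      then have "p f (\<lambda>z. g z - s z) = p f' (\<lambda>z. g z - s z) + r * p b (\<lambda>z. g z - s z)"
        using psd_form_lin[OF U p f'U bU gsU, of r] by simp
      then show ?thesis
        using o[OF f'] ob psd_form_rules(1)[OF p gsU f'U f'U] psd_form_rules(1)[OF p gsU bU bU]
          psd_form_rules(1)[OF p gsU _ bU, of f] f insert(5) by auto
    qed
    then show ?thesis using sM' by blast
  qed
qed

text \<open>By the same induction: \<open>f = f' + r b\<close> with \<open>f'\<close> vanishing at the point \<open>x\<close> and \<open>b\<close> \<open>p\<close>-orthogonal to all such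
  functions, so that \<open>p f f\<close> splits exactly, while \<open>q f f\<close> splits up to the factor \<open>2\<close>.\<close>

lemma psd_form_comparison:
  fixes p q :: "('z \<Rightarrow> real) \<Rightarrow> ('z \<Rightarrow> real) \<Rightarrow> real"
  shows "finite P \<Longrightarrow> fun_subspace U \<Longrightarrow> psd_form U p \<Longrightarrow> psd_form U q \<Longrightarrow>
    \<forall>f\<in>U. (\<forall>x\<in>P. f x = 0) \<longrightarrow> p f f = 0 \<Longrightarrow> \<forall>f\<in>U. p f f = 0 \<longrightarrow> q f f = 0 \<Longrightarrow>
    \<exists>C\<ge>0. \<forall>f\<in>U. q f f \<le> C * p f f"
proof (induction P arbitrary: U rule: finite_induct)
  case (empty U)
  then show ?case by (intro exI[of _ 0]) auto
next
  case (insert x P U)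
  let ?M = "{f \<in> U. f x = 0}"
  have sM: "fun_subspace ?M" by (rule fun_subspace_vanishing[OF insert(4)])
  have null: "\<forall>f\<in>?M. (\<forall>x\<in>P. f x = 0) \<longrightarrow> p f f = 0" using insert(7) by auto
  have null2: "\<forall>f\<in>?M. p f f = 0 \<longrightarrow> q f f = 0" using insert(8) by auto
  obtain C1 where C1: "0 \<le> C1" "\<And>f. f \<in> ?M \<Longrightarrow> q f f \<le> C1 * p f f"
    using insert.IH[OF sM psd_form_subset[OF insert(5)] psd_form_subset[OF insert(6)] null null2] by blast
  note U = insert(4) and p = insert(5) and q = insert(6)
  show ?case
  proof (cases "?M = U")
    case True
    then show ?thesis using C1 by blast
  next
    case False
    then obtain b0 where b0: "b0 \<in> U" "b0 x \<noteq> 0" by blast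
    obtain s where s: "s \<in> ?M" "\<forall>f\<in>?M. p (\<lambda>z. b0 z - s z) f = 0"
      using orthogonal_projection_exists[OF U p insert(1) sM _ null b0(1)] by blast
    define b where "b = (\<lambda>z. b0 z - s z)"
    have bU: "b \<in> U" using fun_subspace_lin[OF U b0(1), of s "-1"] s(1) by (simp add: b_def)
    have bx: "b x \<noteq> 0" using b0 s(1) by (simp add: b_def)
    define C2 where "C2 = q b b / p b b"
    have pb: "0 \<le> p b b" and qb: "0 \<le> q b b" using psd_form_rules(4)[OF p bU bU bU] psd_form_rules(4)[OF q bU bU bU] .
    have C2: "0 \<le> C2" "q b b = C2 * p b b"
      using insert(8) bU pb qb by (auto simp: C2_def)
    define C where "C = 2 * max C1 C2"
    have C: "0 \<le> C" "2 * C1 \<le> C" "2 * C2 \<le> C" using C1(1) by (auto simp: C_def)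
    have "q f f \<le> C * p f f" if f: "f \<in> U" for f
    proof -
      define r where "r = f x / b x"
      define f' where "f' = (\<lambda>z. f z + (- r) * b z)"
      have f'U: "f' \<in> U" unfolding f'_def by (rule fun_subspace_lin[OF U f bU])
      have f'M: "f' \<in> ?M" using f'U bx by (simp add: f'_def r_def)
      have feq: "f = (\<lambda>z. f' z + r * b z)" by (auto simp: f'_def fun_eq_iff)
      have "p b f' = 0" using s(2) f'M by (simp add: b_def)
      then have "p f' b = 0" using psd_form_rules(1)[OF p f'U bU bU] by simp
      then have pf: "p f f = p f' f' + r\<^sup>2 * p b b"
        using psd_form_square[OF U p f'U bU, of r] unfolding feq[symmetric] by simp
      have "q f f \<le> 2 * q f' f' + 2 * (r\<^sup>2 * q b b)"
      proof -
        have "0 \<le> q (\<lambda>z. f' z + (- r) * b z) (\<lambda>z. f' z + (- r) * b z)"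
          using psd_form_rules(4)[OF q fun_subspace_lin[OF U f'U bU]] f by blast
        then show ?thesis
          using psd_form_square[OF U q f'U bU, of "- r"] psd_form_square[OF U q f'U bU, of r] unfolding feq[symmetric]
          by (simp add: algebra_simps)
      qed
      also have "\<dots> \<le> (2 * C1) * p f' f' + (2 * C2) * (r\<^sup>2 * p b b)"
        using C1(2)[OF f'M] C2(2) by (simp add: mult_ac)
      also have "\<dots> \<le> C * p f' f' + C * (r\<^sup>2 * p b b)"
        using C psd_form_rules(4)[OF p f'U f'U f'U] pb by (intro add_mono mult_right_mono) auto
      finally show ?thesis unfolding pf by (simp add: distrib_left)
    qed
    then show ?thesis using C(1) by blast
  qed
qed

lemma psd_form_add:
  assumes p: "psd_form U p" and q: "psd_form U q"
  shows "psd_form U (\<lambda>f g. p f g + q f g)"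
  unfolding psd_form_def
proof (intro conjI ballI allI)
  fix f g h c assume f: "f \<in> U"
  show "0 \<le> p f f + q f f" using psd_form_rules(4)[OF p f f f] psd_form_rules(4)[OF q f f f] by simp
  assume g: "g \<in> U"
  show "p f g + q f g = p g f + q g f" using psd_form_rules(1)[OF p f g g] psd_form_rules(1)[OF q f g g] by simp
  assume h: "h \<in> U"
  show "p (\<lambda>z. f z + g z) h + q (\<lambda>z. f z + g z) h = p f h + q f h + (p g h + q g h)"
    using psd_form_rules(2)[OF p f g h] psd_form_rules(2)[OF q f g h] by simp
next
  fix c f h assume f: "f \<in> U" and h: "h \<in> U"
  show "p (\<lambda>z. c * f z) h + q (\<lambda>z. c * f z) h = c * (p f h + q f h)"
    using psd_form_rules(3)[OF p f h h] psd_form_rules(3)[OF q f h h] by (simp add: distrib_left)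
qed

section \<open>The discrete problem\<close>

lemma spacetime_test_fst_times:
  fixes \<psi> :: "real^'d \<Rightarrow> real"
  assumes \<psi>: "space_test per \<psi> D" and \<tau>: "\<And>s. (\<tau> has_real_derivative \<tau>' s) (at s)" "continuous_on UNIV \<tau>'"
  shows "\<exists>E. spacetime_test per (\<lambda>z. \<psi> (fst z) * \<tau> (snd z)) E"
proof -
  have C1: "C1_with_grad \<psi> D" using \<psi> by (simp add: space_test_def)
  have P: "if per then (\<forall>t. periodic (\<lambda>x. \<psi> (fst (x, t)) * \<tau> (snd (x, t))))
    else (\<exists>K. compact K \<and> K \<subseteq> interior unit_cell \<and> (\<forall>x t. x \<notin> K \<longrightarrow> \<psi> (fst (x, t)) * \<tau> (snd (x, t)) = 0))"
  proof (cases per)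
    case True
    then show ?thesis using \<psi> by (auto simp: space_test_def periodic_def)
  next
    case False
    then obtain K where "compact K" "K \<subseteq> interior unit_cell" "\<forall>x. x \<notin> K \<longrightarrow> \<psi> x = 0"
      using \<psi> by (auto simp: space_test_def)
    then show ?thesis using False by auto
  qed
  from C1_fst_snd[OF C1 \<tau>] P show ?thesis unfolding spacetime_test_def by blast
qed

locale transport_fe = transport per V normV u + fe_mesh per T
  for per :: bool and V :: "(real^'d \<Rightarrow> real^'d) set" and normV u
    and T :: "((real^'d) \<times> real) set set"
begin

text \<open>The classical transport derivative \<open>\<partial>\<^sub>t f + u \<cdot> \<nabla>f\<close> off the faces of the mesh.\<close>

definition mesh_transport :: "((real^'d) \<times> real \<Rightarrow> real) \<Rightarrow> (real^'d) \<times> real \<Rightarrow> real" where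
  "mesh_transport f z = bvec u z \<bullet> mesh_grad T f z"

lemma mesh_transport_L2:
  assumes "f \<in> Gh per T"
  shows "mesh_transport f \<in> L2 Omega"
proof -
  obtain L where "\<And>z. norm (mesh_grad T f z) \<le> L" using ae_C1_bounded[OF Gh_ae_C1[OF assms]] by blast
  from transport_of_gradient_L2[OF ae_C1_measurable_grad[OF Gh_ae_C1[OF assms]] this] show ?thesis
    by (simp add: mesh_transport_def[abs_def])
qed

lemma Gh_L2: "f \<in> Gh per T \<Longrightarrow> f \<in> L2 Omega"
  by (intro L2_continuous_compact Omega_props Gh_continuous_Omega)

lemma Gh_green:
  assumes "f \<in> Gh per T" "spacetime_test per \<phi> D"
  shows "adjoint_pairing per u f \<phi> D + L2_inner Omega (mesh_transport f) \<phi> =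
    L2_inner unit_cell (\<lambda>x. f (x, 1)) (\<lambda>x. \<phi> (x, 1)) - L2_inner unit_cell (\<lambda>x. f (x, 0)) (\<lambda>x. \<phi> (x, 0))"
  using green[OF Gh_ae_C1[OF assms(1)] Gh_periodic[OF assms(1)] assms(2)] by (simp add: mesh_transport_def[abs_def])

lemma Gh_has_transport_deriv:
  assumes f: "f \<in> Gh per T"
  shows "has_transport_deriv per u f (mesh_transport f)"
  unfolding has_transport_deriv_def
proof (intro conjI allI impI mesh_transport_L2[OF f])
  fix \<phi> :: "(real^'d) \<times> real \<Rightarrow> real" and D assume t: "spacetime_test0 per \<phi> D"
  then obtain J where J: "J \<subseteq> {0<..<1}" "\<forall>x t. t \<notin> J \<longrightarrow> \<phi> (x, t) = 0"
    unfolding spacetime_test0_def by blast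
  have "0 \<notin> J" "1 \<notin> J" using J(1) by auto
  then have "\<phi> (x, 0) = 0" "\<phi> (x, 1) = 0" for x using J(2) by auto
  then show "adjoint_pairing per u f \<phi> D = - L2_inner Omega (mesh_transport f) \<phi>"
    using Gh_green[OF f, of \<phi> D] t by (simp add: spacetime_test0_def L2_inner_def)
qed

lemma Gh_subset_G_space: "Gh per T \<subseteq> G_space per u"
  using Gh_has_transport_deriv Gh_L2 by (auto simp: G_space_def)

text \<open>Two weak transport derivatives of the same function have the same integrals against all tests.\<close>

lemma transport_deriv_AE:
  assumes f: "f \<in> Gh per T"
  shows "AE z in OmegaM. transport_deriv per u f z = mesh_transport f z"
proof -
  let ?w = "transport_deriv per u f"
  have w: "has_transport_deriv per u f ?w"
    unfolding transport_deriv_def by (rule someI[where P = "has_transport_deriv per u f", OF Gh_has_transport_deriv[OF f]])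
  have wL2: "?w \<in> L2 Omega" using w by (simp add: has_transport_deriv_def)
  have "AE z in OmegaM. ?w z - mesh_transport f z = 0"
  proof (rule fundamental_lemma_Omega[where per = per])
    show "integrable OmegaM (\<lambda>z. ?w z - mesh_transport f z)"
      by (intro L2_integrable_compact Omega_props L2_diff wL2 mesh_transport_L2 f)
    fix \<phi> :: "(real^'d) \<times> real \<Rightarrow> real" and D assume t: "spacetime_test0 per \<phi> D"
    have "L2_inner Omega ?w \<phi> = L2_inner Omega (mesh_transport f) \<phi>"
      using w Gh_has_transport_deriv[OF f] t unfolding has_transport_deriv_def by (metis neg_equal_iff_equal)
    moreover have "continuous_on Omega \<phi>"
      using t C1_continuous continuous_on_subset unfolding spacetime_test0_def spacetime_test_def by blast
    then have "\<phi> \<in> L2 Omega" by (intro L2_continuous_compact Omega_props)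
    ultimately show "(LINT z|OmegaM. (?w z - mesh_transport f z) * \<phi> z) = 0"
      using L2_mult_integrable[OF wL2] L2_mult_integrable[OF mesh_transport_L2[OF f]] by (simp add: L2_inner_def left_diff_distrib)
  qed
  then show ?thesis by eventually_elim simp
qed

lemma L2_inner_transport_deriv:
  assumes f: "f \<in> Gh per T"
  shows "L2_inner Omega (transport_deriv per u f) h = L2_inner Omega (mesh_transport f) h"
    and "L2_inner Omega h (transport_deriv per u f) = L2_inner Omega h (mesh_transport f)"
proof -
  have "AE z in OmegaM. transport_deriv per u f z * h z = mesh_transport f z * h z"
    "AE z in OmegaM. h z * transport_deriv per u f z = h z * mesh_transport f z"
    using transport_deriv_AE[OF f] by (auto elim: eventually_mono)
  then show "L2_inner Omega (transport_deriv per u f) h = L2_inner Omega (mesh_transport f) h"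
    "L2_inner Omega h (transport_deriv per u f) = L2_inner Omega h (mesh_transport f)"
    unfolding L2_inner_def by (blast intro: integral_cong_AE_lebesgue_on(1)[OF Omega_props(2)])+
qed

lemma Gh_face_continuous:
  assumes "f \<in> Gh per T" "t \<in> {0..1}"
  shows "continuous_on unit_cell (\<lambda>x. f (x, t))"
  by (rule slice_integrable(1)[OF Gh_continuous_Omega[OF assms(1)] assms(2)])

lemma Gh_face_zero_spat:
  assumes f: "f \<in> Gh per T" and t: "t \<in> {0..1}" and 0: "\<And>x. x \<in> unit_cell \<Longrightarrow> f (x, t) = 0" and x: "x \<in> spat per"
  shows "f (x, t) = 0"
proof (cases per)
  case False
  then show ?thesis using 0 x by (simp add: spat_def)
next
  case True
  obtain k where k: "k \<in> lattice_vectors" "x + k \<in> unit_cell" using lattice_reduce .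
  have "f (x + k, t) = f (x, t)"
    using Gh_periodic[OF f] True t k(1) by (simp add: spatially_periodic_def periodic_def)
  then show ?thesis using 0[OF k(2)] by simp
qed

text \<open>By Green's formula a zero trace means that the face values are orthogonal to the face values of all tests.
  The tests \<open>\<psi>(x) t\<close> and \<open>\<psi>(x) (1 - t)\<close> separate the two faces.\<close>

lemma Gh0_iff:
  assumes f: "f \<in> Gh per T"
  shows "f \<in> Gh0 per u T \<longleftrightarrow> (\<forall>x\<in>unit_cell. f (x, 0) = 0 \<and> f (x, 1) = 0)"
proof -
  have tr: "f \<in> Gh0 per u T \<longleftrightarrow> (\<forall>\<phi> D. spacetime_test per \<phi> D \<longrightarrow>
      L2_inner unit_cell (\<lambda>x. f (x, 1)) (\<lambda>x. \<phi> (x, 1)) - L2_inner unit_cell (\<lambda>x. f (x, 0)) (\<lambda>x. \<phi> (x, 0)) = 0)"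
  proof -
    have "(\<lambda>x. 0::real) \<in> L2 (unit_cell :: (real^'d) set)" by (rule L2_continuous_cell) simp
    moreover have "L2_inner unit_cell (\<lambda>x. 0) h = 0" for h :: "real^'d \<Rightarrow> real" by (simp add: L2_inner_def)
    ultimately have "f \<in> Gh0 per u T \<longleftrightarrow> (\<forall>\<phi> D. spacetime_test per \<phi> D \<longrightarrow>
       adjoint_pairing per u f \<phi> D + L2_inner Omega (transport_deriv per u f) \<phi> = 0)"
      using f Gh_subset_G_space by (auto simp: Gh0_def G0_space_def has_trace_def)
    then show ?thesis using Gh_green[OF f] L2_inner_transport_deriv(1)[OF f] by simp
  qed
  show ?thesis
  proof
    assume zero: "\<forall>x\<in>unit_cell. f (x, 0) = 0 \<and> f (x, 1) = 0"
    have "L2_inner unit_cell (\<lambda>x. f (x, t)) h = L2_inner unit_cell (\<lambda>x. 0) h" if "t = 0 \<or> t = 1" for t and h :: "real^'d \<Rightarrow> real"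
      unfolding L2_inner_def using zero that
      by (intro Bochner_Integration.integral_cong) (auto simp: space_restrict_space)
    then show "f \<in> Gh0 per u T" unfolding tr by (simp add: L2_inner_def)
  next
    assume "f \<in> Gh0 per u T"
    then have z: "\<And>\<phi> D. spacetime_test per \<phi> D \<Longrightarrow>
      L2_inner unit_cell (\<lambda>x. f (x, 1)) (\<lambda>x. \<phi> (x, 1)) - L2_inner unit_cell (\<lambda>x. f (x, 0)) (\<lambda>x. \<phi> (x, 0)) = 0"
      unfolding tr by blast
    have zero: "f (x, t) = 0" if x: "x \<in> unit_cell" and t: "t \<in> {0..1}"
      and test: "\<And>\<psi> D. space_test per \<psi> D \<Longrightarrow> (LINT x|cellM. f (x, t) * \<psi> x) = 0" for x t
    proof -
      have "AE x in cellM. f (x, t) = 0"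
        by (rule fundamental_lemma_cell[OF slice_integrable(2)[OF Gh_continuous_Omega[OF f] t] test])
      then have "AE x in cellM. norm (f (x, t)) \<le> 0" by eventually_elim simp
      from AE_bound_imp_bound_cell[OF Gh_face_continuous[OF f t] this x] show ?thesis by simp
    qed
    have t1: "(LINT x|cellM. f (x, 1) * \<psi> x) = 0" if "space_test per \<psi> D" for \<psi> D
    proof -
      have "\<exists>E. spacetime_test per (\<lambda>z. \<psi> (fst z) * snd z) E"
        by (rule spacetime_test_fst_times[OF that, where \<tau>' = "\<lambda>_. 1"]) (auto intro!: derivative_eq_intros)
      then show ?thesis using z by (fastforce simp: L2_inner_def)
    qed
    have t0: "(LINT x|cellM. f (x, 0) * \<psi> x) = 0" if "space_test per \<psi> D" for \<psi> D
    proof -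
      have "\<exists>E. spacetime_test per (\<lambda>z. \<psi> (fst z) * (1 - snd z)) E"
        by (rule spacetime_test_fst_times[OF that, where \<tau>' = "\<lambda>_. -1"]) (auto intro!: derivative_eq_intros)
      then show ?thesis using z by (fastforce simp: L2_inner_def)
    qed
    show "\<forall>x\<in>unit_cell. f (x, 0) = 0 \<and> f (x, 1) = 0"
      using zero[OF _ _ t0] zero[OF _ _ t1] by auto
  qed
qed

lemma Gh_subspace: "fun_subspace (Gh per T)"
proof -
  have "(\<lambda>z. 0) \<in> Gh per T"
    unfolding Gh_def periodic_def by (auto intro!: exI[of _ 0])
  then show ?thesis unfolding fun_subspace_def using Gh_add Gh_scale by blast
qed

lemma Gh0_subset: "Gh0 per u T \<subseteq> Gh per T" by (simp add: Gh0_def)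

lemma Gh0_subspace: "fun_subspace (Gh0 per u T)"
proof -
  have eq: "Gh0 per u T = {f \<in> Gh per T. \<forall>x\<in>unit_cell. f (x, 0) = 0 \<and> f (x, 1) = 0}"
    using Gh0_iff Gh0_subset by blast
  show ?thesis
    using Gh_subspace unfolding eq fun_subspace_def by simp
qed

definition transport_form :: "((real^'d) \<times> real \<Rightarrow> real) \<Rightarrow> ((real^'d) \<times> real \<Rightarrow> real) \<Rightarrow> real" where
  "transport_form f g = L2_inner Omega (mesh_transport f) (mesh_transport g)"

definition graph_form :: "((real^'d) \<times> real \<Rightarrow> real) \<Rightarrow> ((real^'d) \<times> real \<Rightarrow> real) \<Rightarrow> real" where
  "graph_form f g = L2_inner Omega f g + transport_form f g"

definition face_form :: "((real^'d) \<times> real \<Rightarrow> real) \<Rightarrow> ((real^'d) \<times> real \<Rightarrow> real) \<Rightarrow> real" where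
  "face_form f g = L2_inner unit_cell (\<lambda>x. f (x, 0)) (\<lambda>x. g (x, 0)) + L2_inner unit_cell (\<lambda>x. f (x, 1)) (\<lambda>x. g (x, 1))"

lemma mesh_transport_add: "f \<in> Gh per T \<Longrightarrow> g \<in> Gh per T \<Longrightarrow> mesh_transport (\<lambda>z. f z + g z) = (\<lambda>z. mesh_transport f z + mesh_transport g z)"
  by (auto simp: mesh_transport_def fun_eq_iff mesh_grad_add inner_add_right)

lemma mesh_transport_scale: "f \<in> Gh per T \<Longrightarrow> mesh_transport (\<lambda>z. c * f z) = (\<lambda>z. c * mesh_transport f z)"
  by (auto simp: mesh_transport_def fun_eq_iff mesh_grad_scale)

lemma transport_form_psd: "psd_form (Gh per T) transport_form"
  unfolding psd_form_def transport_form_def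
  by (auto simp: mesh_transport_add mesh_transport_scale L2_inner_add mesh_transport_L2 L2_inner_scale L2_inner_nonneg intro: L2_inner_sym)

lemma graph_form_psd: "psd_form (Gh per T) graph_form"
proof -
  have "psd_form (Gh per T) (L2_inner Omega)"
    unfolding psd_form_def
    by (auto simp: L2_inner_add Gh_L2 L2_inner_scale L2_inner_nonneg intro: L2_inner_sym)
  from psd_form_add[OF this transport_form_psd] show ?thesis by (simp add: graph_form_def[abs_def])
qed

lemma Gh_face_L2: "f \<in> Gh per T \<Longrightarrow> t \<in> {0..1} \<Longrightarrow> (\<lambda>x. f (x, t)) \<in> L2 unit_cell"
  by (intro L2_continuous_cell Gh_face_continuous)

lemma face_form_psd: "psd_form (Gh per T) face_form"
proof -
  have "psd_form (Gh per T) (\<lambda>f g. L2_inner unit_cell (\<lambda>x. f (x, t)) (\<lambda>x. g (x, t)))" if "t \<in> {0..1}" for t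
    unfolding psd_form_def using that
    by (auto simp: L2_inner_add Gh_face_L2 L2_inner_scale L2_inner_nonneg intro: L2_inner_sym)
  from psd_form_add[OF this[of 0] this[of 1]] show ?thesis by (simp add: face_form_def[abs_def])
qed

lemma mesh_transport_zero:
  assumes f: "f \<in> Gh per T" and 0: "\<And>z. z \<in> Omega \<Longrightarrow> f z = 0"
  shows "AE z in OmegaM. mesh_transport f z = 0"
proof -
  have "convex (Omega :: ((real^'d) \<times> real) set)" unfolding Omega_cbox by (rule convex_box)
  then have "negligible (frontier (Omega :: ((real^'d) \<times> real) set))" by (rule negligible_convex_frontier)
  then have 1: "AE z::(real^'d) \<times> real in lebesgue. z \<notin> frontier Omega"
    unfolding negligible_iff_null_sets by (rule AE_not_in)
  have 2: "AE z in lebesgue. z \<notin> Omega - mesh_interior T"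
    using negligible_Omega_faces unfolding negligible_iff_null_sets by (rule AE_not_in)
  have "AE z in lebesgue. z \<in> Omega \<longrightarrow> mesh_transport f z = 0"
    using 1 2
  proof eventually_elim
    case (elim z)
    show ?case
    proof
      assume z: "z \<in> Omega"
      then have zi: "z \<in> interior Omega" using elim(1) closure_subset by (auto simp: frontier_def)
      have "GDERIV f z :> 0"
        using 0 zi by (intro affine_on_cell_GDERIV[of Omega f 0 0]) auto
      moreover have "z \<in> mesh_interior T" using elim(2) z by blast
      ultimately have "mesh_grad T f z = 0" using mesh_grad_eqI by blast
      then show "mesh_transport f z = 0" by (simp add: mesh_transport_def)
    qed
  qed
  then show ?thesis using Omega_props(2) by (subst AE_restrict_space_iff) auto
qed

lemma forms_zero:
  assumes f: "f \<in> Gh per T" and 0: "\<And>z. z \<in> Omega \<Longrightarrow> f z = 0"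
  shows "transport_form f f = 0" "graph_form f f = 0" "face_form f f = 0"
proof -
  have "AE z in OmegaM. mesh_transport f z = 0" by (rule mesh_transport_zero[OF f 0])
  then have "AE z in OmegaM. mesh_transport f z * mesh_transport f z = 0" by eventually_elim simp
  then show t: "transport_form f f = 0" unfolding transport_form_def L2_inner_def by (rule integral_eq_zero_AE)
  have "L2_inner Omega f f = 0"
    unfolding L2_inner_def by (rule integral_eq_zero_AE, rule AE_I2) (use 0 in \<open>auto simp: space_restrict_space\<close>)
  then show "graph_form f f = 0" using t by (simp add: graph_form_def)
  have "L2_inner unit_cell (\<lambda>x. f (x, t)) (\<lambda>x. f (x, t)) = 0" if "t \<in> {0..1}" for t
    unfolding L2_inner_def by (rule integral_eq_zero_AE, rule AE_I2) (use 0 that in \<open>auto simp: space_restrict_space Omega_def\<close>)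
  then show "face_form f f = 0" by (simp add: face_form_def)
qed

lemma transport_form_definite:
  assumes f: "f \<in> Gh0 per u T" and a: "transport_form f f = 0" and z: "z \<in> spacetime per"
  shows "f z = 0"
proof -
  have fG: "f \<in> Gh per T" using f Gh0_subset by blast
  have "integrable OmegaM (\<lambda>z. mesh_transport f z * mesh_transport f z)" by (rule L2_mult_integrable[OF mesh_transport_L2[OF fG] mesh_transport_L2[OF fG]])
  then have "AE z in OmegaM. mesh_transport f z * mesh_transport f z = 0"
    using a integral_nonneg_eq_0_iff_AE[of OmegaM "\<lambda>z. mesh_transport f z * mesh_transport f z"] by (simp add: transport_form_def L2_inner_def)
  then have T0: "AE z in OmegaM. bvec u z \<bullet> mesh_grad T f z = 0" by eventually_elim (simp add: mesh_transport_def)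
  have init: "\<And>x. x \<in> unit_cell \<Longrightarrow> f (x, 0) = 0" using Gh0_iff[OF fG] f by blast
  have "f w = 0" if "w \<in> Omega" for w
    by (rule transport_uniqueness[OF Gh_ae_C1[OF fG] Gh_periodic[OF fG] T0 init that])
  then show ?thesis by (rule Gh_zero_Omega_imp_zero[OF fG z])
qed

lemma discrete_solution_iff:
  "discrete_solution per u T I0 I1 Ih \<longleftrightarrow> Ih \<in> Gh per T \<and> (\<forall>dI\<in>Gh0 per u T. transport_form Ih dI = 0) \<and>
    (\<forall>x\<in>spat per. Ih (x, 0) = I0 x \<and> Ih (x, 1) = I1 x)"
proof (cases "Ih \<in> Gh per T")
  case True
  have "L2_inner Omega (transport_deriv per u Ih) (transport_deriv per u dI) = transport_form Ih dI" if "dI \<in> Gh0 per u T" for dI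
    using L2_inner_transport_deriv(1)[OF True] L2_inner_transport_deriv(2)[of dI] that Gh0_subset
    by (auto simp: transport_form_def)
  then show ?thesis by (auto simp: discrete_solution_def)
qed (simp add: discrete_solution_def)

lemma Gh_diff:
  assumes "f \<in> Gh per T" "g \<in> Gh per T"
  shows "(\<lambda>z. f z - g z) \<in> Gh per T"
  using fun_subspace_lin[OF Gh_subspace assms, of "-1"] by simp

lemma transport_form_diff:
  assumes "f \<in> Gh per T" "g \<in> Gh per T" "h \<in> Gh per T"
  shows "transport_form (\<lambda>z. f z - g z) h = transport_form f h - transport_form g h"
  using psd_form_lin[OF Gh_subspace transport_form_psd assms, of "-1"] by simp

lemma solution_exists:
  assumes g: "gh \<in> Gh per T"
  shows "\<exists>Ih. discrete_solution per u T (\<lambda>x. gh (x, 0)) (\<lambda>x. gh (x, 1)) Ih"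
proof -
  obtain P where P: "finite P" "\<forall>f\<in>Gh per T. (\<forall>p\<in>P. f p = 0) \<longrightarrow> (\<forall>z\<in>Omega. f z = 0)"
    using Gh_determined_by_vertices by blast
  have "\<forall>f\<in>Gh0 per u T. (\<forall>x\<in>P. f x = 0) \<longrightarrow> transport_form f f = 0"
    using P(2) forms_zero(1) Gh0_subset by blast
  from orthogonal_projection_exists[OF Gh_subspace transport_form_psd P(1) Gh0_subspace Gh0_subset this g]
  obtain s where s: "s \<in> Gh0 per u T" "\<forall>f\<in>Gh0 per u T. transport_form (\<lambda>z. gh z - s z) f = 0" by blast
  have sG: "s \<in> Gh per T" using s(1) Gh0_subset by blast
  have s0: "\<And>x. x \<in> unit_cell \<Longrightarrow> s (x, 0) = 0" "\<And>x. x \<in> unit_cell \<Longrightarrow> s (x, 1) = 0"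
    using Gh0_iff[OF sG] s(1) by blast+
  have "s (x, 0) = 0" "s (x, 1) = 0" if "x \<in> spat per" for x
    using Gh_face_zero_spat[OF sG _ s0(1) that] Gh_face_zero_spat[OF sG _ s0(2) that] by auto
  then have "discrete_solution per u T (\<lambda>x. gh (x, 0)) (\<lambda>x. gh (x, 1)) (\<lambda>z. gh z - s z)"
    unfolding discrete_solution_iff using Gh_diff[OF g sG] s(2) by simp
  then show ?thesis by blast
qed

lemma solution_unique:
  assumes I: "discrete_solution per u T I0 I1 Ih" and J: "discrete_solution per u T I0 I1 Jh"
    and z: "z \<in> spacetime per"
  shows "Jh z = Ih z"
proof -
  have G: "Ih \<in> Gh per T" "Jh \<in> Gh per T" using I J by (simp_all add: discrete_solution_iff)
  define d where "d = (\<lambda>z. Jh z - Ih z)"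
  have dG: "d \<in> Gh per T" unfolding d_def by (rule Gh_diff[OF G(2,1)])
  have "\<forall>x\<in>unit_cell. d (x, 0) = 0 \<and> d (x, 1) = 0"
    using I J spat_superset[of per] by (auto simp: discrete_solution_iff d_def subset_iff)
  then have d0: "d \<in> Gh0 per u T" using Gh0_iff[OF dG] by blast
  have "transport_form d d = transport_form Jh d - transport_form Ih d"
    using transport_form_diff[OF G(2,1) dG] by (simp add: d_def[symmetric])
  also have "\<dots> = 0" using I J d0 by (simp add: discrete_solution_iff)
  finally have "d z = 0" using transport_form_definite[OF d0 _ z] by blast
  then show ?thesis by (simp add: d_def)
qed

text \<open>The differences of discrete solutions lie in this space; its elements are determined by their face values.\<close>

definition harmonic :: "((real^'d) \<times> real \<Rightarrow> real) set" where
  "harmonic = {f \<in> Gh per T. \<forall>g\<in>Gh0 per u T. transport_form f g = 0}"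

lemma harmonic_subspace: "fun_subspace harmonic"
proof -
  have G: "\<And>g. g \<in> Gh0 per u T \<Longrightarrow> g \<in> Gh per T" using Gh0_subset by blast
  have "transport_form (\<lambda>z. 0) g = 0" if "g \<in> Gh0 per u T" for g
    using psd_form_rules(3)[OF transport_form_psd G[OF that] G[OF that] G[OF that], of 0] by simp
  moreover have "transport_form (\<lambda>z. f z + f' z) g = 0" "transport_form (\<lambda>z. c * f z) g = 0"
    if "f \<in> harmonic" "f' \<in> harmonic" "g \<in> Gh0 per u T" for f f' g c
    using psd_form_rules(2,3)[OF transport_form_psd _ _ G[OF that(3)], of f f'] that by (simp_all add: harmonic_def)
  ultimately show ?thesis
    using Gh_subspace unfolding fun_subspace_def by (simp add: harmonic_def)
qed

lemma harmonic_zero_faces: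
  assumes f: "f \<in> harmonic" and 0: "face_form f f = 0" and z: "z \<in> Omega"
  shows "f z = 0"
proof -
  have fG: "f \<in> Gh per T" using f by (simp add: harmonic_def)
  have face: "f (x, t) = 0" if t: "t \<in> {0..1}" and i: "L2_inner unit_cell (\<lambda>x. f (x, t)) (\<lambda>x. f (x, t)) = 0" and x: "x \<in> unit_cell" for x t
  proof -
    have "integrable cellM (\<lambda>x. f (x, t) * f (x, t))" by (rule L2_mult_integrable[OF Gh_face_L2[OF fG t] Gh_face_L2[OF fG t]])
    then have "AE x in cellM. f (x, t) * f (x, t) = 0"
      using i integral_nonneg_eq_0_iff_AE[of cellM "\<lambda>x. f (x, t) * f (x, t)"] by (simp add: L2_inner_def)
    then have "AE x in cellM. norm (f (x, t)) \<le> 0" by eventually_elim simp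
    from AE_bound_imp_bound_cell[OF Gh_face_continuous[OF fG t] this x] show ?thesis by simp
  qed
  have i: "L2_inner unit_cell (\<lambda>x. f (x, 0)) (\<lambda>x. f (x, 0)) = 0" "L2_inner unit_cell (\<lambda>x. f (x, 1)) (\<lambda>x. f (x, 1)) = 0"
    using 0 L2_inner_nonneg[of unit_cell "\<lambda>x. f (x, 0)"] L2_inner_nonneg[of unit_cell "\<lambda>x. f (x, 1)"]
    unfolding face_form_def by linarith+
  have "\<forall>x\<in>unit_cell. f (x, 0) = 0 \<and> f (x, 1) = 0"
  proof (intro ballI conjI)
    fix x :: "real^'d" assume x: "x \<in> unit_cell"
    show "f (x, 0) = 0" by (rule face[OF _ i(1) x]) simp
    show "f (x, 1) = 0" by (rule face[OF _ i(2) x]) simp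
  qed
  then have "f \<in> Gh0 per u T" using Gh0_iff[OF fG] by blast
  moreover from this have "transport_form f f = 0" using f by (simp add: harmonic_def)
  moreover have "z \<in> spacetime per" using z Omega_subset by blast
  ultimately show ?thesis by (rule transport_form_definite)
qed

lemma stability: "\<exists>C\<ge>0. \<forall>f\<in>harmonic. graph_form f f \<le> C * face_form f f"
proof -
  obtain P where P: "finite P" "\<forall>f\<in>Gh per T. (\<forall>p\<in>P. f p = 0) \<longrightarrow> (\<forall>z\<in>Omega. f z = 0)"
    using Gh_determined_by_vertices by blast
  have sub: "harmonic \<subseteq> Gh per T" by (auto simp: harmonic_def)
  have 1: "\<forall>f\<in>harmonic. (\<forall>x\<in>P. f x = 0) \<longrightarrow> face_form f f = 0"
    using P(2) forms_zero(3) sub by blast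
  have 2: "\<forall>f\<in>harmonic. face_form f f = 0 \<longrightarrow> graph_form f f = 0"
    using harmonic_zero_faces forms_zero(2) sub by blast
  show ?thesis
    by (rule psd_form_comparison[OF P(1) harmonic_subspace psd_form_subset[OF face_form_psd sub]
        psd_form_subset[OF graph_form_psd sub] 1 2])
qed

lemma G_norm_eq:
  assumes "f \<in> Gh per T"
  shows "G_norm per u f = sqrt (graph_form f f)"
  unfolding G_norm_def graph_form_def transport_form_def L2_norm_sq
  using L2_inner_transport_deriv[OF assms] by simp

lemma continuous_dependence:
  "\<exists>C\<ge>0. \<forall>gh\<in>Gh per T. \<forall>gh'\<in>Gh per T. \<forall>Ih Ih'.
       discrete_solution per u T (\<lambda>x. gh (x, 0)) (\<lambda>x. gh (x, 1)) Ih \<longrightarrow>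
       discrete_solution per u T (\<lambda>x. gh' (x, 0)) (\<lambda>x. gh' (x, 1)) Ih' \<longrightarrow>
       G_norm per u (\<lambda>z. Ih z - Ih' z) \<le>
         C * sqrt ((L2_norm unit_cell (\<lambda>x. gh (x, 0) - gh' (x, 0)))\<^sup>2 +
                   (L2_norm unit_cell (\<lambda>x. gh (x, 1) - gh' (x, 1)))\<^sup>2)"
proof -
  obtain C where C: "0 \<le> C" "\<forall>f\<in>harmonic. graph_form f f \<le> C * face_form f f" using stability by blast
  have bound: "G_norm per u (\<lambda>z. Ih z - Ih' z) \<le> sqrt C * sqrt ((L2_norm unit_cell (\<lambda>x. gh (x, 0) - gh' (x, 0)))\<^sup>2 +
                   (L2_norm unit_cell (\<lambda>x. gh (x, 1) - gh' (x, 1)))\<^sup>2)"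
    if I: "discrete_solution per u T (\<lambda>x. gh (x, 0)) (\<lambda>x. gh (x, 1)) Ih"
    and I': "discrete_solution per u T (\<lambda>x. gh' (x, 0)) (\<lambda>x. gh' (x, 1)) Ih'" for gh gh' Ih Ih'
  proof -
    define e where "e = (\<lambda>z. Ih z - Ih' z)"
    have G: "Ih \<in> Gh per T" "Ih' \<in> Gh per T" using I I' by (simp_all add: discrete_solution_iff)
    have eG: "e \<in> Gh per T" unfolding e_def by (rule Gh_diff[OF G])
    have "transport_form e g = 0" if "g \<in> Gh0 per u T" for g
      using transport_form_diff[OF G, of g] I I' that Gh0_subset by (auto simp: discrete_solution_iff e_def)
    then have eh: "e \<in> harmonic" using eG by (simp add: harmonic_def)
    have "L2_inner unit_cell (\<lambda>x. e (x, 0)) (\<lambda>x. e (x, 0)) = (L2_norm unit_cell (\<lambda>x. gh (x, 0) - gh' (x, 0)))\<^sup>2"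
      "L2_inner unit_cell (\<lambda>x. e (x, 1)) (\<lambda>x. e (x, 1)) = (L2_norm unit_cell (\<lambda>x. gh (x, 1) - gh' (x, 1)))\<^sup>2"
      unfolding L2_norm_sq L2_inner_def using I I' spat_superset[of per]
      by (auto intro!: Bochner_Integration.integral_cong simp: space_restrict_space discrete_solution_iff e_def subset_iff)
    then have "graph_form e e \<le> C * ((L2_norm unit_cell (\<lambda>x. gh (x, 0) - gh' (x, 0)))\<^sup>2 +
                   (L2_norm unit_cell (\<lambda>x. gh (x, 1) - gh' (x, 1)))\<^sup>2)"
      using bspec[OF C(2) eh] by (simp add: face_form_def)
    then show ?thesis using G_norm_eq[OF eG] by (simp add: e_def[symmetric] real_sqrt_mult[symmetric])
  qed
  show ?thesis
    by (intro exI[of _ "sqrt C"] conjI ballI allI impI bound) (use C(1) in auto)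
qed

end

theorem mainTheorem4:
  fixes per :: bool
    and V :: "(real^'d \<Rightarrow> real^'d) set"
    and normV :: "(real^'d \<Rightarrow> real^'d) \<Rightarrow> real"
    and u :: "real^'d \<Rightarrow> real \<Rightarrow> real^'d"
    and T :: "((real^'d) \<times> real) set set"
    and \<sigma> \<tau> :: real
  assumes "velocity_space per V normV"
    and "admissible_velocity per V normV u"
    and "mesh per T" and "shape_regular \<sigma> T" and "quasi_uniform \<tau> T"
  shows "Gh per T \<subseteq> G_space per u \<and>
    (\<forall>gh\<in>Gh per T.
       (\<exists>Ih. discrete_solution per u T (\<lambda>x. gh (x, 0)) (\<lambda>x. gh (x, 1)) Ih \<and>
          (\<forall>Jh. discrete_solution per u T (\<lambda>x. gh (x, 0)) (\<lambda>x. gh (x, 1)) Jh \<longrightarrow>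
             (\<forall>z\<in>spacetime per. Jh z = Ih z)))) \<and>
    (\<exists>C\<ge>0. \<forall>gh\<in>Gh per T. \<forall>gh'\<in>Gh per T. \<forall>Ih Ih'.
       discrete_solution per u T (\<lambda>x. gh (x, 0)) (\<lambda>x. gh (x, 1)) Ih \<longrightarrow>
       discrete_solution per u T (\<lambda>x. gh' (x, 0)) (\<lambda>x. gh' (x, 1)) Ih' \<longrightarrow>
       G_norm per u (\<lambda>z. Ih z - Ih' z) \<le>
         C * sqrt ((L2_norm unit_cell (\<lambda>x. gh (x, 0) - gh' (x, 0)))\<^sup>2 +
                   (L2_norm unit_cell (\<lambda>x. gh (x, 1) - gh' (x, 1)))\<^sup>2))"
proof -
  interpret transport_fe per V normV u T
    using assms(1-3) by unfold_locales
  show ?thesis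
  proof (intro conjI)
    show "Gh per T \<subseteq> G_space per u" by (rule Gh_subset_G_space)
    show "\<forall>gh\<in>Gh per T.
       (\<exists>Ih. discrete_solution per u T (\<lambda>x. gh (x, 0)) (\<lambda>x. gh (x, 1)) Ih \<and>
          (\<forall>Jh. discrete_solution per u T (\<lambda>x. gh (x, 0)) (\<lambda>x. gh (x, 1)) Jh \<longrightarrow>
             (\<forall>z\<in>spacetime per. Jh z = Ih z)))"
      using solution_exists solution_unique by blast
  qed (rule continuous_dependence)
qed

end
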